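(* Let $n\ge2$, $s\in(\frac12,1]$ and $\mathbf z\in\mathbb R^n$. Then the set $\mathcal N^{1+s}_{\mathbf z}:=\{\gamma\in H^{1+s}(\mathbb R/\mathbb Z,\mathbb R^n):|\gamma'|=1\text{ on }\mathbb R/\mathbb Z,\ \gamma(0)=\mathbf z\}$ is a smooth submanifold of the open subset $H^{1+s}_{\mathrm r}(\mathbb R/\mathbb Z,\mathbb R^n)$ of $H^{1+s}(\mathbb R/\mathbb Z,\mathbb R^n)$, and the set $\mathcal A^{1+s}_{\mathbf z}:=\{\gamma\in\mathcal N^{1+s}_{\mathbf z}:\gamma|_{[0,1)}\text{ injective}\}$ is a smooth submanifold of the open subset $H^{1+s}_{\mathrm{ir}}(\mathbb R/\mathbb Z,\mathbb R^n)$ of $H^{1+s}(\mathbb R/\mathbb Z,\mathbb R^n)$.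
   Context: $\mathbb R/\mathbb Z$ is the circle of length $1$. $H^{1+s}(\mathbb R/\mathbb Z,\mathbb R^n)=W^{1+s,2}(\mathbb R/\mathbb Z,\mathbb R^n)$ is the (for $s<1$ fractional) Sobolev Hilbert space of $1$-periodic functions, which for $s>\frac12$ embeds compactly into $C^1(\mathbb R/\mathbb Z,\mathbb R^n)$. $H^{1+s}_{\mathrm r}$ is the open subset of regular curves ($|\gamma'|>0$ everywhere), and $H^{1+s}_{\mathrm{ir}}$ is the open subset of regular curves that are injective on $[0,1)$. *)

theory Defs
  imports "HOL-Analysis.Analysis" "HOL-Library.Function_Algebras"
begin

text \<open>
  The Sobolev spaces depend on a real parameter, so they cannot be types of a Banach space class.
  They are treated as linear subspaces \<open>E\<close> of the function space, with a norm \<open>N\<close> given as a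
  real-valued functional.  Linear operations on functions are pointwise.
\<close>

instantiation "fun" :: (type, real_vector) real_vector
begin

definition scaleR_fun :: "real \<Rightarrow> ('a \<Rightarrow> 'b) \<Rightarrow> 'a \<Rightarrow> 'b"
  where "scaleR_fun c f = (\<lambda>x. c *\<^sub>R f x)"

instance
  by standard (simp_all add: scaleR_fun_def plus_fun_def fun_eq_iff algebra_simps)

end

section \<open>Smooth maps and submanifolds in normed spaces\<close>

definition norm_topology :: "'a::real_vector set \<Rightarrow> ('a \<Rightarrow> real) \<Rightarrow> 'a topology"
  where "norm_topology E N = Metric_space.mtopology E (\<lambda>x y. N (x - y))"

definition bounded_multilinear ::
    "'a::real_vector set \<Rightarrow> ('a \<Rightarrow> real) \<Rightarrow> 'b::real_vector set \<Rightarrow> ('b \<Rightarrow> real)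
      \<Rightarrow> nat \<Rightarrow> ('a list \<Rightarrow> 'b) \<Rightarrow> bool"
  where "bounded_multilinear E N E' N' k A \<longleftrightarrow>
    (\<forall>vs\<in>lists E. length vs = k \<longrightarrow> A vs \<in> E') \<and>
    (\<forall>vs\<in>lists E. length vs = k \<longrightarrow>
      (\<forall>i<k. \<forall>u\<in>E. \<forall>v\<in>E. \<forall>a b.
        A (vs[i := a *\<^sub>R u + b *\<^sub>R v]) = a *\<^sub>R A (vs[i := u]) + b *\<^sub>R A (vs[i := v]))) \<and>
    (\<exists>C. \<forall>vs\<in>lists E. length vs = k \<longrightarrow> N' (A vs) \<le> C * prod_list (map N vs))"

text \<open>
  \<open>f\<close> is infinitely often Frechet differentiable on the open set \<open>U\<close>.  The \<open>k\<close>-th derivative at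
  \<open>x\<close> is the bounded \<open>k\<close>-linear map \<open>D k x\<close> (the arguments form a list of length \<open>k\<close>, the most recent
  direction of differentiation comes first), and \<open>D (Suc k) x\<close> is the Frechet derivative of \<open>D k\<close> at
  \<open>x\<close> with respect to the operator norm on \<open>k\<close>-linear maps.
\<close>

definition smooth_map ::
    "'a::real_vector set \<Rightarrow> ('a \<Rightarrow> real) \<Rightarrow> 'b::real_vector set \<Rightarrow> ('b \<Rightarrow> real)
      \<Rightarrow> 'a set \<Rightarrow> ('a \<Rightarrow> 'b) \<Rightarrow> bool"
  where "smooth_map E N E' N' U f \<longleftrightarrow>
    openin (norm_topology E N) U \<and>
    (\<exists>D :: nat \<Rightarrow> 'a \<Rightarrow> 'a list \<Rightarrow> 'b.
      (\<forall>x\<in>U. D 0 x [] = f x) \<and>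
      (\<forall>k. \<forall>x\<in>U. bounded_multilinear E N E' N' k (D k x)) \<and>
      (\<forall>k. \<forall>x\<in>U. \<forall>\<epsilon>>0. \<exists>\<delta>>0. \<forall>y\<in>U. N (y - x) < \<delta> \<longrightarrow>
        (\<forall>vs\<in>lists {v \<in> E. N v \<le> 1}. length vs = k \<longrightarrow>
          N' (D k y vs - D k x vs - D (Suc k) x ((y - x) # vs)) \<le> \<epsilon> * N (y - x))))"

definition smooth_diffeo ::
    "'a::real_vector set \<Rightarrow> ('a \<Rightarrow> real) \<Rightarrow> 'a set \<Rightarrow> 'a set \<Rightarrow> ('a \<Rightarrow> 'a) \<Rightarrow> bool"
  where "smooth_diffeo E N V W \<phi> \<longleftrightarrow>
    bij_betw \<phi> V W \<and> smooth_map E N E N V \<phi> \<and> smooth_map E N E N W (inv_into V \<phi>)"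

definition complemented_subspace ::
    "'a::real_vector set \<Rightarrow> ('a \<Rightarrow> real) \<Rightarrow> 'a set \<Rightarrow> bool"
  where "complemented_subspace E N F \<longleftrightarrow>
    subspace F \<and> closedin (norm_topology E N) F \<and>
    (\<exists>G. subspace G \<and> closedin (norm_topology E N) G \<and> F \<inter> G = {0} \<and>
         E = {x + y | x y. x \<in> F \<and> y \<in> G})"

text \<open>
  \<open>M\<close> is a smooth submanifold of the open subset \<open>U\<close> of the Banach space \<open>(E, N)\<close>: near each of its
  points it is straightened to a closed complemented linear subspace by a smooth chart of \<open>U\<close>.
\<close>

definition smooth_submanifold ::
    "'a::real_vector set \<Rightarrow> ('a \<Rightarrow> real) \<Rightarrow> 'a set \<Rightarrow> 'a set \<Rightarrow> bool"
  where "smooth_submanifold E N U M \<longleftrightarrow>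
    openin (norm_topology E N) U \<and> M \<subseteq> U \<and>
    (\<forall>p\<in>M. \<exists>V W \<phi> F.
      p \<in> V \<and> V \<subseteq> U \<and> openin (norm_topology E N) V \<and> openin (norm_topology E N) W \<and>
      smooth_diffeo E N V W \<phi> \<and> complemented_subspace E N F \<and>
      \<phi> ` (M \<inter> V) = F \<inter> W)"

section \<open>Sobolev spaces of periodic functions\<close>

definition periodic1 :: "(real \<Rightarrow> 'a) \<Rightarrow> bool"
  where "periodic1 f \<longleftrightarrow> (\<forall>t. f (t + 1) = f t)"

definition l2_sq :: "(real \<Rightarrow> 'a::euclidean_space) \<Rightarrow> ennreal"
  where "l2_sq f = (\<integral>\<^sup>+t\<in>{0..1}. ennreal ((norm (f t))\<^sup>2) \<partial>lborel)"

definition l2_periodic :: "(real \<Rightarrow> 'a::euclidean_space) set"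
  where "l2_periodic = {f. periodic1 f \<and> f \<in> borel_measurable borel \<and> l2_sq f < \<infinity>}"

definition smooth_test_function :: "(real \<Rightarrow> real) \<Rightarrow> bool"
  where "smooth_test_function \<phi> \<longleftrightarrow>
    periodic1 \<phi> \<and> (\<forall>k t. ((deriv ^^ k) \<phi>) differentiable (at t))"

definition has_weak_deriv ::
    "(real \<Rightarrow> 'a::euclidean_space) \<Rightarrow> (real \<Rightarrow> 'a) \<Rightarrow> bool"
  where "has_weak_deriv f g \<longleftrightarrow>
    f \<in> l2_periodic \<and> g \<in> l2_periodic \<and>
    (\<forall>\<phi>. smooth_test_function \<phi> \<longrightarrow>
      (LINT t:{0..1}|lborel. deriv \<phi> t *\<^sub>R f t) = - (LINT t:{0..1}|lborel. \<phi> t *\<^sub>R g t))"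

text \<open>
  A weak derivative is unique only almost everywhere; \<open>weak_deriv\<close> is used only inside integrals
  that do not depend on the representative.
\<close>

definition weak_deriv :: "(real \<Rightarrow> 'a::euclidean_space) \<Rightarrow> real \<Rightarrow> 'a"
  where "weak_deriv f = (SOME g. has_weak_deriv f g)"

text \<open>
  The squared Gagliardo (Sobolev--Slobodeckij) seminorm of order \<open>s\<close> on the circle; for
  \<open>w \<in> [-1/2, 1/2]\<close> the points \<open>u + w\<close> and \<open>u\<close> of the circle have distance \<open>\<bar>w\<bar>\<close>.
\<close>

definition gagliardo_sq :: "real \<Rightarrow> (real \<Rightarrow> 'a::euclidean_space) \<Rightarrow> ennreal"
  where "gagliardo_sq s g =
    (\<integral>\<^sup>+u\<in>{0..1}. (\<integral>\<^sup>+w\<in>{-1/2..1/2}.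
      ennreal ((norm (g (u + w) - g u))\<^sup>2 / \<bar>w\<bar> powr (1 + 2 * s)) \<partial>lborel) \<partial>lborel)"

text \<open>
  \<open>sobolev_space s\<close> is the space \<open>H\<close> of order \<open>1 + s\<close> for \<open>0 < s \<le> 1\<close>.  Each of its elements, an
  almost-everywhere class, is represented by its continuous representative.
\<close>

definition sobolev_space :: "real \<Rightarrow> (real \<Rightarrow> 'a::euclidean_space) set"
  where "sobolev_space s = {\<gamma>. continuous_on UNIV \<gamma> \<and>
    (\<exists>g. has_weak_deriv \<gamma> g \<and>
      (if s < 1 then gagliardo_sq s g < \<infinity> else \<exists>h. has_weak_deriv g h))}"

definition sobolev_norm :: "real \<Rightarrow> (real \<Rightarrow> 'a::euclidean_space) \<Rightarrow> real"
  where "sobolev_norm s \<gamma> = sqrt (enn2real (l2_sq \<gamma> + l2_sq (weak_deriv \<gamma>) +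
    (if s < 1 then gagliardo_sq s (weak_deriv \<gamma>) else l2_sq (weak_deriv (weak_deriv \<gamma>)))))"

text \<open>
  For \<open>s > 1/2\<close> the elements of \<open>sobolev_space s\<close> are continuously differentiable, so pointwise
  conditions on the derivative refer to the classical derivative.
\<close>

definition regular_curves :: "real \<Rightarrow> (real \<Rightarrow> 'a::euclidean_space) set"
  where "regular_curves s =
    {\<gamma> \<in> sobolev_space s. \<forall>t. norm (vector_derivative \<gamma> (at t)) > 0}"

definition injective_regular_curves :: "real \<Rightarrow> (real \<Rightarrow> 'a::euclidean_space) set"
  where "injective_regular_curves s = {\<gamma> \<in> regular_curves s. inj_on \<gamma> {0..<1}}"

definition arclength_curves :: "real \<Rightarrow> 'a::euclidean_space \<Rightarrow> (real \<Rightarrow> 'a) set"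
  where "arclength_curves s z =
    {\<gamma> \<in> sobolev_space s. (\<forall>t. norm (vector_derivative \<gamma> (at t)) = 1) \<and> \<gamma> 0 = z}"

definition injective_arclength_curves :: "real \<Rightarrow> 'a::euclidean_space \<Rightarrow> (real \<Rightarrow> 'a) set"
  where "injective_arclength_curves s z = {\<gamma> \<in> arclength_curves s z. inj_on \<gamma> {0..<1}}"

end

theory Submission
  imports Defs
begin

text \<open>Let \<open>\<gamma>\<close> be a closed curve of unit speed with derivative \<open>g\<close>.  A nearby closed curve \<open>\<gamma> + v\<close> has unit
speed if and only if \<open>g t \<bullet> v' t + \<bar>v' t\<bar>\<^sup>2 / 2 = 0\<close> for all \<open>t\<close>.  This is precisely the component along
\<open>g\<close> of \<open>v' + (\<bar>v'\<bar>\<^sup>2 / 2) g\<close>, an expression that differs from \<open>v'\<close> by a quadratic term only.  So on the level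
of derivatives this expression is a chart that turns the condition of unit speed into the linear condition of
being orthogonal to \<open>g\<close>.  Derivatives of closed curves have mean zero, however, and the quadratic term does not.
It is therefore corrected by one of the fields \<open>c - (c \<bullet> g) g\<close> with a constant vector \<open>c\<close>.  These are
orthogonal to \<open>g\<close>, so the correction leaves the component along \<open>g\<close> alone, and the mean can always be
corrected: if the field belonging to \<open>c\<close> has mean zero, then \<open>c\<close> is everywhere parallel to \<open>g\<close>, while Rolle's
theorem for \<open>c \<bullet> \<gamma>\<close> gives a point at which \<open>c\<close> is orthogonal to \<open>g\<close>; hence \<open>c = 0\<close>
(lemma \<open>mean_tang_inj\<close>).  Integration yields a chart \<open>\<gamma> + v \<mapsto> v + B v v\<close> of the space of
closed curves, with a bounded symmetric bilinear map \<open>B\<close>.  It takes the curves of unit speed that start at \<open>\<gamma> 0\<close>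
to the subspace of all \<open>v\<close> with \<open>v 0 = 0\<close> and \<open>v'\<close> orthogonal to \<open>g\<close> (lemma \<open>straightened\<close>), and that
subspace is the range of a bounded projection (lemma \<open>complemented_tangential\<close>).

That \<open>x \<mapsto> x + B x x\<close> is a local diffeomorphism at \<open>0\<close> of a Banach space follows from the contraction principle.
The derivatives of its inverse are found by differentiating the equation \<open>x + B x x = y\<close>: the derivative of
order \<open>k\<close> solves a linear equation whose right hand side is a sum, over all splittings of the \<open>k\<close> directions into two
nonempty parts, of \<open>B\<close> applied to two derivatives of lower order.  This recursion serves as the definition of the
derivatives, and an induction on \<open>k\<close> shows that consecutive ones are related by a remainder of second order
(lemma \<open>bounds_step\<close>).  The outcome is the criterion \<open>smooth_submanifoldI\<close>.

What is needed about the Sobolev space is that it is complete (theorem \<open>banach_sobolev_space\<close>), that its norm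
dominates the \<open>C\<^sup>1\<close> norm (theorem \<open>sobolev_embedding_C1\<close>, which uses \<open>s > 1/2\<close>), and that the derivatives
form an algebra (lemma \<open>hs_bd_prod\<close>), which makes \<open>B\<close> bounded.  The \<open>C\<^sup>1\<close> bound also shows that the regular
curves and the injective regular curves form open sets.\<close>

section \<open>Normed subspaces\<close>

text \<open>Nonnegativity and symmetry are required on the whole type, not only on \<open>E\<close>, because a \<open>Metric_space\<close> requires
them of its distance function.\<close>

locale normed_subspace =
  fixes E :: "'a::real_vector set" and N :: "'a \<Rightarrow> real"
  assumes subspace_E: "subspace E"
    and N_nonneg [simp]: "0 \<le> N x"
    and N_minus [simp]: "N (- x) = N x"
    and N_triangle: "x \<in> E \<Longrightarrow> y \<in> E \<Longrightarrow> N (x + y) \<le> N x + N y"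
    and N_scale: "x \<in> E \<Longrightarrow> N (c *\<^sub>R x) = \<bar>c\<bar> * N x"
    and N_eq_0: "x \<in> E \<Longrightarrow> N x = 0 \<Longrightarrow> x = 0"
begin

lemma E_0 [simp]: "0 \<in> E"
  and E_add [simp]: "x \<in> E \<Longrightarrow> y \<in> E \<Longrightarrow> x + y \<in> E"
  and E_diff [simp]: "x \<in> E \<Longrightarrow> y \<in> E \<Longrightarrow> x - y \<in> E"
  and E_scale [simp]: "x \<in> E \<Longrightarrow> c *\<^sub>R x \<in> E"
  and E_minus [simp]: "x \<in> E \<Longrightarrow> - x \<in> E"
  using subspace_E
  by (simp_all add: subspace_0 subspace_add subspace_diff subspace_scale subspace_neg)

lemma N_0 [simp]: "N 0 = 0"
  using N_scale[of 0 0] by simp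

lemma N_commute: "N (x - y) = N (y - x)"
  using N_minus[of "x - y"] by simp

lemma N_diff: "x \<in> E \<Longrightarrow> y \<in> E \<Longrightarrow> N (x - y) \<le> N x + N y"
  using N_triangle[of x "- y"] by simp

lemma N_diff_triangle: "x \<in> E \<Longrightarrow> y \<in> E \<Longrightarrow> z \<in> E \<Longrightarrow> N (x - z) \<le> N (x - y) + N (y - z)"
  using N_triangle[of "x - y" "y - z"] by simp

lemma Metric_space_N: "Metric_space E (\<lambda>x y. N (x - y))"
proof
  show "N (x - y) = 0 \<longleftrightarrow> x = y" if "x \<in> E" "y \<in> E" for x y
    using N_eq_0[of "x - y"] that by auto
qed (auto intro: N_commute N_diff_triangle)

lemma openin_norm_topology:
  "openin (norm_topology E N) U \<longleftrightarrow>
    U \<subseteq> E \<and> (\<forall>x\<in>U. \<exists>r>0. \<forall>y\<in>E. N (y - x) < r \<longrightarrow> y \<in> U)"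
proof -
  interpret Metric_space E "\<lambda>x y. N (x - y)" by (rule Metric_space_N)
  have "mball x r \<subseteq> U \<longleftrightarrow> (\<forall>y\<in>E. N (y - x) < r \<longrightarrow> y \<in> U)" if "x \<in> E" for x r
    using that by (auto simp: subset_iff N_commute[of x])
  then have "(\<exists>r>0. mball x r \<subseteq> U) \<longleftrightarrow> (\<exists>r>0. \<forall>y\<in>E. N (y - x) < r \<longrightarrow> y \<in> U)" if "x \<in> E" for x
    using that by simp
  then show ?thesis
    unfolding norm_topology_def openin_mtopology Ball_def by (auto simp: subset_iff)
qed

lemma topspace_norm_topology [simp]: "topspace (norm_topology E N) = E"
  by (simp add: norm_topology_def Metric_space.topspace_mtopology[OF Metric_space_N])

lemma openin_ball: "openin (norm_topology E N) {x \<in> E. N (x - a) < r}" if "a \<in> E"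
  unfolding openin_norm_topology
proof (intro conjI ballI)
  fix x assume x: "x \<in> {x \<in> E. N (x - a) < r}"
  have "N (y - a) < r" if "y \<in> E" "N (y - x) < r - N (x - a)" for y
    using N_diff_triangle[of y x a] that x \<open>a \<in> E\<close> by auto
  then show "\<exists>e>0. \<forall>y\<in>E. N (y - x) < e \<longrightarrow> y \<in> {x \<in> E. N (x - a) < r}"
    using x by (intro exI[of _ "r - N (x - a)"]) auto
qed auto

lemma closedin_zeros:
  assumes add: "\<And>x y. x \<in> E \<Longrightarrow> y \<in> E \<Longrightarrow> T (x - y) = T x - T y"
    and bd: "\<And>x. x \<in> E \<Longrightarrow> T x \<in> E \<and> N (T x) \<le> c * N x"
  shows "closedin (norm_topology E N) {x \<in> E. T x = 0}"
  unfolding closedin_def topspace_norm_topology openin_norm_topology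
proof (intro conjI ballI)
  fix x assume x: "x \<in> E - {x \<in> E. T x = 0}"
  then have "N (T x) > 0"
    using N_eq_0[of "T x"] bd[of x] N_nonneg[of "T x"] by (metis (mono_tags) DiffE mem_Collect_eq less_eq_real_def)
  have "T y \<noteq> 0" if "y \<in> E" "N (y - x) < N (T x) / (\<bar>c\<bar> + 1)" for y
  proof
    assume "T y = 0"
    then have "N (T x) = N (T (y - x))" using add[of y x] that x by simp
    also have "\<dots> \<le> c * N (y - x)" using bd that x by auto
    also have "\<dots> \<le> (\<bar>c\<bar> + 1) * N (y - x)" by (intro mult_right_mono) auto
    also have "\<dots> < N (T x)" using that(2) by (simp add: field_simps)
    finally show False by simp
  qed
  then show "\<exists>r>0. \<forall>y\<in>E. N (y - x) < r \<longrightarrow> y \<in> E - {x \<in> E. T x = 0}"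
    using \<open>N (T x) > 0\<close> by (intro exI[of _ "N (T x) / (\<bar>c\<bar> + 1)"]) auto
qed auto

text \<open>The kernel of the projection is a closed complement of its range.\<close>

lemma complemented_range_of_projection:
  assumes add: "\<And>x y. x \<in> E \<Longrightarrow> y \<in> E \<Longrightarrow> T (x + y) = T x + T y"
    and scale: "\<And>x a. x \<in> E \<Longrightarrow> T (a *\<^sub>R x) = a *\<^sub>R T x"
    and bd: "\<And>x. x \<in> E \<Longrightarrow> T x \<in> E \<and> N (T x) \<le> c * N x"
    and idem: "\<And>x. x \<in> E \<Longrightarrow> T (T x) = T x"
  shows "complemented_subspace E N {x \<in> E. T x = x}"
proof -
  have T0: "T 0 = 0" using scale[of 0 0] by simp
  have minus: "T (x - y) = T x - T y" if "x \<in> E" "y \<in> E" for x y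
    using add[of x "-y"] scale[of y "-1"] that by simp
  have sF: "subspace {x \<in> E. T x = x}" and sG: "subspace {x \<in> E. T x = 0}"
    by (auto simp: subspace_def add scale T0)
  have cG: "closedin (norm_topology E N) {x \<in> E. T x = 0}"
    by (rule closedin_zeros[where c = c]) (auto simp: minus bd)
  have "closedin (norm_topology E N) {x \<in> E. x - T x = 0}"
  proof (rule closedin_zeros[where c = "1 + c"])
    show "x - T x \<in> E \<and> N (x - T x) \<le> (1 + c) * N x" if "x \<in> E" for x
      using that bd[of x] N_diff[of x "T x"] by (auto simp: algebra_simps)
  qed (simp add: minus)
  then have cF: "closedin (norm_topology E N) {x \<in> E. T x = x}"
    unfolding right_minus_eq eq_commute[of _ "T _"] .
  have "E = {x + y |x y. x \<in> {x \<in> E. T x = x} \<and> y \<in> {x \<in> E. T x = 0}}" (is "_ = ?S")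
  proof
    show "E \<subseteq> ?S"
    proof
      fix x assume x: "x \<in> E"
      have Tx: "T x \<in> E" using bd[OF x] by simp
      have 1: "T x \<in> {x \<in> E. T x = x}" using Tx idem[OF x] by simp
      have "T (x - T x) = 0" using minus[OF x Tx] idem[OF x] by simp
      then have 2: "x - T x \<in> {x \<in> E. T x = 0}" using x Tx by simp
      show "x \<in> ?S"
        by (rule CollectI, rule exI[of _ "T x"], rule exI[of _ "x - T x"]) (use 1 2 in simp)
    qed
    show "?S \<subseteq> E" by clarify (rule E_add)
  qed
  moreover have "{x \<in> E. T x = x} \<inter> {x \<in> E. T x = 0} = {0}"
  proof (intro equalityI subsetI)
    show "x \<in> {0}" if "x \<in> {x \<in> E. T x = x} \<inter> {x \<in> E. T x = 0}" for x
      using that by (metis (mono_tags, lifting) Int_iff mem_Collect_eq singletonI)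
  qed (simp add: T0)
  ultimately show ?thesis
    unfolding complemented_subspace_def
    by (intro conjI exI[of _ "{x \<in> E. T x = 0}"] sF sG cF cG)
qed

abbreviation P :: "'a list \<Rightarrow> real" where "P vs \<equiv> prod_list (map N vs)"

lemma P_nonneg: "0 \<le> P vs"
  by (induction vs) auto

lemma P_le_1: "vs \<in> lists {v \<in> E. N v \<le> 1} \<Longrightarrow> P vs \<le> 1"
  by (induction vs) (auto intro!: mult_le_one P_nonneg)

text \<open>All maps below satisfy a remainder estimate of second order that is uniform on \<open>U\<close>.  This is stronger than
differentiability and is easier to carry through an induction than statements with \<open>\<epsilon>\<close> and \<open>\<delta>\<close>.\<close>

lemma smooth_mapI:
  fixes D :: "'a \<Rightarrow> 'a list \<Rightarrow> 'a"
  assumes U: "openin (norm_topology E N) U"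
    and D0: "\<And>x. x \<in> U \<Longrightarrow> D x [] = f x"
    and closed: "\<And>x vs. x \<in> U \<Longrightarrow> vs \<in> lists E \<Longrightarrow> D x vs \<in> E"
    and linear: "\<And>x xs ys u v a b. x \<in> U \<Longrightarrow> xs \<in> lists E \<Longrightarrow> ys \<in> lists E \<Longrightarrow> u \<in> E \<Longrightarrow> v \<in> E \<Longrightarrow>
        D x (xs @ (a *\<^sub>R u + b *\<^sub>R v) # ys) = a *\<^sub>R D x (xs @ u # ys) + b *\<^sub>R D x (xs @ v # ys)"
    and bounded: "\<And>k x. x \<in> U \<Longrightarrow> \<exists>C. \<forall>vs\<in>lists E. length vs = k \<longrightarrow> N (D x vs) \<le> C * P vs"
    and remainder: "\<And>k. \<exists>C. \<forall>x\<in>U. \<forall>y\<in>U. \<forall>vs\<in>lists E. length vs = k \<longrightarrow>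
        N (D y vs - D x vs - D x ((y - x) # vs)) \<le> C * (N (y - x))\<^sup>2 * P vs"
  shows "smooth_map E N E N U f"
  unfolding smooth_map_def
proof (intro conjI exI[of _ "\<lambda>_. D"] allI ballI impI)
  show "bounded_multilinear E N E N k (D x)" if "x \<in> U" for k x
    unfolding bounded_multilinear_def
  proof (intro conjI ballI impI allI)
    fix vs i u v a b
    assume vs: "vs \<in> lists E" "length vs = k" and "i < k" and uv: "u \<in> E" "v \<in> E"
    have "take i vs \<in> lists E" "drop (Suc i) vs \<in> lists E"
      using vs by (auto dest: in_set_takeD in_set_dropD)
    then show "D x (vs[i := a *\<^sub>R u + b *\<^sub>R v]) = a *\<^sub>R D x (vs[i := u]) + b *\<^sub>R D x (vs[i := v])"
      using linear[OF \<open>x \<in> U\<close>] uv vs \<open>i < k\<close> by (simp add: upd_conv_take_nth_drop)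
  qed (use that closed bounded in auto)
next
  fix k x and e :: real assume x: "x \<in> U" and e: "0 < e"
  obtain C where C: "\<forall>x\<in>U. \<forall>y\<in>U. \<forall>vs\<in>lists E. length vs = k \<longrightarrow>
        N (D y vs - D x vs - D x ((y - x) # vs)) \<le> C * (N (y - x))\<^sup>2 * P vs"
    using remainder by blast
  show "\<exists>\<delta>>0. \<forall>y\<in>U. N (y - x) < \<delta> \<longrightarrow>
          (\<forall>vs\<in>lists {v \<in> E. N v \<le> 1}. length vs = k \<longrightarrow>
            N (D y vs - D x vs - D x ((y - x) # vs)) \<le> e * N (y - x))"
  proof (intro exI[of _ "e / (\<bar>C\<bar> + 1)"] conjI ballI impI)
    fix y vs assume y: "y \<in> U" "N (y - x) < e / (\<bar>C\<bar> + 1)"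
      and vs: "vs \<in> lists {v \<in> E. N v \<le> 1}" "length vs = k"
    have "N (D y vs - D x vs - D x ((y - x) # vs)) \<le> C * (N (y - x))\<^sup>2 * P vs"
      using C x y vs by (simp add: lists_eq_set subset_iff)
    also have "\<dots> \<le> (\<bar>C\<bar> + 1) * (N (y - x))\<^sup>2 * 1"
      using P_le_1[OF vs(1)] by (intro mult_mono) (auto simp: P_nonneg)
    also have "\<dots> = ((\<bar>C\<bar> + 1) * N (y - x)) * N (y - x)"
      by (simp add: power2_eq_square)
    also have "\<dots> \<le> e * N (y - x)"
      using y(2) by (intro mult_right_mono) (auto simp: field_simps)
    finally show "N (D y vs - D x vs - D x ((y - x) # vs)) \<le> e * N (y - x)" .
  qed (use e in auto)
qed (use U D0 in auto)

end

section \<open>Sums over splittings of a list\<close>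

text \<open>The sum runs over all ways to distribute the entries of a list over two lists without changing their order.  It is
the index set of the Leibniz rule for higher derivatives of a bilinear expression, where the entries are the
directions of differentiation.\<close>

fun split_sum :: "('a list \<Rightarrow> 'a list \<Rightarrow> 'b) \<Rightarrow> 'a list \<Rightarrow> 'b::comm_monoid_add" where
  "split_sum F [] = F [] []"
| "split_sum F (x # xs) = split_sum (\<lambda>a b. F (x # a) b) xs + split_sum (\<lambda>a b. F a (x # b)) xs"

lemma split_sum_cong [fundef_cong]:
  assumes "xs = ys"
    and "\<And>a b. length a + length b = length ys \<Longrightarrow> set a \<subseteq> set ys \<Longrightarrow> set b \<subseteq> set ys \<Longrightarrow> F a b = G a b"
  shows "split_sum F xs = split_sum G ys"
  using assms(2) unfolding assms(1)
proof (induction ys arbitrary: F G)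
  case (Cons x ys)
  have "split_sum (\<lambda>a b. F (x # a) b) ys = split_sum (\<lambda>a b. G (x # a) b) ys"
       "split_sum (\<lambda>a b. F a (x # b)) ys = split_sum (\<lambda>a b. G a (x # b)) ys"
    by (intro Cons.IH Cons.prems; auto)+
  then show ?case by simp
qed simp

lemma split_sum_add: "split_sum (\<lambda>a b. F a b + G a b) xs = split_sum F xs + split_sum G xs"
  by (induction xs arbitrary: F G) (simp_all add: add_ac)

lemma split_sum_scaleR:
  "split_sum (\<lambda>a b. c *\<^sub>R F a b) xs = c *\<^sub>R (split_sum F xs :: 'b::real_vector)"
  by (induction xs arbitrary: F) (simp_all add: scaleR_add_right)

lemma split_sum_diff:
  "split_sum (\<lambda>a b. F a b - G a b) xs = split_sum F xs - (split_sum G xs :: 'b::real_vector)"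
  by (induction xs arbitrary: F G) simp_all

text \<open>Used to isolate one entry of the list, which goes to either side of each splitting.\<close>

lemma split_sum_append:
  "split_sum F (xs @ ys) = split_sum (\<lambda>a b. split_sum (\<lambda>a' b'. F (a @ a') (b @ b')) ys) xs"
  by (induction xs arbitrary: F) simp_all

lemma split_sum_0 [simp]: "split_sum (\<lambda>a b. 0) xs = 0"
  by (induction xs) simp_all

lemma split_sum_left_Nil: "split_sum (\<lambda>a b. if a = [] then f b else 0) xs = f xs"
proof (induction xs arbitrary: f)
  case (Cons x xs)
  show ?case using Cons.IH[of "\<lambda>b. f (x # b)"] by simp
qed simp

lemma split_sum_right_Nil: "split_sum (\<lambda>a b. if b = [] then f a else 0) xs = f xs"
proof (induction xs arbitrary: f)
  case (Cons x xs)
  show ?case using Cons.IH[of "\<lambda>b. f (x # b)"] by simp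
qed simp

lemma (in normed_subspace) split_sum_bound:
  assumes "xs \<in> lists E"
    and "\<And>a b. a \<in> lists E \<Longrightarrow> b \<in> lists E \<Longrightarrow> length a + length b = length xs \<Longrightarrow>
           F a b \<in> E \<and> N (F a b) \<le> c * (P a * P b)"
  shows "split_sum F xs \<in> E \<and> N (split_sum F xs) \<le> 2 ^ length xs * c * P xs"
  using assms
proof (induction xs arbitrary: F c)
  case Nil
  then show ?case using Nil(1)[of "[]" "[]"] by simp
next
  case (Cons x xs)
  have x: "x \<in> E" "xs \<in> lists E" using Cons.hyps by auto
  have 1: "split_sum (\<lambda>a b. F (x # a) b) xs \<in> E \<and>
      N (split_sum (\<lambda>a b. F (x # a) b) xs) \<le> 2 ^ length xs * (c * N x) * P xs"
  proof (rule Cons.IH)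
    show "F (x # a) b \<in> E \<and> N (F (x # a) b) \<le> c * N x * (P a * P b)"
      if "a \<in> lists E" "b \<in> lists E" "length a + length b = length xs" for a b
      using Cons.prems[of "x # a" b] that x by (simp add: mult_ac)
  qed
  have 2: "split_sum (\<lambda>a b. F a (x # b)) xs \<in> E \<and>
      N (split_sum (\<lambda>a b. F a (x # b)) xs) \<le> 2 ^ length xs * (c * N x) * P xs"
  proof (rule Cons.IH)
    show "F a (x # b) \<in> E \<and> N (F a (x # b)) \<le> c * N x * (P a * P b)"
      if "a \<in> lists E" "b \<in> lists E" "length a + length b = length xs" for a b
      using Cons.prems[of a "x # b"] that x by (simp add: mult_ac)
  qed
  from 1 2 show ?case
    using N_triangle[of "split_sum (\<lambda>a b. F (x # a) b) xs" "split_sum (\<lambda>a b. F a (x # b)) xs"]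
    by (auto simp: algebra_simps)
qed

section \<open>Quadratic perturbations of the identity\<close>

locale banach_subspace = normed_subspace +
  assumes complete:
    "(\<And>n. X n \<in> E) \<Longrightarrow> (\<And>e. e > 0 \<Longrightarrow> \<exists>M. \<forall>m\<ge>M. \<forall>n\<ge>M. N (X m - X n) < e) \<Longrightarrow>
      \<exists>x\<in>E. (\<lambda>n. N (X n - x)) \<longlonglongrightarrow> 0"
begin

text \<open>The iterates approach each other geometrically, as in Banach's fixed point theorem.\<close>

lemma contraction_fixpoint:
  assumes C: "C \<subseteq> E" and T: "\<And>x. x \<in> C \<Longrightarrow> T x \<in> C" and w: "w \<in> C"
    and closed: "\<And>X x. (\<And>n::nat. X n \<in> C) \<Longrightarrow> x \<in> E \<Longrightarrow> (\<lambda>n. N (X n - x)) \<longlonglongrightarrow> 0 \<Longrightarrow> x \<in> C"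
    and half: "\<And>x y. x \<in> C \<Longrightarrow> y \<in> C \<Longrightarrow> N (T x - T y) \<le> N (x - y) / 2"
  shows "\<exists>x\<in>C. T x = x"
proof -
  define X where "X n = (T ^^ n) w" for n
  have XC: "X n \<in> C" for n
    by (induction n) (auto simp: X_def w T)
  then have XE: "X n \<in> E" for n using C by blast
  define d where "d = N (T w - w)"
  have step: "N (X (Suc n) - X n) \<le> d / 2 ^ n" for n
  proof (induction n)
    case (Suc n)
    have "N (X (Suc (Suc n)) - X (Suc n)) \<le> N (X (Suc n) - X n) / 2"
      using half[OF XC[of "Suc n"] XC[of n]] by (simp add: X_def)
    also have "\<dots> \<le> d / 2 ^ n / 2" using Suc by (intro divide_right_mono) auto
    finally show ?case by (simp add: field_simps)
  qed (simp add: X_def d_def)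
  have tail: "N (X (n + k) - X n) \<le> 2 * d / 2 ^ n - 2 * d / 2 ^ (n + k)" for n k
  proof (induction k)
    case (Suc k)
    have "N (X (n + Suc k) - X n) \<le> N (X (Suc (n + k)) - X (n + k)) + N (X (n + k) - X n)"
      using N_diff_triangle[OF XE XE XE] by simp
    moreover have "d / 2 ^ (n + k) = 2 * d / 2 ^ (n + k) - 2 * d / 2 ^ (n + Suc k)"
      by (simp add: field_simps)
    ultimately show ?case using Suc step[of "n + k"] by linarith
  qed simp
  have d0: "d \<ge> 0" by (simp add: d_def)
  have tail': "N (X m - X n) \<le> 2 * d / 2 ^ n" if "n \<le> m" for m n
    using tail[of n "m - n"] that d0 by (smt (verit) divide_nonneg_pos le_add_diff_inverse zero_less_power)
  have "\<exists>x\<in>E. (\<lambda>n. N (X n - x)) \<longlonglongrightarrow> 0"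
  proof (rule complete[OF XE])
    fix e :: real assume "e > 0"
    have "(\<lambda>n. 2 * d / 2 ^ n) \<longlonglongrightarrow> 0"
      by (intro tendsto_divide_0[OF tendsto_const] filterlim_at_top_imp_at_infinity filterlim_realpow_sequentially_gt1) auto
    then obtain M where M: "2 * d / 2 ^ M < e"
      using order_tendstoD(2)[OF _ \<open>e > 0\<close>] eventually_happens'[OF sequentially_bot] by blast
    have mono: "2 * d / 2 ^ n \<le> 2 * d / 2 ^ M" if "n \<ge> M" for n
      using that d0 by (intro divide_left_mono power_increasing) auto
    have "N (X m - X n) < e" if "m \<ge> M" "n \<ge> M" for m n
    proof (cases "n \<le> m")
      case True
      show ?thesis using tail'[OF True] mono[OF that(2)] M by linarith
    next
      case False
      then have "m \<le> n" by simp
      show ?thesis using tail'[OF \<open>m \<le> n\<close>] mono[OF that(1)] M N_commute[of "X m" "X n"] by linarith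
    qed
    then show "\<exists>M. \<forall>m\<ge>M. \<forall>n\<ge>M. N (X m - X n) < e" by blast
  qed
  then obtain x where x: "x \<in> E" "(\<lambda>n. N (X n - x)) \<longlonglongrightarrow> 0" by blast
  then have xC: "x \<in> C" using closed[of X x] XC by blast
  have "N (T x - x) \<le> N (X n - x) / 2 + N (X (Suc n) - x)" for n
  proof -
    have "N (T x - x) \<le> N (T x - X (Suc n)) + N (X (Suc n) - x)"
      using XE x T[OF xC] C by (intro N_diff_triangle) auto
    then show ?thesis using half[OF xC XC[of n]] by (simp add: X_def N_commute)
  qed
  moreover have "(\<lambda>n. N (X n - x) / 2 + N (X (Suc n) - x)) \<longlonglongrightarrow> 0 / 2 + 0"
    by (intro tendsto_intros x LIMSEQ_Suc) auto
  ultimately have "N (T x - x) \<le> 0"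
    by (intro LIMSEQ_le_const[where X = "\<lambda>n. N (X n - x) / 2 + N (X (Suc n) - x)"]) auto
  then have "T x - x = 0" using N_eq_0[of "T x - x"] N_nonneg[of "T x - x"] T[OF xC] C x by auto
  then show ?thesis using xC by auto
qed

lemma N_limit_le:
  assumes "\<And>n. X n \<in> E" "\<And>n. N (X n) \<le> r" "x \<in> E" "(\<lambda>n. N (X n - x)) \<longlonglongrightarrow> 0"
  shows "N x \<le> r"
proof -
  have "N x \<le> N (X n - x) + r" for n
    using N_triangle[of "X n" "x - X n"] assms N_commute[of "X n" x] by (smt (verit) E_diff add.commute diff_add_cancel)
  moreover have "(\<lambda>n. N (X n - x) + r) \<longlonglongrightarrow> 0 + r" by (intro tendsto_intros assms)
  ultimately show ?thesis by (intro LIMSEQ_le_const[where X = "\<lambda>n. N (X n - x) + r"]) auto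
qed

end

text \<open>The number \<open>b\<close> is only an upper bound and may be increased; this shrinks the ball of radius
  \<open>1 / (4 * b)\<close> on which the map is inverted.\<close>

locale quadratic_perturbation = banach_subspace +
  fixes B :: "'a \<Rightarrow> 'a \<Rightarrow> 'a" and b :: real
  assumes B_E [simp]: "x \<in> E \<Longrightarrow> y \<in> E \<Longrightarrow> B x y \<in> E"
    and B_commute: "B x y = B y x"
    and B_add_right: "x \<in> E \<Longrightarrow> y \<in> E \<Longrightarrow> z \<in> E \<Longrightarrow> B x (y + z) = B x y + B x z"
    and B_scale_right: "x \<in> E \<Longrightarrow> y \<in> E \<Longrightarrow> B x (c *\<^sub>R y) = c *\<^sub>R B x y"
    and b_pos: "0 < b"
    and B_bound: "x \<in> E \<Longrightarrow> y \<in> E \<Longrightarrow> N (B x y) \<le> b * N x * N y"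
begin

lemma B_add_left: "x \<in> E \<Longrightarrow> y \<in> E \<Longrightarrow> z \<in> E \<Longrightarrow> B (x + y) z = B x z + B y z"
  using B_add_right[of z x y] by (simp add: B_commute)

lemma B_scale_left: "x \<in> E \<Longrightarrow> y \<in> E \<Longrightarrow> B (c *\<^sub>R x) y = c *\<^sub>R B x y"
  using B_scale_right[of y x] by (simp add: B_commute)

lemma B_diff_right: "x \<in> E \<Longrightarrow> y \<in> E \<Longrightarrow> z \<in> E \<Longrightarrow> B x (y - z) = B x y - B x z"
  using B_add_right[of x y "- z"] B_scale_right[of x z "-1"] by simp

lemma B_diff_left: "x \<in> E \<Longrightarrow> y \<in> E \<Longrightarrow> z \<in> E \<Longrightarrow> B (x - y) z = B x z - B y z"
  using B_diff_right[of z x y] by (simp add: B_commute)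

lemmas B_simps = B_add_left B_add_right B_diff_left B_diff_right B_scale_left B_scale_right

lemma B_bound_le:
  assumes "x \<in> E" "y \<in> E" "N x \<le> c" "N y \<le> e"
  shows "N (B x y) \<le> b * c * e"
proof -
  have "b * N x * N y \<le> b * c * e"
    using assms b_pos order_trans[OF N_nonneg assms(3)] by (intro mult_mono) auto
  then show ?thesis using B_bound[OF assms(1,2)] by linarith
qed

definition Q :: "'a \<Rightarrow> 'a" where "Q x = x + B x x"

text \<open>The derivative of \<open>Q\<close> at \<open>x\<close>.\<close>

definition L :: "'a \<Rightarrow> 'a \<Rightarrow> 'a" where "L x u = u + 2 *\<^sub>R B x u"

text \<open>For \<open>x\<close> in the ball of radius \<open>r\<close> the operator \<open>2 * B x\<close> has norm at most \<open>1/2\<close>, so \<open>L x\<close> is invertible.\<close>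

definition r :: real where "r = 1 / (4 * b)"

lemma r_pos: "0 < r" and b_r: "b * r = 1 / 4"
  using b_pos by (simp_all add: r_def)

lemma Q_E [simp]: "x \<in> E \<Longrightarrow> Q x \<in> E"
  by (simp add: Q_def)

lemma L_E [simp]: "x \<in> E \<Longrightarrow> u \<in> E \<Longrightarrow> L x u \<in> E"
  by (simp add: L_def)

lemma N_B_small: "x \<in> E \<Longrightarrow> N x \<le> r \<Longrightarrow> u \<in> E \<Longrightarrow> N (B x u) \<le> N u / 4"
  using B_bound_le[of x u r "N u"] b_r by simp

lemma Q_diff: "x \<in> E \<Longrightarrow> y \<in> E \<Longrightarrow> Q y - Q x = L x (y - x) + B (y - x) (y - x)"
  by (simp add: Q_def L_def B_simps B_commute[of y x] scaleR_2 algebra_simps)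

lemma L_add: "x \<in> E \<Longrightarrow> u \<in> E \<Longrightarrow> v \<in> E \<Longrightarrow> L x (u + v) = L x u + L x v"
  by (simp add: L_def B_simps algebra_simps)

lemma L_diff: "x \<in> E \<Longrightarrow> u \<in> E \<Longrightarrow> v \<in> E \<Longrightarrow> L x (u - v) = L x u - L x v"
  by (simp add: L_def B_simps algebra_simps)

lemma L_scale: "x \<in> E \<Longrightarrow> u \<in> E \<Longrightarrow> L x (c *\<^sub>R u) = c *\<^sub>R L x u"
  by (simp add: L_def B_simps algebra_simps)

lemma N_le_L:
  assumes "x \<in> E" "N x \<le> r" "u \<in> E"
  shows "N u \<le> 2 * N (L x u)"
proof -
  have "N (L x u - 2 *\<^sub>R B x u) \<le> N (L x u) + N (2 *\<^sub>R B x u)"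
    using assms by (intro N_diff) auto
  then show ?thesis using N_B_small[OF assms] N_scale[of "B x u" 2] assms by (simp add: L_def)
qed

lemma L_solvable:
  assumes x: "x \<in> E" "N x \<le> r" and h: "h \<in> E"
  shows "\<exists>!u. u \<in> E \<and> L x u = h"
proof -
  have "\<exists>u\<in>E. h - 2 *\<^sub>R B x u = u"
  proof (rule contraction_fixpoint[where w = 0])
    show "N (h - 2 *\<^sub>R B x u - (h - 2 *\<^sub>R B x v)) \<le> N (u - v) / 2" if "u \<in> E" "v \<in> E" for u v
    proof -
      have "h - 2 *\<^sub>R B x u - (h - 2 *\<^sub>R B x v) = 2 *\<^sub>R B x (v - u)"
        using that x by (simp add: B_simps algebra_simps)
      then show ?thesis
        using N_scale[of "B x (v - u)" 2] N_B_small[OF x, of "v - u"] that x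
        by (simp add: N_commute[of u v])
    qed
  qed (use x h in auto)
  then obtain u where u: "u \<in> E" "L x u = h" by (auto simp: L_def diff_eq_eq)
  show ?thesis
  proof (intro ex1I[of _ u] conjI u)
    fix v assume v: "v \<in> E \<and> L x v = h"
    then have "N (v - u) \<le> 2 * N (L x (v - u))" using x u by (intro N_le_L) auto
    also have "\<dots> = 0" using v u x by (simp add: L_diff)
    finally show "v = u" using N_eq_0[of "v - u"] N_nonneg[of "v - u"] v u by auto
  qed
qed

definition R :: "'a \<Rightarrow> 'a \<Rightarrow> 'a" where "R x h = (THE u. u \<in> E \<and> L x u = h)"

lemma R_E [simp]: "x \<in> E \<Longrightarrow> N x \<le> r \<Longrightarrow> h \<in> E \<Longrightarrow> R x h \<in> E"
  and L_R: "x \<in> E \<Longrightarrow> N x \<le> r \<Longrightarrow> h \<in> E \<Longrightarrow> L x (R x h) = h"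
  using theI'[OF L_solvable, of x h] by (simp_all add: R_def)

lemma R_unique: "x \<in> E \<Longrightarrow> N x \<le> r \<Longrightarrow> h \<in> E \<Longrightarrow> u \<in> E \<Longrightarrow> L x u = h \<Longrightarrow> R x h = u"
  using L_solvable[of x h] R_E[of x h] L_R[of x h] by blast

lemma R_linear: "x \<in> E \<Longrightarrow> N x \<le> r \<Longrightarrow> g \<in> E \<Longrightarrow> h \<in> E \<Longrightarrow>
    R x (a *\<^sub>R g + c *\<^sub>R h) = a *\<^sub>R R x g + c *\<^sub>R R x h"
  by (intro R_unique) (auto simp: L_add L_scale L_R)

definition W :: "'a set" where "W = {y \<in> E. N y < r / 2}"

text \<open>\<open>Q\<close> is injective on the ball of radius \<open>r\<close> with a Lipschitz inverse, since \<open>B x x - B y y\<close> equals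
\<open>B x (x - y) + B y (x - y)\<close>.\<close>

lemma N_Q_diff_ge:
  assumes "x \<in> E" "y \<in> E" "N x \<le> r" "N y \<le> r"
  shows "N (y - x) \<le> 2 * N (Q y - Q x)"
proof -
  have eq: "y - x = (Q y - Q x) - (B x (y - x) + B y (y - x))"
    using assms by (simp add: Q_def B_simps B_commute[of y x] algebra_simps)
  have "N (y - x) \<le> N (Q y - Q x) + N (B x (y - x) + B y (y - x))"
    using assms by (subst eq, intro N_diff) auto
  moreover have "N (B x (y - x) + B y (y - x)) \<le> N (y - x) / 2"
    using N_triangle[of "B x (y - x)" "B y (y - x)"] N_B_small[of x "y - x"] N_B_small[of y "y - x"]
      assms by auto
  ultimately show ?thesis by simp
qed

lemma Q_inj:
  assumes "x \<in> E" "y \<in> E" "N x \<le> r" "N y \<le> r" "Q x = Q y"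
  shows "x = y"
  using N_Q_diff_ge[OF assms(1-4)] assms(5) N_eq_0[of "y - x"] N_nonneg[of "y - x"] assms(1,2)
  by auto

lemma Q_surj:
  assumes "y \<in> W"
  shows "\<exists>x. x \<in> E \<and> N x < r \<and> Q x = y"
proof -
  have y: "y \<in> E" "N y < r / 2" using assms by (auto simp: W_def)
  have "\<exists>x\<in>{x \<in> E. N x \<le> r}. y - B x x = x"
  proof (rule contraction_fixpoint[where w = 0])
    show "y - B x x \<in> {x \<in> E. N x \<le> r}" if "x \<in> {x \<in> E. N x \<le> r}" for x
      using that y N_diff[of y "B x x"] N_B_small[of x x] r_pos by auto
    show "N (y - B x x - (y - B x' x')) \<le> N (x - x') / 2"
      if "x \<in> {x \<in> E. N x \<le> r}" "x' \<in> {x \<in> E. N x \<le> r}" for x x'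
    proof -
      have eq: "y - B x x - (y - B x' x') = B x (x' - x) + B x' (x' - x)"
        using that y by (simp add: B_simps B_commute[of x' x] algebra_simps)
      show ?thesis unfolding eq
        using N_triangle[of "B x (x' - x)" "B x' (x' - x)"] N_B_small[of x "x' - x"]
          N_B_small[of x' "x' - x"] that N_commute[of x x'] by auto
    qed
    show "x \<in> {x \<in> E. N x \<le> r}" if "\<And>n. X n \<in> {x \<in> E. N x \<le> r}" "x \<in> E"
      "(\<lambda>n. N (X n - x)) \<longlonglongrightarrow> 0" for X x
      using that N_limit_le[of X r x] by auto
  qed (use r_pos in auto)
  then obtain x where x: "x \<in> E" "N x \<le> r" "y = x + B x x" by (auto simp: diff_eq_eq)
  have "N x \<le> N y + N (B x x)" using N_diff[of y "B x x"] x by auto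
  also have "\<dots> < r" using y N_B_small[of x x] x r_pos by auto
  finally show ?thesis using x by (auto simp: Q_def)
qed

definition \<xi> :: "'a \<Rightarrow> 'a" where "\<xi> y = (SOME x. x \<in> E \<and> N x < r \<and> Q x = y)"

lemma \<xi>:
  assumes "y \<in> W"
  shows "\<xi> y \<in> E" "N (\<xi> y) < r" "N (\<xi> y) \<le> r" "Q (\<xi> y) = y"
  using someI_ex[OF Q_surj[OF assms]] by (auto simp: \<xi>_def)

lemma W_E: "y \<in> W \<Longrightarrow> y \<in> E"
  by (simp add: W_def)

lemma N_\<xi>_diff: "y \<in> W \<Longrightarrow> y' \<in> W \<Longrightarrow> N (\<xi> y' - \<xi> y) \<le> 2 * N (y' - y)"
  using N_Q_diff_ge[of "\<xi> y" "\<xi> y'"] \<xi> by auto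

text \<open>\<open>d y [h\<^sub>1, \<dots>, h\<^sub>k]\<close> is the derivative of order \<open>k\<close> of the inverse \<open>\<xi>\<close> at \<open>y\<close>.  Differentiating
\<open>\<xi> y + B (\<xi> y) (\<xi> y) = y\<close> in the directions \<open>h\<^sub>1, \<dots>, h\<^sub>k\<close> gives \<open>L (\<xi> y)\<close>, applied to this derivative, from the two
splittings with an empty part; the other splittings contain derivatives of lower order and are moved to the right
hand side.  The identity map on the right contributes to the first derivative only.\<close>

function d :: "'a \<Rightarrow> 'a list \<Rightarrow> 'a" where
  "d y hs = (if hs = [] then \<xi> y else
     R (\<xi> y) ((if length hs = 1 then hd hs else 0) -
       split_sum (\<lambda>a c. if a = [] \<or> c = [] then 0 else B (d y a) (d y c)) hs))"
  by pat_completeness auto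
termination
proof (relation "Wellfounded.measure (\<lambda>(y, hs). length hs)", goal_cases)
  case (2 y hs a c)
  then show ?case by (cases c) auto
next
  case (3 y hs a c)
  then show ?case by (cases a) auto
qed simp

declare d.simps [simp del]

abbreviation G :: "'a \<Rightarrow> 'a list \<Rightarrow> 'a list \<Rightarrow> 'a" where
  "G y a c \<equiv> (if a = [] \<or> c = [] then 0 else B (d y a) (d y c))"

definition S :: "'a \<Rightarrow> 'a list \<Rightarrow> 'a" where
  "S y hs = (if length hs = 1 then hd hs else 0) - split_sum (G y) hs"

lemma d_Nil [simp]: "d y [] = \<xi> y"
  by (simp add: d.simps)

lemma d_eq_R_S: "hs \<noteq> [] \<Longrightarrow> d y hs = R (\<xi> y) (S y hs)"
  by (simp add: d.simps[of y hs] S_def)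

lemma split_sum_E:
  assumes "set xs \<subseteq> E"
    and "\<And>a b. set a \<subseteq> E \<Longrightarrow> set b \<subseteq> E \<Longrightarrow> length a + length b = length xs \<Longrightarrow> F a b \<in> E"
  shows "split_sum F xs \<in> E"
  using assms
proof (induction xs arbitrary: F)
  case (Cons x xs)
  have "split_sum (\<lambda>a b. F (x # a) b) xs \<in> E" "split_sum (\<lambda>a b. F a (x # b)) xs \<in> E"
    by (intro Cons.IH Cons.prems; use Cons.prems(1) in force)+
  then show ?case by simp
qed simp

lemma S_E_if:
  assumes hs: "hs \<in> lists E" "hs \<noteq> []"
    and smaller: "\<And>a. a \<in> lists E \<Longrightarrow> length a < length hs \<Longrightarrow> d y a \<in> E"
  shows "S y hs \<in> E"
proof -
  have "split_sum (G y) hs \<in> E"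
  proof (rule split_sum_E)
    show "G y a c \<in> E" if "set a \<subseteq> E" "set c \<subseteq> E" "length a + length c = length hs" for a c
      using that smaller[of a] smaller[of c] by (cases a; cases c) (auto simp: in_lists_conv_set subset_iff)
  qed (use hs in \<open>auto simp: in_lists_conv_set\<close>)
  moreover have "hd hs \<in> E" using hs by (cases hs) auto
  ultimately show ?thesis by (simp add: S_def)
qed

lemma d_E [simp]:
  assumes "y \<in> W" "hs \<in> lists E"
  shows "d y hs \<in> E"
  using assms(2)
proof (induction "length hs" arbitrary: hs rule: less_induct)
  case less
  show ?case
  proof (cases "hs = []")
    case False
    then have "S y hs \<in> E" using less by (intro S_E_if) auto
    then show ?thesis using False \<xi>[OF assms(1)] by (simp add: d_eq_R_S)
  qed (simp add: \<xi> assms)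
qed

lemma S_E [simp]: "y \<in> W \<Longrightarrow> hs \<in> lists E \<Longrightarrow> hs \<noteq> [] \<Longrightarrow> S y hs \<in> E"
  by (rule S_E_if) auto

lemma L_d: "y \<in> W \<Longrightarrow> hs \<in> lists E \<Longrightarrow> hs \<noteq> [] \<Longrightarrow> L (\<xi> y) (d y hs) = S y hs"
  by (simp add: d_eq_R_S L_R \<xi>)

text \<open>The right hand side obeys the product rule: a new direction joins one of the two parts of each splitting.  The last
term stems from the splittings in which the new direction forms a part of its own; it accounts for the dependence of
\<open>L (\<xi> y)\<close> on \<open>y\<close>.\<close>

lemma S_Cons:
  assumes "hs \<noteq> []"
  shows "S y (h # hs) =
    - split_sum (\<lambda>a c. if a = [] \<or> c = [] then 0
                      else B (d y (h # a)) (d y c) + B (d y a) (d y (h # c))) hs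
    - 2 *\<^sub>R B (d y [h]) (d y hs)"
proof -
  let ?K1 = "\<lambda>a c. if a = [] \<or> c = [] then 0 else B (d y (h # a)) (d y c)"
  let ?K2 = "\<lambda>a c. if a = [] \<or> c = [] then 0 else B (d y a) (d y (h # c))"
  let ?f = "\<lambda>c. if c = [] then 0 else B (d y [h]) (d y c)"
  have "split_sum (\<lambda>a c. G y (h # a) c) hs = split_sum (\<lambda>a c. ?K1 a c + (if a = [] then ?f c else 0)) hs"
    by (intro split_sum_cong) auto
  also have "\<dots> = split_sum ?K1 hs + ?f hs"
    by (simp only: split_sum_add split_sum_left_Nil)
  finally have 1: "split_sum (\<lambda>a c. G y (h # a) c) hs = split_sum ?K1 hs + B (d y [h]) (d y hs)"
    using assms by simp
  have "split_sum (\<lambda>a c. G y a (h # c)) hs = split_sum (\<lambda>a c. ?K2 a c + (if c = [] then ?f a else 0)) hs"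
    by (intro split_sum_cong) (auto simp: B_commute)
  also have "\<dots> = split_sum ?K2 hs + ?f hs"
    by (simp only: split_sum_add split_sum_right_Nil)
  finally have 2: "split_sum (\<lambda>a c. G y a (h # c)) hs = split_sum ?K2 hs + B (d y [h]) (d y hs)"
    using assms by simp
  have 3: "split_sum (\<lambda>a c. if a = [] \<or> c = [] then 0
                      else B (d y (h # a)) (d y c) + B (d y a) (d y (h # c))) hs
      = split_sum ?K1 hs + split_sum ?K2 hs"
    unfolding split_sum_add[symmetric] by (intro split_sum_cong) auto
  show ?thesis
    using assms 1 2 unfolding 3 S_def by (simp add: scaleR_2)
qed

text \<open>Bound, Lipschitz estimate and remainder for the derivative whose order is the length of \<open>hs\<close>, with a constant that is
uniform in the base points and in the directions.\<close>

definition bounds :: "real \<Rightarrow> 'a list \<Rightarrow> bool" where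
  "bounds C hs \<longleftrightarrow> (\<forall>y\<in>W. \<forall>y'\<in>W.
     N (d y hs) \<le> C * P hs \<and>
     N (d y' hs - d y hs) \<le> C * N (y' - y) * P hs \<and>
     N (d y' hs - d y hs - d y ((y' - y) # hs)) \<le> C * (N (y' - y))\<^sup>2 * P hs)"

lemma bounds_mono: "bounds C hs \<Longrightarrow> C \<le> C' \<Longrightarrow> bounds C' hs"
  unfolding bounds_def
  by (meson P_nonneg N_nonneg mult_right_mono order_trans zero_le_power2)

lemma bounds_Nil: "bounds (r + 2 + 8 * b) []"
  unfolding bounds_def
proof (intro ballI conjI)
  fix y y' assume y: "y \<in> W" "y' \<in> W"
  note [simp] = \<xi>[OF y(1)] \<xi>[OF y(2)] W_E[OF y(1)] W_E[OF y(2)]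
  show "N (d y []) \<le> (r + 2 + 8 * b) * P []"
    using b_pos order_trans[OF \<xi>(3)[OF y(1)], of "r + 2 + 8 * b"] by simp
  have "0 \<le> (r + 8 * b) * N (y' - y)" using r_pos b_pos by simp
  then show "N (d y' [] - d y []) \<le> (r + 2 + 8 * b) * N (y' - y) * P []"
    using N_\<xi>_diff[OF y] by (simp add: algebra_simps)
  let ?\<Delta> = "\<xi> y' - \<xi> y"
  have "L (\<xi> y) (d y [y' - y]) = y' - y" using y by (subst L_d) (auto simp: S_def)
  moreover have "y' - y = L (\<xi> y) ?\<Delta> + B ?\<Delta> ?\<Delta>" using Q_diff[of "\<xi> y" "\<xi> y'"] by simp
  ultimately have eq: "L (\<xi> y) (?\<Delta> - d y [y' - y]) = - B ?\<Delta> ?\<Delta>"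
    using y by (simp add: L_diff)
  have "N (?\<Delta> - d y [y' - y]) \<le> 2 * N (B ?\<Delta> ?\<Delta>)"
    using N_le_L[of "\<xi> y" "?\<Delta> - d y [y' - y]"] y eq by simp
  also have "\<dots> \<le> 2 * (b * (2 * N (y' - y)) * (2 * N (y' - y)))"
    using N_\<xi>_diff[OF y] by (intro mult_left_mono B_bound_le) auto
  also have "\<dots> \<le> (r + 2 + 8 * b) * (N (y' - y))\<^sup>2"
    using r_pos by (simp add: power2_eq_square algebra_simps)
  finally show "N (d y' [] - d y [] - d y [y' - y]) \<le> (r + 2 + 8 * b) * (N (y' - y))\<^sup>2 * P []"
    by simp
qed

text \<open>Subtracting the linear equations that define \<open>d y' hs\<close> and \<open>d y hs\<close> gives an equation for their difference with the
operator \<open>L (\<xi> y)\<close>, whose inverse is bounded by \<open>2\<close>.  On its right hand side all terms are differences of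
products of lower derivatives, which the hypothesis controls, and the change of \<open>L (\<xi> y)\<close> itself.\<close>

lemma bounds_step:
  assumes C: "0 \<le> C" and hs: "hs \<in> lists E" "hs \<noteq> []"
    and smaller: "\<And>a. a \<in> lists E \<Longrightarrow> length a < length hs \<Longrightarrow> bounds C a"
  defines "M1 \<equiv> 2 * (1 + 2 ^ length hs * (b * C * C))"
  defines "M2 \<equiv> 4 * 2 ^ length hs * (b * C * C) + 8 * b * M1"
  defines "M3 \<equiv> 6 * 2 ^ length hs * (b * C * C) + 32 * b * b * M1 + 8 * b * M2"
  shows "bounds (M1 + M2 + M3) hs"
proof -
  have bCC: "0 \<le> b * C * C" using b_pos C by simp
  have M: "0 \<le> M1" "0 \<le> M2" "0 \<le> M3" using bCC b_pos by (simp_all add: M1_def M2_def M3_def)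
  have P: "0 \<le> P hs" by (rule P_nonneg)
  have small: "N (d y a) \<le> C * P a"
      "N (d y' a - d y a) \<le> C * N (y' - y) * P a"
      "N (d y' a - d y a - d y ((y' - y) # a)) \<le> C * (N (y' - y))\<^sup>2 * P a"
    if "y \<in> W" "y' \<in> W" "a \<in> lists E" "length a < length hs" for y y' a
    using smaller[of a] that by (auto simp: bounds_def)
  (* In a splitting of hs into two nonempty parts both parts are shorter than hs. *)
  have split_bound: "split_sum (\<lambda>a c. if a = [] \<or> c = [] then 0 else F a c) hs \<in> E \<and>
      N (split_sum (\<lambda>a c. if a = [] \<or> c = [] then 0 else F a c) hs) \<le> 2 ^ length hs * e * P hs"
    if e: "0 \<le> e" and F: "\<And>a c. a \<in> lists E \<Longrightarrow> c \<in> lists E \<Longrightarrow> length a < length hs \<Longrightarrow> length c < length hs \<Longrightarrow>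
        F a c \<in> E \<and> N (F a c) \<le> e * (P a * P c)" for F e
  proof (rule split_sum_bound[OF hs(1)])
    fix a c assume ac: "a \<in> lists E" "c \<in> lists E" "length a + length c = length hs"
    show "(if a = [] \<or> c = [] then 0 else F a c) \<in> E \<and>
        N (if a = [] \<or> c = [] then 0 else F a c) \<le> e * (P a * P c)"
    proof (cases "a = [] \<or> c = []")
      case False
      then have "length a < length hs" "length c < length hs" using ac(3) by (auto simp flip: length_greater_0_conv)
      then show ?thesis using F[OF ac(1,2)] False by simp
    next
      case True
      then show ?thesis using e P_nonneg[of a] P_nonneg[of c] by auto
    qed
  qed
  have solve: "N u \<le> 2 * e" if "y \<in> W" "u \<in> E" "N (L (\<xi> y) u) \<le> e" for y u e
    using N_le_L[of "\<xi> y" u] \<xi>[OF that(1)] that by simp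
  have bd1: "N (d y hs) \<le> M1 * P hs" if y: "y \<in> W" for y
  proof -
    have "N (split_sum (G y) hs) \<le> 2 ^ length hs * (b * C * C) * P hs"
    proof (rule split_bound[THEN conjunct2, OF bCC], intro conjI)
      fix a c assume ac: "a \<in> lists E" "c \<in> lists E" "length a < length hs" "length c < length hs"
      show "N (B (d y a) (d y c)) \<le> b * C * C * (P a * P c)"
        using B_bound_le[of "d y a" "d y c", OF _ _ small(1)[OF y y ac(1,3)] small(1)[OF y y ac(2,4)]] y ac
        by (simp add: mult_ac)
      show "B (d y a) (d y c) \<in> E" using y ac by simp
    qed
    moreover have "N (if length hs = 1 then hd hs else 0) \<le> 1 * P hs"
      using P by (cases hs) auto
    moreover have "(if length hs = 1 then hd hs else 0) \<in> E" using hs by (cases hs) auto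
    moreover have "split_sum (G y) hs \<in> E"
      using y hs by (intro split_sum_E) (auto simp: in_lists_conv_set subset_iff)
    ultimately have "N (L (\<xi> y) (d y hs)) \<le> (1 + 2 ^ length hs * (b * C * C)) * P hs"
      unfolding L_d[OF y hs] S_def using N_diff[of "if length hs = 1 then hd hs else 0" "split_sum (G y) hs"]
      by (simp add: algebra_simps)
    from solve[OF y _ this] show ?thesis
      using y hs by (simp add: M1_def algebra_simps)
  qed
  have bd2: "N (d y' hs - d y hs) \<le> M2 * N (y' - y) * P hs" if y: "y \<in> W" "y' \<in> W" for y y'
  proof -
    let ?n = "N (y' - y)"
    let ?F = "\<lambda>a c. B (d y' a - d y a) (d y' c) + B (d y a) (d y' c - d y c)"
    have F: "split_sum (\<lambda>a c. if a = [] \<or> c = [] then 0 else ?F a c) hs \<in> E \<and>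
        N (split_sum (\<lambda>a c. if a = [] \<or> c = [] then 0 else ?F a c) hs)
          \<le> 2 ^ length hs * (2 * (b * C * C) * ?n) * P hs"
    proof (rule split_bound, goal_cases)
      case (2 a c)
      note d1 = small(1)[OF y(1) y(1) 2(1,3)] small(1)[OF y(2) y(2) 2(2,4)]
      note d2 = small(2)[OF y 2(1,3)] small(2)[OF y 2(2,4)]
      have "N (B (d y' a - d y a) (d y' c)) \<le> b * (C * ?n * P a) * (C * P c)"
        using y 2 d1 d2 by (intro B_bound_le) auto
      moreover have "N (B (d y a) (d y' c - d y c)) \<le> b * (C * P a) * (C * ?n * P c)"
        using y 2 d1 d2 by (intro B_bound_le) auto
      ultimately show ?case
        using N_triangle[of "B (d y' a - d y a) (d y' c)" "B (d y a) (d y' c - d y c)"] y 2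
        by (simp add: algebra_simps)
    qed (use bCC in simp)
    have "S y' hs - S y hs = - (split_sum (G y') hs - split_sum (G y) hs)"
      by (simp add: S_def)
    also have "split_sum (G y') hs - split_sum (G y) hs
        = split_sum (\<lambda>a c. if a = [] \<or> c = [] then 0 else ?F a c) hs"
      unfolding split_sum_diff[symmetric]
    proof (intro split_sum_cong refl)
      fix a c assume "set a \<subseteq> set hs" "set c \<subseteq> set hs"
      then have "a \<in> lists E" "c \<in> lists E" using hs by (auto simp: in_lists_conv_set)
      then show "G y' a c - G y a c = (if a = [] \<or> c = [] then 0 else ?F a c)"
        using y by (simp add: B_simps)
    qed
    finally have S: "N (S y' hs - S y hs) \<le> 2 ^ length hs * (2 * (b * C * C) * ?n) * P hs"
      using F by simp
    have "L (\<xi> y) (d y' hs) = S y' hs - 2 *\<^sub>R B (\<xi> y' - \<xi> y) (d y' hs)"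
      using L_d[OF y(2) hs] y hs \<xi>[OF y(1)] \<xi>[OF y(2)] by (simp add: L_def B_simps algebra_simps)
    then have eq: "L (\<xi> y) (d y' hs - d y hs) = (S y' hs - S y hs) - 2 *\<^sub>R B (\<xi> y' - \<xi> y) (d y' hs)"
      using L_d[OF y(1) hs] y hs \<xi>[OF y(1)] by (simp add: L_diff)
    have "N (B (\<xi> y' - \<xi> y) (d y' hs)) \<le> b * (2 * ?n) * (M1 * P hs)"
      using y hs \<xi>[OF y(1)] \<xi>[OF y(2)] N_\<xi>_diff[OF y] bd1[OF y(2)] by (intro B_bound_le) auto
    then have "N (2 *\<^sub>R B (\<xi> y' - \<xi> y) (d y' hs)) \<le> 2 * (b * (2 * ?n) * (M1 * P hs))"
      using y hs \<xi>(1)[OF y(1)] \<xi>(1)[OF y(2)] by (simp add: N_scale mult_ac)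
    then have "N (L (\<xi> y) (d y' hs - d y hs))
        \<le> 2 ^ length hs * (2 * (b * C * C) * ?n) * P hs + 2 * (b * (2 * ?n) * (M1 * P hs))"
      unfolding eq using S N_diff[of "S y' hs - S y hs" "2 *\<^sub>R B (\<xi> y' - \<xi> y) (d y' hs)"] y hs
        \<xi>[OF y(1)] \<xi>[OF y(2)] by simp
    from solve[OF y(1) _ this] show ?thesis
      using y hs by (simp add: M2_def algebra_simps)
  qed
  have bd3: "N (d y' hs - d y hs - d y ((y' - y) # hs)) \<le> M3 * (N (y' - y))\<^sup>2 * P hs"
    if y: "y \<in> W" "y' \<in> W" for y y'
  proof -
    let ?\<eta> = "y' - y" let ?n = "N ?\<eta>" let ?\<Delta> = "\<xi> y' - \<xi> y"
    note [simp] = \<xi>(1)[OF y(1)] \<xi>(1)[OF y(2)]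
    have \<eta>: "?\<eta> \<in> E" using y W_E by simp
    let ?rem = "\<lambda>a. d y' a - d y a - d y (?\<eta> # a)"
    let ?K = "\<lambda>a c. B (d y (?\<eta> # a)) (d y c) + B (d y a) (d y (?\<eta> # c))"
    let ?F = "\<lambda>a c. B (?rem a) (d y c) + B (d y a) (?rem c) + B (d y' a - d y a) (d y' c - d y c)"
    have F: "split_sum (\<lambda>a c. if a = [] \<or> c = [] then 0 else ?F a c) hs \<in> E \<and>
        N (split_sum (\<lambda>a c. if a = [] \<or> c = [] then 0 else ?F a c) hs)
          \<le> 2 ^ length hs * (3 * (b * C * C) * ?n\<^sup>2) * P hs"
    proof (rule split_bound, goal_cases)
      case (2 a c)
      note d1 = small(1)[OF y(1) y(1) 2(1,3)] small(1)[OF y(1) y(1) 2(2,4)]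
      note d2 = small(2)[OF y 2(1,3)] small(2)[OF y 2(2,4)]
      note d3 = small(3)[OF y 2(1,3)] small(3)[OF y 2(2,4)]
      have ac: "d y a \<in> E" "d y c \<in> E" "d y' a \<in> E" "d y' c \<in> E" "d y (?\<eta> # a) \<in> E" "d y (?\<eta> # c) \<in> E"
        using y 2 \<eta> by simp_all
      have "N (B (?rem a) (d y c)) \<le> b * (C * ?n\<^sup>2 * P a) * (C * P c)"
        using ac d1 d3 by (intro B_bound_le) auto
      moreover have "N (B (d y a) (?rem c)) \<le> b * (C * P a) * (C * ?n\<^sup>2 * P c)"
        using ac d1 d3 by (intro B_bound_le) auto
      moreover have "N (B (d y' a - d y a) (d y' c - d y c)) \<le> b * (C * ?n * P a) * (C * ?n * P c)"
        using ac d2 by (intro B_bound_le) auto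
      moreover have "N (?F a c) \<le> N (B (?rem a) (d y c)) + N (B (d y a) (?rem c))
          + N (B (d y' a - d y a) (d y' c - d y c))"
        using N_triangle[of "B (?rem a) (d y c) + B (d y a) (?rem c)" "B (d y' a - d y a) (d y' c - d y c)"]
          N_triangle[of "B (?rem a) (d y c)" "B (d y a) (?rem c)"] ac by simp
      ultimately show ?case
        using ac by (simp add: algebra_simps power2_eq_square)
    qed (use bCC in simp)
    have sums: "split_sum (G y') hs - split_sum (G y) hs
        - split_sum (\<lambda>a c. if a = [] \<or> c = [] then 0 else ?K a c) hs
        = split_sum (\<lambda>a c. if a = [] \<or> c = [] then 0 else ?F a c) hs"
      unfolding split_sum_diff[symmetric]
    proof (intro split_sum_cong refl)
      fix a c assume "set a \<subseteq> set hs" "set c \<subseteq> set hs"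
      then have "a \<in> lists E" "c \<in> lists E" using hs by (auto simp: in_lists_conv_set)
      then have "d y a \<in> E" "d y c \<in> E" "d y' a \<in> E" "d y' c \<in> E" "d y (?\<eta> # a) \<in> E" "d y (?\<eta> # c) \<in> E"
        using y \<eta> by simp_all
      then show "G y' a c - G y a c - (if a = [] \<or> c = [] then 0 else ?K a c)
          = (if a = [] \<or> c = [] then 0 else ?F a c)"
        by (simp add: B_simps)
    qed
    have dE: "d y hs \<in> E" "d y' hs \<in> E" "d y (?\<eta> # hs) \<in> E" "d y [?\<eta>] \<in> E"
      using y hs \<eta> by simp_all
    have L': "L (\<xi> y) (d y' hs) = S y' hs - 2 *\<^sub>R B ?\<Delta> (d y' hs)"
      using L_d[OF y(2) hs] dE by (simp add: L_def B_simps algebra_simps)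
    have L\<eta>: "L (\<xi> y) (d y (?\<eta> # hs)) =
        - split_sum (\<lambda>a c. if a = [] \<or> c = [] then 0 else ?K a c) hs - 2 *\<^sub>R B (d y [?\<eta>]) (d y hs)"
      using L_d[OF y(1), of "?\<eta> # hs"] S_Cons[OF hs(2)] hs \<eta> by simp
    have "L (\<xi> y) (?rem hs) = L (\<xi> y) (d y' hs) - L (\<xi> y) (d y hs) - L (\<xi> y) (d y (?\<eta> # hs))"
      using dE by (simp add: L_diff)
    also have "\<dots> = - (split_sum (G y') hs - split_sum (G y) hs
          - split_sum (\<lambda>a c. if a = [] \<or> c = [] then 0 else ?K a c) hs)
        - 2 *\<^sub>R (B ?\<Delta> (d y' hs) - B (d y [?\<eta>]) (d y hs))"
      unfolding L' L\<eta> L_d[OF y(1) hs] S_def by (simp add: algebra_simps)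
    also have "B ?\<Delta> (d y' hs) - B (d y [?\<eta>]) (d y hs)
        = B (?\<Delta> - d y [?\<eta>]) (d y hs) + B ?\<Delta> (d y' hs - d y hs)"
      using dE by (simp add: B_simps)
    finally have eq: "L (\<xi> y) (?rem hs) =
        - split_sum (\<lambda>a c. if a = [] \<or> c = [] then 0 else ?F a c) hs
        - 2 *\<^sub>R (B (?\<Delta> - d y [?\<eta>]) (d y hs) + B ?\<Delta> (d y' hs - d y hs))"
      unfolding sums .
    have "N (B (?\<Delta> - d y [?\<eta>]) (d y hs)) \<le> b * (8 * b * ?n\<^sup>2) * (M1 * P hs)"
    proof (rule B_bound_le)
      have "L (\<xi> y) (d y [?\<eta>]) = ?\<eta>" using y \<eta> by (subst L_d) (auto simp: S_def)
      moreover have "?\<eta> = L (\<xi> y) ?\<Delta> + B ?\<Delta> ?\<Delta>"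
        using Q_diff[of "\<xi> y" "\<xi> y'"] \<xi>(4)[OF y(1)] \<xi>(4)[OF y(2)] by simp
      ultimately have eq: "L (\<xi> y) (?\<Delta> - d y [?\<eta>]) = - B ?\<Delta> ?\<Delta>"
        using dE by (simp add: L_diff)
      have "N (?\<Delta> - d y [?\<eta>]) \<le> 2 * (b * (2 * ?n) * (2 * ?n))"
        using B_bound_le[of ?\<Delta> ?\<Delta> "2 * ?n" "2 * ?n"] N_\<xi>_diff[OF y] dE
        by (intro solve[OF y(1)]) (simp_all add: eq)
      then show "N (?\<Delta> - d y [?\<eta>]) \<le> 8 * b * ?n\<^sup>2" by (simp add: power2_eq_square)
    qed (use dE bd1[OF y(1)] in auto)
    moreover have "N (B ?\<Delta> (d y' hs - d y hs)) \<le> b * (2 * ?n) * (M2 * ?n * P hs)"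
      using dE N_\<xi>_diff[OF y] bd2[OF y] by (intro B_bound_le) auto
    moreover have "N (B (?\<Delta> - d y [?\<eta>]) (d y hs) + B ?\<Delta> (d y' hs - d y hs))
        \<le> N (B (?\<Delta> - d y [?\<eta>]) (d y hs)) + N (B ?\<Delta> (d y' hs - d y hs))"
      using dE by (intro N_triangle) auto
    ultimately have "N (2 *\<^sub>R (B (?\<Delta> - d y [?\<eta>]) (d y hs) + B ?\<Delta> (d y' hs - d y hs)))
        \<le> 2 * (b * (8 * b * ?n\<^sup>2) * (M1 * P hs) + b * (2 * ?n) * (M2 * ?n * P hs))"
      using dE by (simp add: N_scale)
    then have "N (L (\<xi> y) (?rem hs)) \<le> 2 ^ length hs * (3 * (b * C * C) * ?n\<^sup>2) * P hs
        + 2 * (b * (8 * b * ?n\<^sup>2) * (M1 * P hs) + b * (2 * ?n) * (M2 * ?n * P hs))"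
      unfolding eq
      using F N_diff[of "- split_sum (\<lambda>a c. if a = [] \<or> c = [] then 0 else ?F a c) hs"
          "2 *\<^sub>R (B (?\<Delta> - d y [?\<eta>]) (d y hs) + B ?\<Delta> (d y' hs - d y hs))"] dE
      by simp
    from solve[OF y(1) _ this] show ?thesis
      using dE by (simp add: M3_def algebra_simps power2_eq_square)
  qed
  have "M1 * P hs \<le> (M1 + M2 + M3) * P hs"
    "M2 * N (y' - y) * P hs \<le> (M1 + M2 + M3) * N (y' - y) * P hs"
    "M3 * (N (y' - y))\<^sup>2 * P hs \<le> (M1 + M2 + M3) * (N (y' - y))\<^sup>2 * P hs" for y y'
    using M P by (intro mult_right_mono; simp)+
  then show ?thesis
    unfolding bounds_def using bd1 bd2 bd3 by (meson order_trans)
qed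

lemma bounds_length: "\<exists>C\<ge>0. \<forall>hs\<in>lists E. length hs < k \<longrightarrow> bounds C hs"
proof (induction k)
  case (Suc k)
  then obtain C where C: "C \<ge> 0" "\<And>hs. hs \<in> lists E \<Longrightarrow> length hs < k \<Longrightarrow> bounds C hs" by blast
  have "\<exists>C'. \<forall>hs\<in>lists E. length hs = k \<longrightarrow> bounds C' hs"
  proof (cases k)
    case 0
    then show ?thesis using bounds_Nil by auto
  next
    case k: (Suc k')
    let ?M1 = "2 * (1 + 2 ^ k * (b * C * C))"
    let ?M2 = "4 * 2 ^ k * (b * C * C) + 8 * b * ?M1"
    let ?M3 = "6 * 2 ^ k * (b * C * C) + 32 * b * b * ?M1 + 8 * b * ?M2"
    have "bounds (?M1 + ?M2 + ?M3) hs" if hs: "hs \<in> lists E" "length hs = k" for hs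
    proof -
      have "hs \<noteq> []" using hs k by auto
      from bounds_step[OF C(1) hs(1) this] show ?thesis using C(2) hs(2) by simp
    qed
    then show ?thesis by blast
  qed
  then obtain C' where C': "\<And>hs. hs \<in> lists E \<Longrightarrow> length hs = k \<Longrightarrow> bounds C' hs" by blast
  show ?case
  proof (intro exI[of _ "max C C'"] conjI ballI impI)
    fix hs assume hs: "hs \<in> lists E" "length hs < Suc k"
    show "bounds (max C C') hs"
    proof (cases "length hs < k")
      case True
      show ?thesis by (rule bounds_mono[OF C(2)[OF hs(1) True]]) simp
    next
      case False
      then have "length hs = k" using hs(2) by simp
      then show ?thesis by (intro bounds_mono[OF C'[OF hs(1)]]) auto
    qed
  qed (use C in auto)
qed auto

end

section \<open>Charts given by quadratic maps\<close>

context quadratic_perturbation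
begin

text \<open>Each summand of the recursion contains every direction exactly once, so multilinearity passes through it.\<close>

lemma d_linear:
  assumes y: "y \<in> W" and uv: "u \<in> E" "v \<in> E" and "xs \<in> lists E" "ys \<in> lists E"
  shows "d y (xs @ (\<alpha> *\<^sub>R u + \<beta> *\<^sub>R v) # ys) = \<alpha> *\<^sub>R d y (xs @ u # ys) + \<beta> *\<^sub>R d y (xs @ v # ys)"
  using assms(4,5)
proof (induction "length xs + length ys" arbitrary: xs ys rule: less_induct)
  case less
  let ?w = "\<alpha> *\<^sub>R u + \<beta> *\<^sub>R v"
  have w: "?w \<in> E" using uv by simp
  let ?hd = "\<lambda>x. if length (xs @ x # ys) = 1 then hd (xs @ x # ys) else 0"
  have hd: "?hd ?w = \<alpha> *\<^sub>R ?hd u + \<beta> *\<^sub>R ?hd v" by auto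
  let ?F = "\<lambda>x a b. split_sum (\<lambda>a' b'. G y (a @ x # a') (b @ b') + G y (a @ a') (b @ x # b')) ys"
  have split: "split_sum (G y) (xs @ x # ys) = split_sum (?F x) xs" for x
    by (simp add: split_sum_append split_sum_add)
  have G: "G y (a @ ?w # a') (b @ b') + G y (a @ a') (b @ ?w # b') =
      (\<alpha> *\<^sub>R (G y (a @ u # a') (b @ b') + G y (a @ a') (b @ u # b'))
     + \<beta> *\<^sub>R (G y (a @ v # a') (b @ b') + G y (a @ a') (b @ v # b')))"
    if "length a + length b = length xs" "set a \<subseteq> set xs" "set b \<subseteq> set xs"
      "length a' + length b' = length ys" "set a' \<subseteq> set ys" "set b' \<subseteq> set ys" for a b a' b'
  proof -
    have ls: "a \<in> lists E" "b \<in> lists E" "a' \<in> lists E" "b' \<in> lists E"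
      using that less.prems by (auto simp: in_lists_conv_set)
    have E: "d y (a @ b) \<in> E" if "a \<in> lists E" "b \<in> lists E" for a b using y that by simp
    have 1: "G y (a @ ?w # a') (b @ b') = \<alpha> *\<^sub>R G y (a @ u # a') (b @ b') + \<beta> *\<^sub>R G y (a @ v # a') (b @ b')"
    proof (cases "b @ b' = []")
      case False
      then have "length a + length a' < length xs + length ys"
        using that by (cases b; cases b') auto
      from less.hyps[OF this ls(1,3)] show ?thesis
        using ls uv E w False by (auto simp: B_simps)
    qed auto
    have 2: "G y (a @ a') (b @ ?w # b') = \<alpha> *\<^sub>R G y (a @ a') (b @ u # b') + \<beta> *\<^sub>R G y (a @ a') (b @ v # b')"
    proof (cases "a @ a' = []")
      case False
      then have "length b + length b' < length xs + length ys"
        using that by (cases a; cases a') auto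
      from less.hyps[OF this ls(2,4)] show ?thesis
        using ls uv E w False by (auto simp: B_simps)
    qed auto
    show ?thesis unfolding 1 2 by (simp add: scaleR_add_right)
  qed
  have "split_sum (G y) (xs @ ?w # ys) = split_sum (\<lambda>a b. \<alpha> *\<^sub>R ?F u a b + \<beta> *\<^sub>R ?F v a b) xs"
    unfolding split split_sum_scaleR[symmetric] split_sum_add[symmetric]
    by (intro split_sum_cong refl G)
  also have "\<dots> = \<alpha> *\<^sub>R split_sum (G y) (xs @ u # ys) + \<beta> *\<^sub>R split_sum (G y) (xs @ v # ys)"
    unfolding split split_sum_add split_sum_scaleR ..
  finally have "S y (xs @ ?w # ys) = \<alpha> *\<^sub>R S y (xs @ u # ys) + \<beta> *\<^sub>R S y (xs @ v # ys)"
    unfolding S_def hd by (simp add: algebra_simps)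
  moreover have "S y (xs @ x # ys) \<in> E" if "x \<in> E" for x
    using y that less.prems by simp
  ultimately show ?case
    using R_linear[OF \<xi>(1,3)[OF y]] uv by (simp add: d_eq_R_S)
qed

lemma openin_W: "openin (norm_topology E N) W"
  using openin_ball[of 0 "r / 2"] by (simp add: W_def)

lemma smooth_inverse:
  assumes p: "p \<in> E" and f: "\<And>y. y \<in> W \<Longrightarrow> f y = p + \<xi> y"
  shows "smooth_map E N E N W f"
proof (rule smooth_mapI[OF openin_W, where D = "\<lambda>y hs. if hs = [] then p + \<xi> y else d y hs"])
  show "\<exists>C. \<forall>vs\<in>lists E. length vs = k \<longrightarrow> N (if vs = [] then p + \<xi> x else d x vs) \<le> C * P vs"
    if x: "x \<in> W" for k x
  proof (cases "k = 0")
    case False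
    obtain C where "\<forall>hs\<in>lists E. length hs < Suc k \<longrightarrow> bounds C hs" using bounds_length by blast
    then show ?thesis using x False unfolding bounds_def by (intro exI[of _ C]) auto
  qed (auto intro!: exI[of _ "N (p + \<xi> x)"])
  show "\<exists>C. \<forall>x\<in>W. \<forall>y\<in>W. \<forall>vs\<in>lists E. length vs = k \<longrightarrow>
      N ((if vs = [] then p + \<xi> y else d y vs) - (if vs = [] then p + \<xi> x else d x vs) -
         (if (y - x) # vs = [] then p + \<xi> x else d x ((y - x) # vs))) \<le> C * (N (y - x))\<^sup>2 * P vs" for k
  proof -
    obtain C where C: "\<forall>hs\<in>lists E. length hs < Suc k \<longrightarrow> bounds C hs" using bounds_length by blast
    have "(if vs = [] then p + \<xi> y else d y vs) - (if vs = [] then p + \<xi> x else d x vs) = d y vs - d x vs"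
      for x y vs by simp
    then show ?thesis using C unfolding bounds_def by (intro exI[of _ C]) auto
  qed
qed (auto simp: f p \<xi> d_linear)

lemma smooth_Q:
  assumes U: "openin (norm_topology E N) U" and p: "p \<in> E"
  shows "smooth_map E N E N U (\<lambda>x. Q (x - p))"
proof -
  define D where "D x vs = (case vs of [] \<Rightarrow> Q (x - p) | [v] \<Rightarrow> L (x - p) v
      | [u, v] \<Rightarrow> 2 *\<^sub>R B u v | _ \<Rightarrow> 0)" for x vs
  have UE: "x \<in> U \<Longrightarrow> x \<in> E" for x using U openin_norm_topology by blast
  have D_simps: "D x [] = Q (x - p)" "D x [v] = L (x - p) v" "D x [u, v] = 2 *\<^sub>R B u v"
    "D x (u # v # w # vs) = 0" for x u v w vs by (simp_all add: D_def)
  have shape: "vs = [] \<or> (\<exists>v. vs = [v]) \<or> (\<exists>u v. vs = [u, v]) \<or> (\<exists>u v w ws. vs = u # v # w # ws)" for vs :: "'a list"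
    by (metis neq_Nil_conv)
  show ?thesis
  proof (rule smooth_mapI[OF U, where D = D])
    show "D x vs \<in> E" if "x \<in> U" "vs \<in> lists E" for x vs
      using shape[of vs] that p UE by (auto simp: D_simps)
    show "D x (xs @ (a *\<^sub>R u + c *\<^sub>R v) # ys) = a *\<^sub>R D x (xs @ u # ys) + c *\<^sub>R D x (xs @ v # ys)"
      if "x \<in> U" "xs \<in> lists E" "ys \<in> lists E" "u \<in> E" "v \<in> E" for x xs ys u v a c
      using shape[of xs] shape[of ys] that p UE
      by (auto simp: D_simps L_add L_scale B_simps algebra_simps split: list.splits)
    show "\<exists>C. \<forall>vs\<in>lists E. length vs = k \<longrightarrow> N (D x vs) \<le> C * P vs" if x: "x \<in> U" for k x
    proof (intro exI ballI impI)
      fix vs assume vs: "vs \<in> lists E"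
      have xp: "x - p \<in> E" using x p UE by simp
      have b: "0 \<le> b" using b_pos by simp
      let ?C = "N (Q (x - p)) + (1 + 2 * b * N (x - p)) + 2 * b"
      have mono: "e * P vs \<le> ?C * P vs" if "e \<le> ?C" for e
        using that P_nonneg by (intro mult_right_mono)
      have "\<exists>e. N (D x vs) \<le> e * P vs \<and> e \<le> ?C"
        using shape[of vs]
      proof (elim disjE exE)
        fix v assume v: "vs = [v]"
        then have "N (L (x - p) v) \<le> N v + 2 * (b * N (x - p) * N v)"
          using N_triangle[of v "2 *\<^sub>R B (x - p) v"] N_scale[of "B (x - p) v" 2] B_bound[of "x - p" v] vs xp
          by (simp add: L_def)
        then show ?thesis using v b
          by (intro exI[of _ "1 + 2 * b * N (x - p)"]) (simp add: D_simps algebra_simps)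
      next
        fix u v assume uv: "vs = [u, v]"
        then show ?thesis using vs B_bound[of u v] N_scale[of "B u v" 2] b
          by (intro exI[of _ "2 * b"]) (simp add: D_simps algebra_simps)
      next
        assume "vs = []"
        then show ?thesis using b by (intro exI[of _ "N (Q (x - p))"]) (simp add: D_simps)
      next
        fix u v w ws assume "vs = u # v # w # ws"
        then show ?thesis using b by (intro exI[of _ 0]) (simp add: D_simps)
      qed
      then show "N (D x vs) \<le> ?C * P vs" using mono by (meson order_trans)
    qed
    show "\<exists>C. \<forall>x\<in>U. \<forall>y\<in>U. \<forall>vs\<in>lists E. length vs = k \<longrightarrow>
        N (D y vs - D x vs - D x ((y - x) # vs)) \<le> C * (N (y - x))\<^sup>2 * P vs" for k
    proof (intro exI[of _ b] ballI impI)
      fix x y vs assume xy: "x \<in> U" "y \<in> U" and vs: "vs \<in> lists E"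
      have E: "x \<in> E" "y \<in> E" using xy UE by auto
      have b: "0 \<le> b" using b_pos by simp
      show "N (D y vs - D x vs - D x ((y - x) # vs)) \<le> b * (N (y - x))\<^sup>2 * P vs"
        using shape[of vs]
      proof (elim disjE exE)
        assume "vs = []"
        then show ?thesis
          using Q_diff[of "x - p" "y - p"] B_bound[of "y - x" "y - x"] E p
          by (simp add: D_simps power2_eq_square)
      next
        fix v assume v: "vs = [v]"
        have "L (y - p) v - L (x - p) v - 2 *\<^sub>R B (y - x) v = 0"
          using v vs E p by (simp add: L_def B_simps algebra_simps)
        then show ?thesis using b v vs by (simp add: D_simps)
      next
        fix u v w ws assume "vs = u # v # w # ws"
        then show ?thesis using b P_nonneg[of ws] by (simp add: D_simps)
      qed (use b in \<open>simp add: D_simps\<close>)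
    qed
  qed (simp add: D_simps)
qed

lemma Q_diff_sum: "x \<in> E \<Longrightarrow> y \<in> E \<Longrightarrow> Q y - Q x = (y - x) + (B x (y - x) + B y (y - x))"
  by (simp add: Q_def B_simps B_commute[of y x] algebra_simps)

text \<open>The domain is cut down to the preimage of \<open>W\<close>, so that the chart maps onto a ball.\<close>

lemma straightening_chart:
  fixes p
  assumes p: "p \<in> E"
  defines "V \<equiv> {x \<in> E. N (x - p) < r \<and> Q (x - p) \<in> W}"
  shows "p \<in> V" "openin (norm_topology E N) V" "smooth_diffeo E N V W (\<lambda>x. Q (x - p))"
    "\<And>y. y \<in> W \<Longrightarrow> p + \<xi> y \<in> V"
proof -
  show "p \<in> V" using p r_pos by (simp add: V_def W_def Q_def B_scale_right[of 0 0 0, simplified])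
  show in_V: "p + \<xi> y \<in> V" if "y \<in> W" for y
    using that p \<xi>[OF that] by (simp add: V_def)
  show V: "openin (norm_topology E N) V"
    unfolding openin_norm_topology
  proof (intro conjI ballI)
    fix x assume x: "x \<in> V"
    then have xE: "x \<in> E" by (simp add: V_def)
    let ?e = "min (r - N (x - p)) ((r / 2 - N (Q (x - p))) / 2)"
    have "y \<in> V" if y: "y \<in> E" "N (y - x) < ?e" for y
    proof -
      have yp: "N (y - p) < r" using N_diff_triangle[of y x p] y xE p by simp
      have xp: "N (x - p) < r" "N (Q (x - p)) < r / 2" using x by (auto simp: V_def W_def)
      have eq: "Q (y - p) - Q (x - p) = (y - x) + (B (x - p) (y - x) + B (y - p) (y - x))"
        using Q_diff_sum[of "x - p" "y - p"] xE y p by simp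
      have "N ((y - x) + (B (x - p) (y - x) + B (y - p) (y - x)))
          \<le> N (y - x) + (N (B (x - p) (y - x)) + N (B (y - p) (y - x)))"
        using N_triangle[of "y - x" "B (x - p) (y - x) + B (y - p) (y - x)"]
          N_triangle[of "B (x - p) (y - x)" "B (y - p) (y - x)"] xE y p by simp
      moreover have "N (B (x - p) (y - x)) \<le> N (y - x) / 4" "N (B (y - p) (y - x)) \<le> N (y - x) / 4"
        using xE y p xp yp by (intro N_B_small; simp)+
      ultimately have "N (Q (y - p) - Q (x - p)) \<le> 2 * N (y - x)"
        unfolding eq using N_nonneg[of "y - x"] by linarith
      then have "N (Q (y - p)) < r / 2"
        using N_triangle[of "Q (y - p) - Q (x - p)" "Q (x - p)"] xE y p by simp
      then show ?thesis using yp y p by (simp add: V_def W_def)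
    qed
    moreover have "?e > 0" using x by (simp add: V_def W_def)
    ultimately show "\<exists>e>0. \<forall>y\<in>E. N (y - x) < e \<longrightarrow> y \<in> V" by blast
  qed (auto simp: V_def)
  have inj: "inj_on (\<lambda>x. Q (x - p)) V"
  proof
    fix x y assume "x \<in> V" "y \<in> V" "Q (x - p) = Q (y - p)"
    then have "x - p = y - p" using p by - (rule Q_inj[of "x - p" "y - p"]; simp add: V_def)
    then show "x = y" by simp
  qed
  have bij: "bij_betw (\<lambda>x. Q (x - p)) V W"
    unfolding bij_betw_def
  proof (intro conjI inj equalityI subsetI)
    fix y assume "y \<in> W"
    then show "y \<in> (\<lambda>x. Q (x - p)) ` V"
      using in_V by (intro image_eqI[of _ _ "p + \<xi> y"]) (auto simp: \<xi>)
  qed (auto simp: V_def)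
  have "inv_into V (\<lambda>x. Q (x - p)) y = p + \<xi> y" if "y \<in> W" for y
    using in_V[OF that] \<xi>[OF that] by (intro inv_into_f_eq inj) auto
  then show "smooth_diffeo E N V W (\<lambda>x. Q (x - p))"
    unfolding smooth_diffeo_def using bij smooth_Q[OF V p] smooth_inverse[OF p] by auto
qed

end

lemma (in banach_subspace) smooth_submanifoldI:
  assumes U: "openin (norm_topology E N) U" and MU: "M \<subseteq> U"
    and loc: "\<And>p. p \<in> M \<Longrightarrow> \<exists>B b F. quadratic_perturbation E N B b \<and> complemented_subspace E N F \<and>
        (\<forall>x\<in>E. x \<in> U \<longrightarrow> (x \<in> M \<longleftrightarrow> (x - p) + B (x - p) (x - p) \<in> F))"
  shows "smooth_submanifold E N U M"
  unfolding smooth_submanifold_def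
proof (intro conjI ballI U MU)
  fix p assume pM: "p \<in> M"
  obtain B b F where B: "quadratic_perturbation E N B b" and F: "complemented_subspace E N F"
    and iff: "\<And>x. x \<in> E \<Longrightarrow> x \<in> U \<Longrightarrow> x \<in> M \<longleftrightarrow> (x - p) + B (x - p) (x - p) \<in> F"
    using loc[OF pM] by blast
  obtain e where e: "e > 0" "\<And>y. y \<in> E \<Longrightarrow> N (y - p) < e \<Longrightarrow> y \<in> U"
    using U pM MU unfolding openin_norm_topology by blast
  interpret B0: quadratic_perturbation E N B b by (rule B)
  (* The ball on which the chart is defined has radius 1 / (4 * b), so it shrinks into U when the
     bound b is increased. *)
  define b' where "b' = max b (1 / (4 * e))"
  interpret quadratic_perturbation E N B b'
  proof
    show "N (B x y) \<le> b' * N x * N y" if "x \<in> E" "y \<in> E" for x y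
    proof -
      have "b * N x * N y \<le> b' * N x * N y"
        by (intro mult_right_mono) (auto simp: b'_def)
      then show ?thesis using B0.B_bound[OF that] by simp
    qed
  qed (use B0.B_commute B0.B_add_right B0.B_scale_right B0.b_pos in \<open>auto simp: b'_def\<close>)
  have "1 / e \<le> 4 * b'" by (simp add: b'_def max_def field_simps)
  then have "r \<le> e" unfolding r_def using e(1) b_pos by (simp add: field_simps)
  have p: "p \<in> E" using pM MU U openin_norm_topology by blast
  define V where "V = {x \<in> E. N (x - p) < r \<and> Q (x - p) \<in> W}"
  note chart = straightening_chart[OF p, folded V_def]
  have VU: "V \<subseteq> U" using e(2) \<open>r \<le> e\<close> by (auto simp: V_def)
  have mem: "x \<in> M \<longleftrightarrow> Q (x - p) \<in> F" if "x \<in> V" for x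
    using iff[of x] that VU unfolding Q_def V_def by blast
  have "(\<lambda>x. Q (x - p)) ` (M \<inter> V) = F \<inter> W"
  proof (intro equalityI subsetI)
    fix y assume y: "y \<in> F \<inter> W"
    then have "p + \<xi> y \<in> V" "Q (p + \<xi> y - p) = y" using chart(4) by (auto simp: \<xi>)
    then show "y \<in> (\<lambda>x. Q (x - p)) ` (M \<inter> V)"
      using mem[of "p + \<xi> y"] y by (intro image_eqI[of _ _ "p + \<xi> y"]) auto
  next
    fix y assume "y \<in> (\<lambda>x. Q (x - p)) ` (M \<inter> V)"
    then show "y \<in> F \<inter> W" using mem by (auto simp: V_def)
  qed
  then show "\<exists>V W \<phi> F. p \<in> V \<and> V \<subseteq> U \<and> openin (norm_topology E N) V \<and> openin (norm_topology E N) W \<and>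
      smooth_diffeo E N V W \<phi> \<and> complemented_subspace E N F \<and> \<phi> ` (M \<inter> V) = F \<inter> W"
    using chart(1-3) VU openin_W F by blast
qed

section \<open>Periodic test functions\<close>

text \<open>A class of smooth periodic functions that is closed under products, as the theorem of Stone and Weierstrass needs,
and under derivatives.\<close>

inductive trig_poly :: "(real \<Rightarrow> real) \<Rightarrow> bool" where
  const: "trig_poly (\<lambda>_. c)"
| cos: "trig_poly (\<lambda>t. cos (2 * pi * t))"
| sin: "trig_poly (\<lambda>t. sin (2 * pi * t))"
| add: "trig_poly f \<Longrightarrow> trig_poly g \<Longrightarrow> trig_poly (\<lambda>t. f t + g t)"
| mult: "trig_poly f \<Longrightarrow> trig_poly g \<Longrightarrow> trig_poly (\<lambda>t. f t * g t)"

lemma trig_poly_deriv: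
  assumes "trig_poly f"
  shows "\<exists>f'. trig_poly f' \<and> (\<forall>t. (f has_real_derivative f' t) (at t))"
  using assms
proof induction
  case (const c)
  then show ?case by (intro exI[of _ "\<lambda>_. 0"]) (auto intro: trig_poly.const)
next
  case cos
  show ?case
    by (intro exI[of _ "\<lambda>t. (- (2 * pi)) * sin (2 * pi * t)"] conjI allI
        trig_poly.mult trig_poly.const trig_poly.sin) (auto intro!: derivative_eq_intros)
next
  case sin
  show ?case
    by (intro exI[of _ "\<lambda>t. (2 * pi) * cos (2 * pi * t)"] conjI allI
        trig_poly.mult trig_poly.const trig_poly.cos) (auto intro!: derivative_eq_intros)
next
  case (add f g)
  then obtain f' g' where *: "trig_poly f'" "\<forall>t. (f has_real_derivative f' t) (at t)"
    "trig_poly g'" "\<forall>t. (g has_real_derivative g' t) (at t)" by blast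
  then show ?case
    by (intro exI[of _ "\<lambda>t. f' t + g' t"]) (auto intro!: trig_poly.add derivative_eq_intros)
next
  case (mult f g)
  then obtain f' g' where *: "trig_poly f'" "\<forall>t. (f has_real_derivative f' t) (at t)"
    "trig_poly g'" "\<forall>t. (g has_real_derivative g' t) (at t)" by blast
  then show ?case using mult
    by (intro exI[of _ "\<lambda>t. f' t * g t + f t * g' t"] conjI allI)
      (auto intro!: trig_poly.add trig_poly.mult derivative_eq_intros)
qed

lemma trig_poly_continuous: "trig_poly f \<Longrightarrow> continuous_on S f"
  using trig_poly_deriv[of f]
  by (metis DERIV_isCont continuous_at_imp_continuous_on)

lemma trig_poly_periodic: "trig_poly f \<Longrightarrow> f (t + 1) = f t"
  by (induction rule: trig_poly.induct) (simp_all add: distrib_left)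

lemma smooth_test_function_trig_poly:
  assumes "trig_poly f"
  shows "smooth_test_function f"
  unfolding smooth_test_function_def periodic1_def
proof (intro conjI allI)
  have *: "trig_poly ((deriv ^^ k) f)" for k
  proof (induction k)
    case (Suc k)
    obtain f' where "trig_poly f'" "\<forall>t. ((deriv ^^ k) f has_real_derivative f' t) (at t)"
      using trig_poly_deriv[OF Suc.IH] by blast
    then have "(deriv ^^ Suc k) f = f'" by (auto simp: DERIV_imp_deriv)
    then show ?case using \<open>trig_poly f'\<close> by simp
  qed (use assms in simp)
  show "(deriv ^^ k) f differentiable at t" for k t
    using trig_poly_deriv[OF *[of k]] real_differentiable_def by blast
qed (use trig_poly_periodic assms in blast)

text \<open>A continuous function on the circle is the pull-back of a continuous function on the set of
  complex numbers of modulus one, where polynomials in the two coordinates are dense.\<close>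

lemma trig_poly_dense:
  fixes u :: "real \<Rightarrow> real"
  assumes u: "continuous_on {0..1} u" "u 0 = u 1" and e: "e > 0"
  shows "\<exists>p. trig_poly p \<and> (\<forall>t\<in>{0..1}. \<bar>u t - p t\<bar> < e)"
proof -
  define c :: "real \<Rightarrow> complex" where "c t = cis (2 * pi * t)" for t
  have c_cont: "continuous_on {0..1} c"
    unfolding c_def cis_conv_exp by (intro continuous_intros)
  define Z where "Z = c ` {0..1}"
  have Z: "compact Z" unfolding Z_def by (intro compact_continuous_image c_cont) auto
  have c_eq: "u t = u t'" if t: "t \<in> {0..1}" "t' \<in> {0..1}" and eq: "c t = c t'" for t t'
  proof -
    from eq have "sin (2 * pi * t) = sin (2 * pi * t') \<and> cos (2 * pi * t) = cos (2 * pi * t')"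
      by (auto simp: c_def complex_eq_iff)
    then obtain n :: int where n: "2 * pi * t = 2 * pi * t' + 2 * pi * n"
      using sin_cos_eq_iff[of "2 * pi * t" "2 * pi * t'"] by auto
    then have "2 * pi * t = 2 * pi * (t' + n)" by (simp add: algebra_simps)
    then have n: "t = t' + n" by simp
    then have "real_of_int n \<le> 1" "real_of_int n \<ge> -1" using t by auto
    then have "n = -1 \<or> n = 0 \<or> n = 1" by linarith
    then show ?thesis
    proof (elim disjE)
      assume "n = 1"
      then have "t = 1" "t' = 0" using t n by auto
      then show ?thesis using u by simp
    next
      assume "n = -1"
      then have "t = 0" "t' = 1" using t n by auto
      then show ?thesis using u by simp
    qed (use n in simp)
  qed
  define v where "v z = u (SOME t. t \<in> {0..1} \<and> c t = z)" for z
  have v: "v (c t) = u t" if "t \<in> {0..1}" for t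
  proof -
    have "\<exists>t'. t' \<in> {0..1} \<and> c t' = c t" using that by blast
    from someI_ex[OF this] show ?thesis unfolding v_def using c_eq that by blast
  qed
  have "continuous_on Z v"
    unfolding continuous_on_closed_vimage[OF compact_imp_closed[OF Z]]
  proof (intro allI impI)
    fix A :: "real set" assume "closed A"
    have "v -` A \<inter> Z = c ` (u -` A \<inter> {0..1})"
      unfolding Z_def using v by force
    moreover have "compact (u -` A \<inter> {0..1})"
      using continuous_closed_preimage[OF u(1) _ \<open>closed A\<close>]
      by (metis Int_commute bounded_Int bounded_closed_interval closed_atLeastAtMost compact_eq_bounded_closed)
    ultimately show "closed (v -` A \<inter> Z)"
      using c_cont by (simp add: compact_imp_closed compact_continuous_image continuous_on_subset)
  qed
  interpret function_ring_on "{f. continuous_on Z f \<and> trig_poly (\<lambda>t. f (c t))}" Z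
  proof
    fix x y assume xy: "x \<in> Z" "y \<in> Z" "x \<noteq> y"
    have "Re x \<noteq> Re y \<or> Im x \<noteq> Im y" using xy by (auto simp: complex_eq_iff)
    moreover have "Re \<in> {f. continuous_on Z f \<and> trig_poly (\<lambda>t. f (c t))}"
      "Im \<in> {f. continuous_on Z f \<and> trig_poly (\<lambda>t. f (c t))}"
      by (auto simp: c_def intro!: continuous_intros trig_poly.cos trig_poly.sin)
    ultimately show "\<exists>f\<in>{f. continuous_on Z f \<and> trig_poly (\<lambda>t. f (c t))}. f x \<noteq> f y" by blast
  qed (use Z in \<open>auto intro: trig_poly.intros continuous_intros\<close>)
  obtain g where g: "g \<in> {f. continuous_on Z f \<and> trig_poly (\<lambda>t. f (c t))}"
    "\<forall>x\<in>Z. \<bar>v x - g x\<bar> < e"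
    using Stone_Weierstrass_basic[OF \<open>continuous_on Z v\<close> e] by blast
  then show ?thesis using v by (intro exI[of _ "\<lambda>t. g (c t)"]) (auto simp: Z_def)
qed

lemma smooth_test_function_DERIV:
  "smooth_test_function \<phi> \<Longrightarrow> (\<phi> has_real_derivative deriv \<phi> t) (at t)"
  unfolding smooth_test_function_def
  by (metis DERIV_deriv_iff_real_differentiable funpow_0)

lemma smooth_test_function_deriv:
  assumes "smooth_test_function \<phi>"
  shows "smooth_test_function (deriv \<phi>)"
proof -
  have *: "(deriv ^^ k) (deriv \<phi>) = (deriv ^^ Suc k) \<phi>" for k by (simp add: funpow_swap1)
  have "deriv \<phi> (t + 1) = deriv \<phi> t" for t
  proof (rule DERIV_imp_deriv[symmetric])
    have "((\<lambda>x. \<phi> (x + 1)) has_real_derivative deriv \<phi> (t + 1)) (at t)"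
      using smooth_test_function_DERIV[OF assms, of "t + 1"] by (simp add: DERIV_shift)
    then show "(\<phi> has_real_derivative deriv \<phi> (t + 1)) (at t)"
      using assms by (simp add: smooth_test_function_def periodic1_def)
  qed
  then show ?thesis using assms unfolding smooth_test_function_def * periodic1_def by blast
qed

lemma smooth_test_function_continuous: "smooth_test_function \<phi> \<Longrightarrow> continuous_on S \<phi>"
  by (metis DERIV_isCont continuous_at_imp_continuous_on smooth_test_function_DERIV)

lemma smooth_test_function_diff_const:
  assumes "smooth_test_function \<phi>"
  shows "smooth_test_function (\<lambda>t. \<phi> t - c)"
proof -
  have "deriv (\<lambda>t. \<phi> t - c) = deriv \<phi>"
    by (rule ext, rule DERIV_imp_deriv) (auto intro!: derivative_eq_intros smooth_test_function_DERIV assms)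
  then have "(deriv ^^ Suc k) (\<lambda>t. \<phi> t - c) = (deriv ^^ Suc k) \<phi>" for k
    by (simp only: funpow_Suc_right o_apply)
  then have "(deriv ^^ k) (\<lambda>t. \<phi> t - c) differentiable at t" for k t
    using assms by (cases k) (auto simp: smooth_test_function_def simp del: funpow.simps(2) intro!: derivative_intros
      dest: spec[of _ 0])
  then show ?thesis using assms by (simp add: smooth_test_function_def periodic1_def)
qed

text \<open>A primitive of a periodic function is periodic precisely if the mean vanishes.  Hence test functions with mean zero
are the derivatives of test functions.\<close>

lemma smooth_test_function_primitive:
  assumes \<psi>: "smooth_test_function \<psi>" and 0: "integral {0..1} \<psi> = 0"
  shows "\<exists>\<phi>. smooth_test_function \<phi> \<and> deriv \<phi> = \<psi>"
proof -
  have "isCont \<psi> t" for t using smooth_test_function_DERIV[OF \<psi>] DERIV_isCont by blast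
  then obtain \<phi> where \<phi>: "\<And>t. (\<phi> has_vector_derivative \<psi> t) (at t)"
    using einterval_antiderivative[of "-\<infinity>" \<infinity> \<psi>] by auto
  then have D: "(\<phi> has_real_derivative \<psi> t) (at t)" for t
    by (simp add: has_real_derivative_iff_has_vector_derivative)
  have "(\<psi> has_integral (\<phi> 1 - \<phi> 0)) {0..1}"
    by (intro fundamental_theorem_of_calculus) (auto intro: has_vector_derivative_at_within \<phi>)
  then have "\<phi> 1 = \<phi> 0" using 0 by (auto dest: integral_unique)
  have "((\<lambda>t. \<phi> (t + 1) - \<phi> t) has_real_derivative 0) (at t)" for t
    using \<psi> D[of "t + 1"] D[of t]
    by (auto intro!: derivative_eq_intros simp: DERIV_shift smooth_test_function_def periodic1_def)
  then have "\<phi> (t + 1) - \<phi> t = \<phi> (0 + 1) - \<phi> 0" for t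
    using DERIV_isconst_all[of "\<lambda>t. \<phi> (t + 1) - \<phi> t" t 0] by blast
  then have per: "\<phi> (t + 1) = \<phi> t" for t using \<open>\<phi> 1 = \<phi> 0\<close> by simp
  have d: "deriv \<phi> = \<psi>" using D by (auto simp: DERIV_imp_deriv)
  have "(deriv ^^ k) \<phi> differentiable at t" for k t
  proof (cases k)
    case 0
    then show ?thesis using D real_differentiable_def by auto
  next
    case (Suc j)
    then have "(deriv ^^ k) \<phi> = (deriv ^^ j) \<psi>" by (simp add: funpow_Suc_right d del: funpow.simps(2))
    then show ?thesis using \<psi> by (simp add: smooth_test_function_def)
  qed
  then show ?thesis using d per by (auto simp: smooth_test_function_def periodic1_def)
qed

lemma integral_deriv_smooth_test_function:
  assumes "smooth_test_function \<phi>"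
  shows "integral {0..1} (deriv \<phi>) = 0"
proof -
  have "(deriv \<phi> has_integral (\<phi> 1 - \<phi> 0)) {0..1}"
    using smooth_test_function_DERIV[OF assms]
    by (intro fundamental_theorem_of_calculus)
      (auto intro: has_field_derivative_at_within simp flip: has_real_derivative_iff_has_vector_derivative)
  moreover have "\<phi> 1 = \<phi> 0" using assms by (metis add_0 periodic1_def smooth_test_function_def)
  ultimately show ?thesis by (auto dest: integral_unique)
qed

text \<open>The function \<open>u\<close> minus its mean is orthogonal to all test functions of mean zero.  It is also a uniform limit of such
test functions, so it is orthogonal to itself.\<close>

lemma continuous_zero_weak_deriv_imp_constant:
  fixes u :: "real \<Rightarrow> real"
  assumes u: "continuous_on {0..1} u" "u 0 = u 1"
    and weak: "\<And>\<phi>. smooth_test_function \<phi> \<Longrightarrow> integral {0..1} (\<lambda>t. deriv \<phi> t * u t) = 0"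
    and t: "t \<in> {0..1}"
  shows "u t = u 0"
proof -
  define m where "m = integral {0..1} u"
  define v where "v t = u t - m" for t
  have v: "continuous_on {0..1} v" "v 0 = v 1" using u by (auto simp: v_def intro!: continuous_intros)
  have int_v: "integral {0..1} v = 0"
    unfolding v_def using u by (subst integral_diff) (auto simp: m_def intro!: integrable_continuous_interval)
  have cont_int: "f integrable_on {0..1}" if "continuous_on {0..1} f" for f :: "real \<Rightarrow> real"
    using that by (rule integrable_continuous_interval)
  have weak_v: "integral {0..1} (\<lambda>t. deriv \<phi> t * v t) = 0" if \<phi>: "smooth_test_function \<phi>" for \<phi>
  proof -
    have d: "continuous_on {0..1} (deriv \<phi>)"
      using \<phi> smooth_test_function_continuous smooth_test_function_deriv by blast
    have "integral {0..1} (\<lambda>t. deriv \<phi> t * v t)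
        = integral {0..1} (\<lambda>t. deriv \<phi> t * u t) - integral {0..1} (\<lambda>t. deriv \<phi> t * m)"
      unfolding v_def right_diff_distrib using d u by (intro integral_diff cont_int continuous_intros)
    then show ?thesis using weak[OF \<phi>] integral_deriv_smooth_test_function[OF \<phi>] by simp
  qed
  obtain K where K: "\<And>t. t \<in> {0..1} \<Longrightarrow> \<bar>v t\<bar> \<le> K" "K > 0"
  proof -
    have "bounded (v ` {0..1})" using v(1) compact_continuous_image compact_imp_bounded by blast
    then show ?thesis using that unfolding bounded_pos by (metis image_eqI real_norm_def)
  qed
  have small: "integral {0..1} (\<lambda>t. v t * v t) \<le> K * (2 * e)" if e: "e > 0" for e
  proof -
    obtain p where p: "trig_poly p" "\<And>t. t \<in> {0..1} \<Longrightarrow> \<bar>v t - p t\<bar> < e"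
      using trig_poly_dense[OF v e] by blast
    have pc: "continuous_on {0..1} p" by (rule trig_poly_continuous[OF p(1)])
    define q where "q = integral {0..1} p"
    have "q = - integral {0..1} (\<lambda>t. v t - p t)"
      using v pc int_v by (subst integral_diff) (auto simp: q_def intro!: cont_int)
    moreover have "norm (integral {0..1} (\<lambda>t. v t - p t)) \<le> e * (1 - 0)"
      using p(2) v pc by (intro integral_bound continuous_intros) (auto intro: less_imp_le)
    ultimately have q: "\<bar>q\<bar> \<le> e" by simp
    have "integral {0..1} (\<lambda>t. p t - q) = 0"
      using pc by (subst integral_diff) (auto simp: q_def intro!: cont_int)
    then obtain \<phi> where \<phi>: "smooth_test_function \<phi>" "deriv \<phi> = (\<lambda>t. p t - q)"
      using smooth_test_function_primitive[OF smooth_test_function_diff_const[OF smooth_test_function_trig_poly[OF p(1)]]]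
      by blast
    have "integral {0..1} (\<lambda>t. v t * v t) = integral {0..1} (\<lambda>t. v t * v t) - integral {0..1} (\<lambda>t. (p t - q) * v t)"
      using weak_v[OF \<phi>(1)] \<phi>(2) by simp
    also have "\<dots> = integral {0..1} (\<lambda>t. v t * v t - (p t - q) * v t)"
      using v pc by (intro integral_diff[symmetric] cont_int continuous_intros)
    also have "\<dots> \<le> integral {0..1} (\<lambda>t::real. K * (2 * e))"
    proof (rule integral_le)
      show "(\<lambda>t. v t * v t - (p t - q) * v t) integrable_on {0..1}"
        using v pc by (intro cont_int continuous_intros)
      fix t :: real assume t: "t \<in> {0..1}"
      have "v t * v t - (p t - q) * v t = (v t - p t + q) * v t" by (simp add: algebra_simps)
      also have "\<dots> \<le> \<bar>v t - p t + q\<bar> * \<bar>v t\<bar>" using abs_ge_self[of "(v t - p t + q) * v t"] by (simp add: abs_mult)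
      also have "\<dots> \<le> (2 * e) * K" using p(2)[OF t] q K(1)[OF t] e by (intro mult_mono) auto
      finally show "v t * v t - (p t - q) * v t \<le> K * (2 * e)" by (simp add: mult_ac)
    qed (intro cont_int continuous_intros)
    finally show ?thesis by simp
  qed
  have "integral {0..1} (\<lambda>t. v t * v t) \<le> 0"
  proof (rule field_le_epsilon)
    fix e :: real assume "e > 0"
    then show "integral {0..1} (\<lambda>t. v t * v t) \<le> 0 + e"
      using small[of "e / (2 * K)"] K(2) by simp
  qed
  moreover have "0 \<le> integral {0..1} (\<lambda>t. v t * v t)"
    using v by (intro integral_nonneg cont_int continuous_intros) auto
  ultimately have "integral {0..1} (\<lambda>t. v t * v t) = 0" by simp
  then have "\<forall>t\<in>{0..1}. v t * v t = 0"
    using v by (subst (asm) integral_eq_0_iff) (auto intro!: continuous_intros)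
  then have "v t = 0" "v 0 = 0" using t by auto
  then show ?thesis by (simp add: v_def)
qed

section \<open>Weak derivatives on the circle\<close>

text \<open>The product rule for indefinite integrals, by Fubini's theorem: the double integral of \<open>prod (f x) (g y)\<close> over the
square splits into the two triangles \<open>x \<le> y\<close> and \<open>y < x\<close>, and the inner integrals over the triangles are increments of
\<open>F\<close> and \<open>G\<close>.\<close>

lemma integral_prod_primitives:
  fixes f F :: "real \<Rightarrow> 'a::euclidean_space" and g G :: "real \<Rightarrow> 'b::euclidean_space"
    and prod :: "'a \<Rightarrow> 'b \<Rightarrow> 'c::euclidean_space"
  assumes prod: "bounded_bilinear prod" and T: "0 \<le> T"
    and f: "set_integrable lborel {0..T} f" and g: "set_integrable lborel {0..T} g"
    and F: "\<And>t. t \<in> {0..T} \<Longrightarrow> F t = F 0 + (LINT u:{0..t}|lborel. f u)"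
    and G: "\<And>t. t \<in> {0..T} \<Longrightarrow> G t = G 0 + (LINT u:{0..t}|lborel. g u)"
  shows "set_integrable lborel {0..T} (\<lambda>t. prod (F t) (g t) + prod (f t) (G t))" (is ?int)
    and "(LINT t:{0..T}|lborel. prod (F t) (g t) + prod (f t) (G t)) = prod (F T) (G T) - prod (F 0) (G 0)" (is ?eq)
proof -
  interpret prod: bounded_bilinear prod by (rule prod)
  define f' where "f' x = indicator {0..T} x *\<^sub>R f x" for x
  define g' where "g' x = indicator {0..T} x *\<^sub>R g x" for x
  have f': "integrable lborel f'" and g': "integrable lborel g'"
    using f g by (simp_all add: f'_def[abs_def] g'_def[abs_def] set_integrable_def)
  have [measurable]: "f' \<in> borel_measurable borel" "g' \<in> borel_measurable borel"
    using f' g' by auto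
  have c: "continuous_on UNIV (\<lambda>x. prod (fst x) (snd x))"
    by (rule prod.continuous_on) (intro continuous_on_fst continuous_on_snd continuous_on_id)+
  have [measurable]: "(\<lambda>z. prod (f' (fst z)) (g' (snd z))) \<in> borel_measurable (borel \<Otimes>\<^sub>M borel)"
    by (rule borel_measurable_continuous_Pair[OF _ _ c]) measurable
  have ind: "(LINT x|lborel. indicator {..y} x *\<^sub>R f' x) = F y - F 0" if "y \<in> {0..T}" for y
  proof -
    have "(LINT x|lborel. indicator {..y} x *\<^sub>R f' x) = (LINT x:{0..y}|lborel. f x)"
      unfolding set_lebesgue_integral_def f'_def using that
      by (intro Bochner_Integration.integral_cong refl) (auto simp: indicator_def)
    then show ?thesis using F[OF that] by simp
  qed
  have ind': "(LINT y|lborel. indicator {..<x} y *\<^sub>R g' y) = G x - G 0" if "x \<in> {0..T}" for x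
  proof -
    have "(LINT y|lborel. indicator {..<x} y *\<^sub>R g' y) = (LINT y|lborel. indicator {0..x} y *\<^sub>R g' y)"
    proof (rule integral_cong_AE)
      show "AE y in lborel. indicator {..<x} y *\<^sub>R g' y = indicator {0..x} y *\<^sub>R g' y"
        using AE_lborel_singleton[of x] by eventually_elim (auto simp: indicator_def g'_def)
    qed measurable
    also have "\<dots> = (LINT y:{0..x}|lborel. g y)"
      unfolding set_lebesgue_integral_def g'_def using that
      by (intro Bochner_Integration.integral_cong refl) (auto simp: indicator_def)
    finally show ?thesis using G[OF that] by simp
  qed
  obtain K where K: "\<And>a b. norm (prod a b) \<le> norm a * norm b * K" using prod.bounded by blast
  let ?H = "\<lambda>(x, y). prod (f' x) (g' y)"
  have H: "integrable (lborel \<Otimes>\<^sub>M lborel) ?H"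
  proof (rule Bochner_Integration.integrable_bound)
    have "integrable (lborel \<Otimes>\<^sub>M lborel) (\<lambda>(x, y). norm (f' x) * norm (g' y))"
      using f' g' by (intro lborel_pair.Fubini_integrable) (auto simp: abs_mult)
    then show "integrable (lborel \<Otimes>\<^sub>M lborel) (\<lambda>z. (case z of (x, y) \<Rightarrow> norm (f' x) * norm (g' y)) * K)"
      by simp
    show "AE z in lborel \<Otimes>\<^sub>M lborel. norm (?H z) \<le> norm ((case z of (x, y) \<Rightarrow> norm (f' x) * norm (g' y)) * K)"
      using K by (auto intro!: AE_I2 order_trans[OF K abs_ge_self])
    show "?H \<in> borel_measurable (lborel \<Otimes>\<^sub>M lborel)" by (simp add: case_prod_beta)
  qed
  define H1 where "H1 x y = (indicator {..y} x *\<^sub>R prod (f' x) (g' y) :: 'c)" for x y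
  define H2 where "H2 x y = (indicator {..<x} y *\<^sub>R prod (f' x) (g' y) :: 'c)" for x y
  have m1: "{z \<in> space (borel \<Otimes>\<^sub>M borel). fst z \<le> (snd z :: real)} \<in> sets (borel \<Otimes>\<^sub>M borel)"
    "{z \<in> space (borel \<Otimes>\<^sub>M borel). (snd z :: real) < fst z} \<in> sets (borel \<Otimes>\<^sub>M borel)"
    by measurable
  have H1: "integrable (lborel \<Otimes>\<^sub>M lborel) (\<lambda>(x, y). H1 x y)"
  proof -
    have "integrable (lborel \<Otimes>\<^sub>M lborel) (\<lambda>z. indicator {z. fst z \<le> snd z} z *\<^sub>R ?H z)"
      using H m1 by (intro integrable_mult_indicator) (auto simp: space_pair_measure)
    then show ?thesis by (simp add: H1_def case_prod_unfold indicator_def)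
  qed
  have H2: "integrable (lborel \<Otimes>\<^sub>M lborel) (\<lambda>(x, y). H2 x y)"
  proof -
    have "integrable (lborel \<Otimes>\<^sub>M lborel) (\<lambda>z. indicator {z. snd z < fst z} z *\<^sub>R ?H z)"
      using H m1 by (intro integrable_mult_indicator) (auto simp: space_pair_measure)
    then show ?thesis by (simp add: H2_def case_prod_unfold indicator_def)
  qed
  have bl: "bounded_linear (\<lambda>x. prod x b)" "bounded_linear (\<lambda>y. prod a y)" for a b
    by (rule prod.bounded_linear_left prod.bounded_linear_right)+
  have I1: "(LINT x|lborel. H1 x y) = indicator {0..T} y *\<^sub>R prod (F y - F 0) (g y)" for y
  proof -
    have "(LINT x|lborel. H1 x y) = (LINT x|lborel. prod (indicator {..y} x *\<^sub>R f' x) (g' y))"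
      by (simp add: H1_def prod.scaleR_left)
    also have "\<dots> = prod (LINT x|lborel. indicator {..y} x *\<^sub>R f' x) (g' y)"
      using f' by (intro integral_bounded_linear bl integrable_mult_indicator) auto
    finally show ?thesis using ind[of y] by (auto simp: g'_def indicator_def prod.zero_right)
  qed
  have I2: "(LINT y|lborel. H2 x y) = indicator {0..T} x *\<^sub>R prod (f x) (G x - G 0)" for x
  proof -
    have "(LINT y|lborel. H2 x y) = (LINT y|lborel. prod (f' x) (indicator {..<x} y *\<^sub>R g' y))"
      by (simp add: H2_def prod.scaleR_right)
    also have "\<dots> = prod (f' x) (LINT y|lborel. indicator {..<x} y *\<^sub>R g' y)"
      using g' by (intro integral_bounded_linear bl integrable_mult_indicator) auto
    finally show ?thesis using ind'[of x] by (auto simp: f'_def indicator_def prod.zero_left)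
  qed
  have int1: "integrable lborel (\<lambda>y. indicator {0..T} y *\<^sub>R prod (F y - F 0) (g y))"
    using lborel_pair.integrable_snd[OF H1] unfolding I1 .
  have int2: "integrable lborel (\<lambda>x. indicator {0..T} x *\<^sub>R prod (f x) (G x - G 0))"
    using lborel_pair.integrable_fst[OF H2] unfolding I2 .
  have "(LINT y|lborel. indicator {0..T} y *\<^sub>R prod (F y - F 0) (g y))
      + (LINT x|lborel. indicator {0..T} x *\<^sub>R prod (f x) (G x - G 0))
      = integral\<^sup>L (lborel \<Otimes>\<^sub>M lborel) (\<lambda>(x, y). H1 x y) + integral\<^sup>L (lborel \<Otimes>\<^sub>M lborel) (\<lambda>(x, y). H2 x y)"
    using lborel_pair.integral_snd[OF H1] lborel_pair.integral_fst[OF H2] unfolding I1 I2 by simp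
  also have "\<dots> = integral\<^sup>L (lborel \<Otimes>\<^sub>M lborel) (\<lambda>z. (case z of (x, y) \<Rightarrow> H1 x y) + (case z of (x, y) \<Rightarrow> H2 x y))"
    by (rule Bochner_Integration.integral_add[symmetric, OF H1 H2])
  also have "\<dots> = integral\<^sup>L (lborel \<Otimes>\<^sub>M lborel) ?H"
    by (intro Bochner_Integration.integral_cong refl)
      (auto simp: H1_def H2_def indicator_def)
  also have "\<dots> = (LINT x|lborel. LINT y|lborel. prod (f' x) (g' y))"
    using lborel_pair.integral_fst[OF H] by simp
  also have "\<dots> = (LINT x|lborel. prod (f' x) (LINT y|lborel. g' y))"
    using g' by (intro Bochner_Integration.integral_cong refl integral_bounded_linear bl)
  also have "\<dots> = prod (LINT x|lborel. f' x) (LINT y|lborel. g' y)"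
    using f' by (intro integral_bounded_linear bl)
  also have "(LINT x|lborel. f' x) = F T - F 0"
    using F[of T] T by (simp add: f'_def[abs_def] set_lebesgue_integral_def)
  also have "(LINT x|lborel. g' x) = G T - G 0"
    using G[of T] T by (simp add: g'_def[abs_def] set_lebesgue_integral_def)
  finally have sum: "(LINT y|lborel. indicator {0..T} y *\<^sub>R prod (F y - F 0) (g y))
      + (LINT x|lborel. indicator {0..T} x *\<^sub>R prod (f x) (G x - G 0)) = prod (F T - F 0) (G T - G 0)" .
  have int3: "integrable lborel (\<lambda>y. prod (F 0) (g' y))" "integrable lborel (\<lambda>x. prod (f' x) (G 0))"
    by (rule integrable_bounded_linear[OF bl(2) g'], rule integrable_bounded_linear[OF bl(1) f'])
  have int3_eq: "(LINT y|lborel. prod (F 0) (g' y)) = prod (F 0) (G T - G 0)"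
    "(LINT x|lborel. prod (f' x) (G 0)) = prod (F T - F 0) (G 0)"
    using integral_bounded_linear[OF bl(2) g'] integral_bounded_linear[OF bl(1) f'] F[of T] G[of T] T
    by (simp_all add: f'_def[abs_def] g'_def[abs_def] set_lebesgue_integral_def)
  have split: "indicator {0..T} t *\<^sub>R (prod (F t) (g t) + prod (f t) (G t)) =
      (indicator {0..T} t *\<^sub>R prod (F t - F 0) (g t) + indicator {0..T} t *\<^sub>R prod (f t) (G t - G 0))
       + (prod (F 0) (g' t) + prod (f' t) (G 0))" for t
    by (simp add: f'_def g'_def prod.scaleR_left prod.scaleR_right prod.diff_left prod.diff_right algebra_simps)
  show ?int
    unfolding set_integrable_def split using int1 int2 int3 by (intro Bochner_Integration.integrable_add)
  have "(LINT t:{0..T}|lborel. prod (F t) (g t) + prod (f t) (G t)) =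
      prod (F T - F 0) (G T - G 0) + (prod (F 0) (G T - G 0) + prod (F T - F 0) (G 0))"
    unfolding set_lebesgue_integral_def split using int1 int2 int3 sum int3_eq by simp
  also have "\<dots> = prod (F T) (G T) - prod (F 0) (G 0)"
    by (simp add: prod.diff_left prod.diff_right)
  finally show ?eq .
qed

lemma l2_periodic_measurable [measurable_dest]: "f \<in> l2_periodic \<Longrightarrow> f \<in> borel_measurable borel"
  by (simp add: l2_periodic_def)

lemma l2_sq_cong_AE:
  assumes "AE t in lborel. t \<in> {0..1} \<longrightarrow> f t = g t"
  shows "l2_sq f = l2_sq g"
  unfolding l2_sq_def using assms by (intro nn_integral_cong_AE) (auto simp: indicator_def elim!: eventually_mono)

lemma l2_sq_le:
  assumes "\<And>t. t \<in> {0..1} \<Longrightarrow> norm (f t) \<le> M"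
  shows "l2_sq f \<le> ennreal (M\<^sup>2)"
proof -
  have "l2_sq f \<le> (\<integral>\<^sup>+t. ennreal (M\<^sup>2) * indicator {0..1} (t::real) \<partial>lborel)"
    unfolding l2_sq_def using assms
    by (intro nn_integral_mono) (auto simp: indicator_def intro!: ennreal_leI power_mono)
  also have "\<dots> = ennreal (M\<^sup>2)" by (simp add: nn_integral_cmult_indicator)
  finally show ?thesis .
qed

lemma norm_add_sq_le: "(norm (x + y))\<^sup>2 \<le> 2 * (norm x)\<^sup>2 + 2 * (norm y)\<^sup>2"
proof -
  have "(norm (x + y))\<^sup>2 \<le> (norm x + norm y)\<^sup>2" by (intro power_mono norm_triangle_ineq) auto
  also have "\<dots> \<le> 2 * (norm x)\<^sup>2 + 2 * (norm y)\<^sup>2"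
    using sum_squares_bound[of "norm x" "norm y"] by (simp add: power2_sum)
  finally show ?thesis .
qed

lemma l2_sq_linear_le:
  fixes f :: "real \<Rightarrow> 'a::euclidean_space" and g :: "real \<Rightarrow> 'b::euclidean_space"
    and h :: "real \<Rightarrow> 'c::euclidean_space"
  assumes [measurable]: "f \<in> borel_measurable borel" "g \<in> borel_measurable borel"
    and le: "\<And>t. t \<in> {0..1} \<Longrightarrow> (norm (h t))\<^sup>2 \<le> a * (norm (f t))\<^sup>2 + b * (norm (g t))\<^sup>2"
    and ab: "0 \<le> a" "0 \<le> b"
  shows "l2_sq h \<le> ennreal a * l2_sq f + ennreal b * l2_sq g"
proof -
  have "l2_sq h \<le> (\<integral>\<^sup>+t. ennreal a * (ennreal ((norm (f t))\<^sup>2) * indicator {0..1} t)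
      + ennreal b * (ennreal ((norm (g t))\<^sup>2) * indicator {0..1} t) \<partial>lborel)"
    unfolding l2_sq_def using le ab
    by (intro nn_integral_mono)
      (auto simp: indicator_def ennreal_leI simp flip: ennreal_mult ennreal_plus)
  also have "\<dots> = ennreal a * l2_sq f + ennreal b * l2_sq g"
    unfolding l2_sq_def by (subst nn_integral_add) (auto simp: nn_integral_cmult)
  finally show ?thesis .
qed

lemma l2_periodic_add:
  assumes "f \<in> l2_periodic" "g \<in> l2_periodic"
  shows "(\<lambda>t. f t + g t) \<in> l2_periodic"
proof -
  have "l2_sq (\<lambda>t. f t + g t) \<le> ennreal 2 * l2_sq f + ennreal 2 * l2_sq g"
    using assms norm_add_sq_le by (intro l2_sq_linear_le) (auto simp: l2_periodic_def)
  also have "\<dots> < \<infinity>" using assms by (auto simp: l2_periodic_def ennreal_mult_less_top)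
  finally show ?thesis using assms by (auto simp: l2_periodic_def periodic1_def)
qed

lemma l2_periodic_scaleR:
  assumes "f \<in> l2_periodic"
  shows "(\<lambda>t. c *\<^sub>R f t) \<in> l2_periodic"
proof -
  have "l2_sq (\<lambda>t. c *\<^sub>R f t) \<le> ennreal (c\<^sup>2) * l2_sq f + ennreal 0 * l2_sq f"
    using assms by (intro l2_sq_linear_le) (auto simp: l2_periodic_def power_mult_distrib)
  also have "\<dots> < \<infinity>" using assms by (auto simp: l2_periodic_def ennreal_mult_less_top)
  finally show ?thesis using assms by (auto simp: l2_periodic_def periodic1_def)
qed

lemma l2_periodic_diff: "f \<in> l2_periodic \<Longrightarrow> g \<in> l2_periodic \<Longrightarrow> (\<lambda>t. f t - g t) \<in> l2_periodic"
  using l2_periodic_add[of f "\<lambda>t. (-1) *\<^sub>R g t"] l2_periodic_scaleR[of g "-1"] by simp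

lemma periodic1_frac:
  assumes "periodic1 f"
  shows "f (frac t) = f t"
proof -
  have "f (t + of_int n) = f t" for t n
  proof (induction n rule: int_induct[where k = 0])
    case (step1 i)
    have "f (t + of_int (i + 1)) = f (t + of_int i + 1)" by (simp add: add.assoc)
    then show ?case using step1 assms unfolding periodic1_def by metis
  next
    case (step2 i)
    have "f (t + of_int (i - 1) + 1) = f (t + of_int i)" by simp
    then show ?case using step2 assms unfolding periodic1_def by metis
  qed simp
  from this[of "frac t" "floor t"] show ?thesis by (simp add: frac_def)
qed

lemma frac_in_unit: "frac t \<in> {0..1}"
  using frac_lt_1[of t] by (simp add: less_imp_le)

lemma periodic1_bounded:
  fixes f :: "real \<Rightarrow> 'a::real_normed_vector"
  assumes "continuous_on UNIV f" "periodic1 f"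
  obtains M where "M > 0" "\<And>t. norm (f t) \<le> M"
proof -
  have "bounded (f ` {0..1})"
    using assms by (intro compact_imp_bounded compact_continuous_image) (auto intro: continuous_on_subset)
  then obtain M where M: "M > 0" "\<And>t. t \<in> {0..1} \<Longrightarrow> norm (f t) \<le> M"
    unfolding bounded_pos by auto
  have "norm (f t) \<le> M" for t
    using M(2)[OF frac_in_unit[of t]] periodic1_frac[OF assms(2), of t] by simp
  then show ?thesis using that M(1) by blast
qed

lemma continuous_periodic_l2: "continuous_on UNIV f \<Longrightarrow> periodic1 f \<Longrightarrow> f \<in> l2_periodic"
  for f :: "real \<Rightarrow> 'a::euclidean_space"
proof -
  assume f: "continuous_on UNIV f" "periodic1 f"
  then obtain M where "\<And>t. norm (f t) \<le> M" using periodic1_bounded by blast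
  then have "l2_sq f \<le> ennreal (M\<^sup>2)" by (intro l2_sq_le)
  then have "l2_sq f < \<infinity>" using ennreal_less_top le_less_trans unfolding infinity_ennreal_def by blast
  then show ?thesis using f by (simp add: l2_periodic_def borel_measurable_continuous_onI)
qed

lemma l2_integrable:
  assumes "f \<in> l2_periodic"
  shows "set_integrable lborel {0..1} f"
  unfolding set_integrable_def
proof (rule integrableI_bounded)
  have [measurable]: "f \<in> borel_measurable borel" using assms by (simp add: l2_periodic_def)
  show "(\<lambda>x. indicat_real {0..1} x *\<^sub>R f x) \<in> borel_measurable lborel" by measurable
  have le: "norm x \<le> 1 + (norm x)\<^sup>2" for x :: 'a
    using sum_squares_bound[of "norm x" 1] norm_ge_zero[of x] zero_le_power2[of "norm x"]
    unfolding power_one mult_1_right by linarith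
  have le': "ennreal (norm x) \<le> 1 + ennreal ((norm x)\<^sup>2)" for x :: 'a
    using ennreal_leI[OF le[of x]] by (simp add: ennreal_plus)
  have "(\<integral>\<^sup>+x. ennreal (norm (indicat_real {0..1} x *\<^sub>R f x)) \<partial>lborel)
      \<le> (\<integral>\<^sup>+x. indicator {0..1} x + ennreal ((norm (f x))\<^sup>2) * indicator {0..1} x \<partial>lborel)"
    using le' by (intro nn_integral_mono) (auto simp: indicator_def)
  also have "\<dots> = 1 + l2_sq f"
    by (subst nn_integral_add) (auto simp: l2_sq_def)
  also have "\<dots> < \<infinity>" using assms by (simp add: l2_periodic_def)
  finally show "(\<integral>\<^sup>+x. ennreal (norm (indicat_real {0..1} x *\<^sub>R f x)) \<partial>lborel) < \<infinity>" .
qed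

lemma set_integrable_continuous_scaleR:
  fixes f :: "real \<Rightarrow> 'a::euclidean_space" and \<phi> :: "real \<Rightarrow> real"
  assumes f: "set_integrable lborel {a..b} f" and \<phi>: "continuous_on UNIV \<phi>"
  shows "set_integrable lborel {a..b} (\<lambda>t. \<phi> t *\<^sub>R f t)"
proof -
  have "bounded (\<phi> ` {a..b})"
    using \<phi> by (intro compact_imp_bounded compact_continuous_image) (auto intro: continuous_on_subset)
  then obtain K where K: "\<And>t. t \<in> {a..b} \<Longrightarrow> norm (\<phi> t) \<le> K" unfolding bounded_iff by blast
  have [measurable]: "\<phi> \<in> borel_measurable borel" using \<phi> by (rule borel_measurable_continuous_onI)
  have m: "(\<lambda>t. indicator {a..b} t *\<^sub>R f t) \<in> borel_measurable lborel"
    using f by (auto simp: set_integrable_def)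
  have m': "(\<lambda>t. \<phi> t *\<^sub>R (indicator {a..b} t *\<^sub>R f t)) \<in> borel_measurable lborel"
    using m by measurable
  have "integrable lborel (\<lambda>t. \<phi> t *\<^sub>R (indicator {a..b} t *\<^sub>R f t))"
  proof (rule Bochner_Integration.integrable_bound)
    show "integrable lborel (\<lambda>t. K *\<^sub>R (indicator {a..b} t *\<^sub>R f t))"
      using f by (intro integrable_scaleR_right) (simp add: set_integrable_def)
    show "AE t in lborel. norm (\<phi> t *\<^sub>R (indicator {a..b} t *\<^sub>R f t)) \<le> norm (K *\<^sub>R (indicator {a..b} t *\<^sub>R f t))"
    proof (intro AE_I2)
      fix t show "norm (\<phi> t *\<^sub>R (indicator {a..b} t *\<^sub>R f t)) \<le> norm (K *\<^sub>R (indicator {a..b} t *\<^sub>R f t))"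
        using K[of t] by (cases "t \<in> {a..b}") (auto intro!: mult_right_mono)
    qed
  qed (rule m')
  then show ?thesis by (simp add: set_integrable_def mult.commute)
qed

lemma smooth_test_function_primitive_of_deriv:
  assumes \<phi>: "smooth_test_function \<phi>" and t: "0 \<le> t"
  shows "\<phi> t = \<phi> 0 + (LINT u:{0..t}|lborel. deriv \<phi> u)"
    and "set_integrable lborel {0..t} (deriv \<phi>)"
proof -
  have c: "continuous_on {0..t} (deriv \<phi>)"
    using \<phi> smooth_test_function_continuous smooth_test_function_deriv by blast
  then show int: "set_integrable lborel {0..t} (deriv \<phi>)"
    unfolding set_integrable_def by (intro borel_integrable_compact) auto
  have "(deriv \<phi> has_integral (\<phi> t - \<phi> 0)) {0..t}"
    using smooth_test_function_DERIV[OF \<phi>] t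
    by (intro fundamental_theorem_of_calculus)
      (auto intro: has_field_derivative_at_within simp flip: has_real_derivative_iff_has_vector_derivative)
  then show "\<phi> t = \<phi> 0 + (LINT u:{0..t}|lborel. deriv \<phi> u)"
    using set_borel_integral_eq_integral[OF int] by (simp add: integral_unique)
qed

lemma test_integrable:
  fixes f :: "real \<Rightarrow> 'a::euclidean_space"
  assumes "smooth_test_function \<phi>" "set_integrable lborel {0..1} f"
  shows "set_integrable lborel {0..1} (\<lambda>t. \<phi> t *\<^sub>R f t)"
    "set_integrable lborel {0..1} (\<lambda>t. deriv \<phi> t *\<^sub>R f t)"
  using assms smooth_test_function_deriv
  by (auto intro!: set_integrable_continuous_scaleR smooth_test_function_continuous)

lemma integral_by_parts_primitive:
  fixes f h :: "real \<Rightarrow> 'a::euclidean_space"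
  assumes \<phi>: "smooth_test_function \<phi>" and h: "set_integrable lborel {0..1} h"
    and f: "continuous_on {0..1} f" "f 0 = f 1"
    and prim: "\<And>t. t \<in> {0..1} \<Longrightarrow> f t = f 0 + (LINT u:{0..t}|lborel. h u)"
  shows "(LINT t:{0..1}|lborel. deriv \<phi> t *\<^sub>R f t) = - (LINT t:{0..1}|lborel. \<phi> t *\<^sub>R h t)"
proof -
  have f_int: "set_integrable lborel {0..1} f"
    unfolding set_integrable_def using f by (intro borel_integrable_compact) auto
  have "(LINT t:{0..1}|lborel. \<phi> t *\<^sub>R h t + deriv \<phi> t *\<^sub>R f t) = \<phi> 1 *\<^sub>R f 1 - \<phi> 0 *\<^sub>R f 0"
    by (rule integral_prod_primitives(2)[OF bounded_bilinear_scaleR _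
          smooth_test_function_primitive_of_deriv(2)[OF \<phi>] h _ prim])
      (simp_all add: smooth_test_function_primitive_of_deriv(1)[OF \<phi>, symmetric])
  also have "\<phi> 1 = \<phi> 0"
    using \<phi> unfolding smooth_test_function_def periodic1_def by (metis add_0)
  finally have "(LINT t:{0..1}|lborel. \<phi> t *\<^sub>R h t + deriv \<phi> t *\<^sub>R f t) = 0"
    using f(2) by simp
  then have "(LINT t:{0..1}|lborel. \<phi> t *\<^sub>R h t) + (LINT t:{0..1}|lborel. deriv \<phi> t *\<^sub>R f t) = 0"
    by (subst (asm) set_integral_add[OF test_integrable(1)[OF \<phi> h] test_integrable(2)[OF \<phi> f_int]])
  then show ?thesis by (simp add: eq_neg_iff_add_eq_0 add.commute)
qed

lemma has_weak_deriv_primitive: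
  fixes f h :: "real \<Rightarrow> 'a::euclidean_space"
  assumes f: "continuous_on UNIV f" "periodic1 f" and h: "h \<in> l2_periodic"
    and prim: "\<And>t. t \<in> {0..1} \<Longrightarrow> f t = f 0 + (LINT u:{0..t}|lborel. h u)"
  shows "has_weak_deriv f h"
  unfolding has_weak_deriv_def
proof (intro conjI allI impI)
  have f01: "f 0 = f 1" using f(2) unfolding periodic1_def by (metis add_0)
  show "f \<in> l2_periodic" by (rule continuous_periodic_l2[OF f])
  show "(LINT t:{0..1}|lborel. deriv \<phi> t *\<^sub>R f t) = - (LINT t:{0..1}|lborel. \<phi> t *\<^sub>R h t)"
    if "smooth_test_function \<phi>" for \<phi>
    by (rule integral_by_parts_primitive[OF that l2_integrable[OF h] continuous_on_subset[OF f(1)] f01 prim]) auto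
qed (rule h)

lemma has_weak_deriv_l2: "has_weak_deriv f g \<Longrightarrow> f \<in> l2_periodic" "has_weak_deriv f g \<Longrightarrow> g \<in> l2_periodic"
  by (simp_all add: has_weak_deriv_def)

lemma has_weak_derivD:
  "has_weak_deriv f g \<Longrightarrow> smooth_test_function \<phi> \<Longrightarrow>
    (LINT t:{0..1}|lborel. deriv \<phi> t *\<^sub>R f t) = - (LINT t:{0..1}|lborel. \<phi> t *\<^sub>R g t)"
  by (simp add: has_weak_deriv_def)

lemma has_weak_deriv_add:
  assumes "has_weak_deriv f g" "has_weak_deriv f' g'"
  shows "has_weak_deriv (\<lambda>t. f t + f' t) (\<lambda>t. g t + g' t)"
  unfolding has_weak_deriv_def
proof (intro conjI allI impI)
  fix \<phi> assume \<phi>: "smooth_test_function \<phi>"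
  have int: "set_integrable lborel {0..1} (\<lambda>t. deriv \<phi> t *\<^sub>R f t)" "set_integrable lborel {0..1} (\<lambda>t. deriv \<phi> t *\<^sub>R f' t)"
    "set_integrable lborel {0..1} (\<lambda>t. \<phi> t *\<^sub>R g t)" "set_integrable lborel {0..1} (\<lambda>t. \<phi> t *\<^sub>R g' t)"
    by (intro test_integrable[OF \<phi>] l2_integrable assms[THEN has_weak_deriv_l2(1)] assms[THEN has_weak_deriv_l2(2)])+
  show "(LINT t:{0..1}|lborel. deriv \<phi> t *\<^sub>R (f t + f' t)) = - (LINT t:{0..1}|lborel. \<phi> t *\<^sub>R (g t + g' t))"
    using assms[THEN has_weak_derivD, OF \<phi>]
    unfolding scaleR_add_right set_integral_add(2)[OF int(1,2)] set_integral_add(2)[OF int(3,4)] by simp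
qed (use assms has_weak_deriv_l2 l2_periodic_add in blast)+

lemma has_weak_deriv_scaleR:
  assumes "has_weak_deriv f g"
  shows "has_weak_deriv (\<lambda>t. c *\<^sub>R f t) (\<lambda>t. c *\<^sub>R g t)"
  unfolding has_weak_deriv_def
proof (intro conjI allI impI)
  fix \<phi> assume \<phi>: "smooth_test_function \<phi>"
  show "(LINT t:{0..1}|lborel. deriv \<phi> t *\<^sub>R c *\<^sub>R f t) = - (LINT t:{0..1}|lborel. \<phi> t *\<^sub>R c *\<^sub>R g t)"
    using assms[THEN has_weak_derivD, OF \<phi>] unfolding scaleR_left_commute[of _ c] by (simp del: scaleR_scaleR)
qed (use assms has_weak_deriv_l2 l2_periodic_scaleR in blast)+

lemma has_weak_deriv_diff:
  "has_weak_deriv f g \<Longrightarrow> has_weak_deriv f' g' \<Longrightarrow> has_weak_deriv (\<lambda>t. f t - f' t) (\<lambda>t. g t - g' t)"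
  using has_weak_deriv_add[of f g "\<lambda>t. (-1) *\<^sub>R f' t" "\<lambda>t. (-1) *\<^sub>R g' t"] has_weak_deriv_scaleR[of f' g' "-1"]
  by simp

lemma has_weak_deriv_cong_AE:
  assumes wd: "has_weak_deriv f g" and l2: "f' \<in> l2_periodic" "g' \<in> l2_periodic"
    and ae: "AE t in lborel. t \<in> {0..1} \<longrightarrow> f t = f' t" "AE t in lborel. t \<in> {0..1} \<longrightarrow> g t = g' t"
  shows "has_weak_deriv f' g'"
  unfolding has_weak_deriv_def
proof (intro conjI allI impI l2)
  fix \<phi> assume \<phi>: "smooth_test_function \<phi>"
  have [measurable]: "f \<in> borel_measurable borel" "g \<in> borel_measurable borel"
      "f' \<in> borel_measurable borel" "g' \<in> borel_measurable borel"
    using wd[THEN has_weak_deriv_l2(1)] wd[THEN has_weak_deriv_l2(2)] l2 by (auto simp: l2_periodic_def)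
  have [measurable]: "\<phi> \<in> borel_measurable borel" "deriv \<phi> \<in> borel_measurable borel"
    using \<phi> smooth_test_function_deriv
    by (auto intro!: borel_measurable_continuous_onI smooth_test_function_continuous)
  have "(LINT t:{0..1}|lborel. deriv \<phi> t *\<^sub>R f' t) = (LINT t:{0..1}|lborel. deriv \<phi> t *\<^sub>R f t)"
    using ae(1) unfolding set_lebesgue_integral_def
    by (intro integral_cong_AE) (auto simp: indicator_def elim: eventually_mono)
  moreover have "(LINT t:{0..1}|lborel. \<phi> t *\<^sub>R g' t) = (LINT t:{0..1}|lborel. \<phi> t *\<^sub>R g t)"
    using ae(2) unfolding set_lebesgue_integral_def
    by (intro integral_cong_AE) (auto simp: indicator_def elim: eventually_mono)
  ultimately show "(LINT t:{0..1}|lborel. deriv \<phi> t *\<^sub>R f' t) = - (LINT t:{0..1}|lborel. \<phi> t *\<^sub>R g' t)"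
    using has_weak_derivD[OF wd \<phi>] by simp
qed

lemma weak_deriv_integral_zero:
  assumes "has_weak_deriv f g"
  shows "(LINT t:{0..1}|lborel. g t) = 0"
proof -
  have "smooth_test_function (\<lambda>_. 1)" by (intro smooth_test_function_trig_poly trig_poly.const)
  from has_weak_derivD[OF assms this] show ?thesis by simp
qed

lemma continuous_primitive:
  fixes g :: "real \<Rightarrow> 'a::euclidean_space"
  assumes "set_integrable lborel {0..1} g"
  shows "continuous_on {0..1} (\<lambda>t. LINT u:{0..t}|lborel. g u)"
proof -
  have c: "continuous_on {0..1} (\<lambda>t. integral {0..t} g)"
    using set_borel_integral_eq_integral(1)[OF assms] by (rule indefinite_integral_continuous_1)
  have eq: "(LINT u:{0..t}|lborel. g u) = integral {0..t} g" if "t \<in> {0..1}" for t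
    using that by (intro set_borel_integral_eq_integral set_integrable_subset[OF assms]) auto
  show ?thesis by (rule continuous_on_eq[OF c]) (simp add: eq)
qed

lemma set_integral_singleton_0 [simp]:
  fixes g :: "real \<Rightarrow> 'a::euclidean_space"
  shows "(LINT u:{0::real}|lborel. g u) = 0"
proof -
  have "AE u in lborel. indicat_real {0::real} u *\<^sub>R g u = 0"
    using AE_lborel_singleton[of "0::real"] by eventually_elim (auto simp: indicator_def)
  then show ?thesis unfolding set_lebesgue_integral_def by (rule integral_eq_zero_AE)
qed

text \<open>The indefinite integral \<open>F\<close> of \<open>g\<close> has the weak derivative \<open>g\<close>, too, so \<open>f - F\<close> has the weak derivative zero.\<close>

lemma primitive_of_weak_deriv:
  fixes f g :: "real \<Rightarrow> 'a::euclidean_space"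
  assumes f: "continuous_on UNIV f" and wd: "has_weak_deriv f g" and t: "t \<in> {0..1}"
  shows "f t = f 0 + (LINT u:{0..t}|lborel. g u)"
proof -
  define F where "F t = (LINT u:{0..t}|lborel. g u)" for t
  have g: "set_integrable lborel {0..1} g" using wd by (intro l2_integrable has_weak_deriv_l2(2))
  have F_cont: "continuous_on {0..1} F" unfolding F_def[abs_def] by (rule continuous_primitive[OF g])
  have F01: "F 0 = 0" "F 1 = 0" using weak_deriv_integral_zero[OF wd] by (simp_all add: F_def)
  have "periodic1 f" using has_weak_deriv_l2(1)[OF wd] by (simp add: l2_periodic_def)
  then have f01: "f 0 = f 1" unfolding periodic1_def by (metis add_0)
  have fc: "continuous_on {0..1} f" using f continuous_on_subset by blast
  have int: "set_integrable lborel {0..1} h" if "continuous_on {0..1} h" for h :: "real \<Rightarrow> 'a"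
    unfolding set_integrable_def using that by (intro borel_integrable_compact) auto
  have "(f t - F t) \<bullet> b = (f 0 - F 0) \<bullet> b" if "b \<in> Basis" for b
  proof (rule continuous_zero_weak_deriv_imp_constant[OF _ _ _ t])
    show "integral {0..1} (\<lambda>t. deriv \<phi> t * ((f t - F t) \<bullet> b)) = 0" if \<phi>: "smooth_test_function \<phi>" for \<phi>
    proof -
      have d: "continuous_on {0..1} (deriv \<phi>)"
        using \<phi> smooth_test_function_continuous smooth_test_function_deriv by blast
      have "(LINT t:{0..1}|lborel. deriv \<phi> t *\<^sub>R (f t - F t)) =
          (LINT t:{0..1}|lborel. deriv \<phi> t *\<^sub>R f t) - (LINT t:{0..1}|lborel. deriv \<phi> t *\<^sub>R F t)"
        using test_integrable(2)[OF \<phi> int[OF fc]] test_integrable(2)[OF \<phi> int[OF F_cont]]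
        by (simp add: scaleR_diff_right)
      also have "\<dots> = 0"
        using has_weak_derivD[OF wd \<phi>] integral_by_parts_primitive[OF \<phi> g F_cont] F01 by (simp add: F_def)
      finally have "integral {0..1} (\<lambda>t. deriv \<phi> t *\<^sub>R (f t - F t)) = 0"
        using set_borel_integral_eq_integral(2)[OF int, of "\<lambda>t. deriv \<phi> t *\<^sub>R (f t - F t)"] d fc F_cont
        by (simp add: continuous_intros)
      moreover have "integral {0..1} ((\<lambda>x. x \<bullet> b) \<circ> (\<lambda>t. deriv \<phi> t *\<^sub>R (f t - F t)))
          = integral {0..1} (\<lambda>t. deriv \<phi> t *\<^sub>R (f t - F t)) \<bullet> b"
        using d fc F_cont
        by (intro integral_linear bounded_linear_inner_left integrable_continuous_interval continuous_intros)
      ultimately show ?thesis by (simp add: o_def)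
    qed
  qed (use fc F_cont f01 F01 in \<open>auto intro!: continuous_intros\<close>)
  then have "f t - F t = f 0 - F 0" by (rule euclidean_eqI)
  then show ?thesis using F01 by (simp add: F_def algebra_simps)
qed

text \<open>The measures whose densities are the positive and the negative part of \<open>k\<close> agree on all half lines, so they
  are equal.  The coercion \<open>ennreal\<close> truncates negative values and thus takes the positive part.\<close>

lemma AE_zero_of_tail_integrals:
  fixes k :: "real \<Rightarrow> real"
  assumes k: "integrable lborel k" and 0: "\<And>x. (LINT t|lborel. indicator {x<..} t * k t) = 0"
  shows "AE t in lborel. k t = 0"
proof -
  have [measurable]: "k \<in> borel_measurable borel" using k by auto
  have int: "integrable lborel (\<lambda>t. indicator {x<..} t * k t)" for x
    using integrable_mult_indicator[OF _ k, of "{x<..}"] by simp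
  have ind: "ennreal (indicator {x<..} t * k t) = ennreal (k t) * indicator {x<..} t"
    "ennreal (- (indicator {x<..} t * k t)) = ennreal (- k t) * indicator {x<..} t" for x t
    by (auto simp: indicator_def)
  have fin: "(\<integral>\<^sup>+t. ennreal (k t) * indicator {x<..} t \<partial>lborel) < \<infinity>"
    "(\<integral>\<^sup>+t. ennreal (- k t) * indicator {x<..} t \<partial>lborel) < \<infinity>" for x
    using int[of x] unfolding real_integrable_def ind by (auto simp: less_top)
  have eq: "(\<integral>\<^sup>+t. ennreal (k t) * indicator {x<..} t \<partial>lborel)
      = (\<integral>\<^sup>+t. ennreal (- k t) * indicator {x<..} t \<partial>lborel)" for x
    using real_lebesgue_integral_def[OF int[of x]] 0[of x] fin[of x] unfolding ind
    by (metis eq_iff_diff_eq_0 ennreal_enn2real infinity_ennreal_def)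
  have "density lborel (\<lambda>t. ennreal (k t)) = density lborel (\<lambda>t. ennreal (- k t))"
    by (rule measure_eqI_lessThan) (auto simp: emeasure_density eq fin[unfolded infinity_ennreal_def])
  then have "AE t in lborel. ennreal (k t) = ennreal (- k t)"
    by (intro sigma_finite_measure.density_unique[OF sigma_finite_lborel]) auto
  then show ?thesis
  proof eventually_elim
    case (elim t)
    then show ?case
      by (cases "k t \<ge> 0") (auto simp: ennreal_neg ennreal_eq_0_iff not_le dest: sym)
  qed
qed

lemma AE_zero_of_zero_primitive:
  fixes h :: "real \<Rightarrow> 'a::euclidean_space"
  assumes h: "set_integrable lborel {0..1} h"
    and 0: "\<And>t. t \<in> {0..1} \<Longrightarrow> (LINT u:{0..t}|lborel. h u) = 0"
  shows "AE t in lborel. t \<in> {0..1} \<longrightarrow> h t = 0"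
proof -
  define h' where "h' t = indicator {0..1} t *\<^sub>R h t" for t :: real
  have h': "integrable lborel h'" using h by (simp add: h'_def[abs_def] set_integrable_def)
  have tail: "(LINT t|lborel. indicator {x<..} t *\<^sub>R h' t) = 0" for x
  proof -
    have all: "(LINT t|lborel. h' t) = 0" using 0[of 1] by (simp add: h'_def set_lebesgue_integral_def)
    have "(LINT t|lborel. indicator {..x} t *\<^sub>R h' t) = 0"
    proof -
      have "(LINT t|lborel. indicator {..x} t *\<^sub>R h' t) = (LINT u:{0..min x 1}|lborel. h u)"
        unfolding set_lebesgue_integral_def h'_def
        by (intro Bochner_Integration.integral_cong refl) (auto simp: indicator_def)
      also have "\<dots> = 0"
        using 0[of "min x 1"] by (cases "x \<ge> 0") (auto simp: set_lebesgue_integral_def)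
      finally show ?thesis .
    qed
    moreover have "(LINT t|lborel. h' t) =
        (LINT t|lborel. indicator {..x} t *\<^sub>R h' t) + (LINT t|lborel. indicator {x<..} t *\<^sub>R h' t)"
    proof -
      have "(LINT t|lborel. h' t) = (LINT t|lborel. indicator {..x} t *\<^sub>R h' t + indicator {x<..} t *\<^sub>R h' t)"
        by (intro Bochner_Integration.integral_cong refl) (auto simp: indicator_def)
      then show ?thesis
        using h' by (simp add: integrable_mult_indicator)
    qed
    ultimately show ?thesis using all by simp
  qed
  have "AE t in lborel. h' t \<bullet> b = 0" for b
  proof (rule AE_zero_of_tail_integrals)
    show "integrable lborel (\<lambda>t. h' t \<bullet> b)" using h' by simp
    have "(LINT t|lborel. indicator {x<..} t * (h' t \<bullet> b)) = (LINT t|lborel. (indicator {x<..} t *\<^sub>R h' t) \<bullet> b)" for x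
      by simp
    also have "\<dots> x = (LINT t|lborel. indicator {x<..} t *\<^sub>R h' t) \<bullet> b" for x
      using h' by (intro integral_inner_left integrable_mult_indicator) auto
    finally show "(LINT t|lborel. indicator {x<..} t * (h' t \<bullet> b)) = 0" for x
      using tail by simp
  qed
  then have "AE t in lborel. \<forall>b\<in>Basis. h' t \<bullet> b = 0" by (intro AE_finite_allI) auto
  then show ?thesis
  proof eventually_elim
    case (elim t)
    have "h' t = 0" by (rule euclidean_eqI) (use elim in simp)
    then show ?case by (auto simp: h'_def indicator_def split: if_splits)
  qed
qed

text \<open>The difference is a weak derivative of the continuous function zero.\<close>

lemma weak_deriv_unique:
  fixes f g :: "real \<Rightarrow> 'a::euclidean_space"
  assumes "has_weak_deriv f g" "has_weak_deriv f h"
  shows "AE t in lborel. t \<in> {0..1} \<longrightarrow> g t = h t"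
proof -
  have "has_weak_deriv (\<lambda>t. 0) (\<lambda>t. g t - h t)"
    using has_weak_deriv_diff[OF assms] by simp
  note 0 = this
  have "AE t in lborel. t \<in> {0..1} \<longrightarrow> g t - h t = 0"
    using primitive_of_weak_deriv[OF _ 0] has_weak_deriv_l2(2)[OF 0]
    by (intro AE_zero_of_zero_primitive l2_integrable) auto
  then show ?thesis by simp
qed

text \<open>On each closed unit interval \<open>F (frac t)\<close> is a translate of \<open>F\<close>; the two one-sided descriptions at an integer
agree because \<open>F 0 = F 1\<close>.\<close>

lemma periodic_extension_continuous:
  fixes F :: "real \<Rightarrow> 'a::real_normed_vector"
  assumes F: "continuous_on {0..1} F" "F 0 = F 1"
  shows "continuous_on UNIV (\<lambda>t. F (frac t))" "periodic1 (\<lambda>t. F (frac t))"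
proof -
  have seg: "continuous_on {of_int n..of_int n + 1} (\<lambda>t. F (frac t))" for n :: int
  proof -
    have c: "continuous_on {of_int n..of_int n + 1} (\<lambda>t. F (t - of_int n))"
      by (rule continuous_on_compose2[OF F(1)]) (auto intro!: continuous_intros)
    have eq: "F (frac t) = F (t - of_int n)" if "t \<in> {of_int n..of_int n + 1}" for t
    proof (cases "t = of_int n + 1")
      case False
      then have "floor t = n" using that by (intro floor_unique) auto
      then show ?thesis by (simp add: frac_def)
    next
      case True
      then have "frac t = 0" by (simp add: frac_def)
      then show ?thesis using True F(2) by simp
    qed
    show ?thesis by (rule continuous_on_eq[OF c]) (simp add: eq)
  qed
  have "isCont (\<lambda>t. F (frac t)) t" for t
  proof -
    let ?n = "floor t"
    have "continuous_on ({of_int (?n - 1)..of_int (?n - 1) + 1} \<union> {of_int ?n..of_int ?n + 1}) (\<lambda>t. F (frac t))"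
      by (intro continuous_on_closed_Un seg) auto
    then have "continuous_on {of_int ?n - 1<..<of_int ?n + 1} (\<lambda>t. F (frac t))"
      by (rule continuous_on_subset) auto
    moreover have "t \<in> {of_int ?n - 1<..<of_int ?n + 1}" by (simp add: less_le_trans[OF _ of_int_floor_le])
    ultimately show ?thesis by (simp add: continuous_on_eq_continuous_at)
  qed
  then show "continuous_on UNIV (\<lambda>t. F (frac t))" by (simp add: continuous_at_imp_continuous_on)
  show "periodic1 (\<lambda>t. F (frac t))" by (simp add: periodic1_def frac_1_eq)
qed

text \<open>Up to a constant the representative is the indefinite integral \<open>w\<close> of \<open>h\<close>.  As \<open>d = u - w\<close> need not be continuous, it
is seen to be constant almost everywhere by another route: \<open>d\<close> minus its mean integrates to zero against every
test function and is thus a weak derivative of the function zero.\<close>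

lemma weak_deriv_continuous_representative:
  fixes u h :: "real \<Rightarrow> 'a::euclidean_space"
  assumes wd: "has_weak_deriv u h"
  shows "\<exists>v. continuous_on UNIV v \<and> periodic1 v \<and> has_weak_deriv v h \<and>
    (AE t in lborel. t \<in> {0..1} \<longrightarrow> u t = v t)"
proof -
  define F where "F t = (LINT u:{0..t}|lborel. h u)" for t
  have h: "set_integrable lborel {0..1} h" using wd by (intro l2_integrable has_weak_deriv_l2(2))
  have F_cont: "continuous_on {0..1} F" unfolding F_def[abs_def] by (rule continuous_primitive[OF h])
  have F01: "F 0 = 0" "F 1 = 0" using weak_deriv_integral_zero[OF wd] by (simp_all add: F_def)
  define w where "w t = F (frac t)" for t
  have w: "continuous_on UNIV w" "periodic1 w"
    unfolding w_def[abs_def] using F_cont F01 by (auto intro: periodic_extension_continuous)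
  have wF: "w t = F t" if "t \<in> {0..1}" for t
    using that F01 by (cases "t = 1") (auto simp: w_def frac_eq[THEN iffD2])
  have w_wd: "has_weak_deriv w h"
    using w wF F01 has_weak_deriv_l2(2)[OF wd] by (intro has_weak_deriv_primitive) (auto simp: F_def)
  define d where "d t = u t - w t" for t
  have d_wd: "has_weak_deriv d (\<lambda>_. 0)"
    unfolding d_def[abs_def] using has_weak_deriv_diff[OF wd w_wd] by simp
  define m where "m = (LINT t:{0..1}|lborel. d t)"
  have const: "(\<lambda>_. m) \<in> l2_periodic" by (intro continuous_periodic_l2) (auto simp: periodic1_def)
  have dm: "(\<lambda>t. d t - m) \<in> l2_periodic"
    by (intro l2_periodic_diff const has_weak_deriv_l2(1)[OF d_wd])
  have "has_weak_deriv (\<lambda>_. 0) (\<lambda>t. d t - m)"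
    unfolding has_weak_deriv_def
  proof (intro conjI allI impI dm)
    show "(\<lambda>_. 0 :: 'a) \<in> l2_periodic" by (intro continuous_periodic_l2) (auto simp: periodic1_def)
    fix \<psi> assume \<psi>: "smooth_test_function \<psi>"
    define c where "c = integral {0..1} \<psi>"
    have "integral {0..1} (\<lambda>t. \<psi> t - c) = 0"
      using smooth_test_function_continuous[OF \<psi>]
      by (subst integral_diff) (auto simp: c_def intro: integrable_continuous_interval)
    then obtain \<phi> where \<phi>: "smooth_test_function \<phi>" "deriv \<phi> = (\<lambda>t. \<psi> t - c)"
      using smooth_test_function_primitive[OF smooth_test_function_diff_const[OF \<psi>]] by blast
    have int: "set_integrable lborel {0..1} d" "set_integrable lborel {0..1} (\<lambda>_::real. m)"
      "set_integrable lborel {0..1} (\<lambda>t. d t - m)"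
      by (intro l2_integrable const dm has_weak_deriv_l2(1)[OF d_wd])+
    have "(LINT t:{0..1}|lborel. deriv \<phi> t *\<^sub>R d t) = 0"
      using has_weak_derivD[OF d_wd \<phi>(1)] by simp
    then have 1: "(LINT t:{0..1}|lborel. \<psi> t *\<^sub>R d t) = c *\<^sub>R m"
      using test_integrable(1)[OF \<psi> int(1)] int(1) unfolding \<phi>(2) scaleR_diff_left
      by (simp add: m_def)
    have "(LINT t:{0..1}|lborel. \<psi> t *\<^sub>R m) = c *\<^sub>R m"
    proof -
      have i: "set_integrable lborel {0..1} \<psi>"
        unfolding set_integrable_def using smooth_test_function_continuous[OF \<psi>] by (intro borel_integrable_compact) auto
      then have "(LINT t:{0..1}|lborel. \<psi> t *\<^sub>R m) = (LINT t:{0..1}|lborel. \<psi> t) *\<^sub>R m"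
        unfolding set_lebesgue_integral_def set_integrable_def
        by (subst Bochner_Integration.integral_scaleR_left[symmetric]) auto
      then show ?thesis using set_borel_integral_eq_integral(2)[OF i] by (simp add: c_def)
    qed
    then have "(LINT t:{0..1}|lborel. \<psi> t *\<^sub>R (d t - m)) = 0"
      using 1 test_integrable(1)[OF \<psi> int(1)] test_integrable(1)[OF \<psi> int(2)] by (simp add: scaleR_diff_right)
    then show "(LINT t:{0..1}|lborel. deriv \<psi> t *\<^sub>R 0) = - (LINT t:{0..1}|lborel. \<psi> t *\<^sub>R (d t - m))"
      by (simp add: set_lebesgue_integral_def)
  qed
  note 0 = this
  have ae: "AE t in lborel. t \<in> {0..1} \<longrightarrow> d t - m = 0"
    using primitive_of_weak_deriv[OF _ 0] has_weak_deriv_l2(2)[OF 0]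
    by (intro AE_zero_of_zero_primitive l2_integrable) auto
  have "has_weak_deriv (\<lambda>t. w t + m) h"
    using w wF F01 has_weak_deriv_l2(2)[OF wd]
    by (intro has_weak_deriv_primitive) (auto simp: F_def periodic1_def intro!: continuous_intros)
  moreover have "AE t in lborel. t \<in> {0..1} \<longrightarrow> u t = w t + m"
    using ae by eventually_elim (auto simp: d_def algebra_simps)
  ultimately show ?thesis
    using w by (intro exI[of _ "\<lambda>t. w t + m"]) (auto simp: periodic1_def intro!: continuous_intros)
qed

section \<open>Sobolev embedding\<close>

text \<open>Instead of the Cauchy-Schwarz inequality, \<open>x \<le> \<Gamma> / 2 + x\<^sup>2 / (2 * \<Gamma>)\<close> is integrated over the unit interval.\<close>

lemma l1_le_of_l2_sq:
  fixes g :: "real \<Rightarrow> 'a::euclidean_space"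
  assumes [measurable]: "g \<in> borel_measurable borel" and \<Gamma>: "\<Gamma> > 0" and l2: "l2_sq g \<le> ennreal (\<Gamma>\<^sup>2)"
  shows "(\<integral>\<^sup>+t. ennreal (norm (g t)) * indicator {0..1} t \<partial>lborel) \<le> ennreal \<Gamma>"
proof -
  have le: "ennreal (norm x) \<le> ennreal (\<Gamma> / 2) + ennreal (1 / (2 * \<Gamma>)) * ennreal ((norm x)\<^sup>2)" for x :: 'a
  proof -
    have "norm x * (2 * \<Gamma>) \<le> \<Gamma>\<^sup>2 + (norm x)\<^sup>2"
      using sum_squares_bound[of "norm x" \<Gamma>] by (simp add: algebra_simps)
    then have "norm x \<le> \<Gamma> / 2 + 1 / (2 * \<Gamma>) * (norm x)\<^sup>2"
      using \<Gamma> by (simp add: field_simps power2_eq_square)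
    then show ?thesis using \<Gamma> by (simp add: ennreal_leI flip: ennreal_mult ennreal_plus)
  qed
  have "(\<integral>\<^sup>+t. ennreal (norm (g t)) * indicator {0..1} t \<partial>lborel)
      \<le> (\<integral>\<^sup>+t. ennreal (\<Gamma> / 2) * indicator {0..1} (t::real)
          + ennreal (1 / (2 * \<Gamma>)) * (ennreal ((norm (g t))\<^sup>2) * indicator {0..1} t) \<partial>lborel)"
    using le by (intro nn_integral_mono) (auto simp: indicator_def)
  also have "\<dots> = ennreal (\<Gamma> / 2) + ennreal (1 / (2 * \<Gamma>)) * l2_sq g"
    unfolding l2_sq_def by (subst nn_integral_add) (auto simp: nn_integral_cmult nn_integral_cmult_indicator)
  also have "\<dots> \<le> ennreal (\<Gamma> / 2) + ennreal (1 / (2 * \<Gamma>)) * ennreal (\<Gamma>\<^sup>2)"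
    by (intro add_left_mono mult_left_mono l2) auto
  also have "\<dots> = ennreal \<Gamma>"
    using \<Gamma> by (simp add: power2_eq_square field_simps flip: ennreal_mult ennreal_plus)
  finally show ?thesis .
qed

lemma norm_set_integral_le:
  fixes g :: "real \<Rightarrow> 'a::euclidean_space"
  assumes "set_integrable lborel A g" "A \<subseteq> {a..b}"
  shows "ennreal (norm (LINT t:A|lborel. g t)) \<le> (\<integral>\<^sup>+t. ennreal (norm (g t)) * indicator {a..b} t \<partial>lborel)"
proof -
  have "ennreal (norm (LINT t:A|lborel. g t)) \<le> (\<integral>\<^sup>+t. ennreal (norm (indicator A t *\<^sub>R g t)) \<partial>lborel)"
    using assms(1) unfolding set_lebesgue_integral_def set_integrable_def by (rule integral_norm_bound_ennreal)
  also have "\<dots> \<le> (\<integral>\<^sup>+t. ennreal (norm (g t)) * indicator {a..b} t \<partial>lborel)"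
    using assms(2) by (intro nn_integral_mono) (auto simp: indicator_def)
  finally show ?thesis .
qed

lemma nn_integral_two_periods:
  assumes [measurable]: "f \<in> borel_measurable borel" and per: "\<And>t. f (t + 1) = f t"
  shows "(\<integral>\<^sup>+t. f t * indicator {0..2} t \<partial>lborel) \<le> 2 * (\<integral>\<^sup>+t. f t * indicator {0..1} (t::real) \<partial>lborel)"
proof -
  have "(\<integral>\<^sup>+t. f t * indicator {0..2} t \<partial>lborel)
      \<le> (\<integral>\<^sup>+t. f t * indicator {0..1} t + f t * indicator {1..2} t \<partial>lborel)"
    by (intro nn_integral_mono) (auto simp: indicator_def)
  also have "\<dots> = (\<integral>\<^sup>+t. f t * indicator {0..1} t \<partial>lborel) + (\<integral>\<^sup>+t. f t * indicator {1..2} t \<partial>lborel)"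
    by (rule nn_integral_add) measurable
  also have "(\<integral>\<^sup>+t. f t * indicator {1..2} t \<partial>lborel) = (\<integral>\<^sup>+t. f (1 + 1 * t) * indicator {1..2} (1 + 1 * t) \<partial>lborel)"
    by (subst nn_integral_real_affine[where c = 1 and t = 1]) auto
  also have "\<dots> = (\<integral>\<^sup>+t. f t * indicator {0..1} t \<partial>lborel)"
    using per by (intro nn_integral_cong) (auto simp: add.commute indicator_def)
  finally show ?thesis by (simp add: mult_2)
qed

lemma primitive_two_periods:
  fixes \<gamma> g :: "real \<Rightarrow> 'a::euclidean_space"
  assumes \<gamma>: "continuous_on UNIV \<gamma>" and wd: "has_weak_deriv \<gamma> g"
    and ab: "0 \<le> a" "a \<le> b" "b \<le> 2"
  shows "set_integrable lborel {a..b} g" and "(LINT t:{a..b}|lborel. g t) = \<gamma> b - \<gamma> a"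
proof -
  have per: "\<gamma> (t + 1) = \<gamma> t" "g (t + 1) = g t" for t
    using wd[THEN has_weak_deriv_l2(1)] wd[THEN has_weak_deriv_l2(2)] by (auto simp: l2_periodic_def periodic1_def)
  have i01: "set_integrable lborel {0..1} g" using wd by (intro l2_integrable has_weak_deriv_l2(2))
  have shift: "indicator {1..1 + c} (1 + 1 * t) *\<^sub>R g (1 + 1 * t) = indicator {0..c} t *\<^sub>R g t" for t c :: real
    using per(2)[of t] by (auto simp: indicator_def add.commute)
  have "integrable lborel (\<lambda>t. indicator {1..1 + 1} (1 + 1 * t) *\<^sub>R g (1 + 1 * t))"
    unfolding shift using i01 by (simp add: set_integrable_def)
  then have "integrable lborel (\<lambda>t. indicator {1..1 + 1::real} t *\<^sub>R g t)"
    by (rule lborel_integrable_real_affine_iff[THEN iffD1, rotated]) simp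
  then have i12: "set_integrable lborel {1..2} g" by (simp add: set_integrable_def)
  have i02: "set_integrable lborel ({0..1} \<union> {1..2}) g"
    using i01 i12 by (intro set_integrable_Un) auto
  have U: "{0..1} \<union> {1..2} = {0..2::real}" by auto
  then show int: "set_integrable lborel {a..b} g"
    using ab by (intro set_integrable_subset[OF i02]) auto
  have prim1: "integral {0..t} g = \<gamma> t - \<gamma> 0" if "t \<in> {0..1}" for t
    using primitive_of_weak_deriv[OF \<gamma> wd that] that
      set_borel_integral_eq_integral(2)[OF set_integrable_subset[OF i01, of "{0..t}"]] by simp
  have io: "g integrable_on {0..2}" using set_borel_integral_eq_integral(1)[OF i02] U by simp
  have prim2: "integral {0..t} g = \<gamma> t - \<gamma> 0" if t: "t \<in> {0..2}" for t
  proof (cases "t \<le> 1")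
    case False
    have "(LINT u:{1..1 + (t - 1)}|lborel. g u) = (LINT u:{0..t - 1}|lborel. g u)"
      unfolding set_lebesgue_integral_def
      unfolding shift[symmetric] using lborel_integral_real_affine[of 1 "\<lambda>u. indicator {1..1 + (t - 1)} u *\<^sub>R g u" 1]
      by simp
    then have "integral {1..t} g = \<gamma> (t - 1) - \<gamma> 0"
      using prim1[of "t - 1"] False t
        set_borel_integral_eq_integral(2)[OF set_integrable_subset[OF i01, of "{0..t - 1}"]]
        set_borel_integral_eq_integral(2)[OF set_integrable_subset[OF i12, of "{1..t}"]] by simp
    moreover have "\<gamma> (t - 1) = \<gamma> t" using per(1)[of "t - 1"] by simp
    moreover have "integral {0..1} g + integral {1..t} g = integral {0..t} g"
      using False t io by (intro Henstock_Kurzweil_Integration.integral_combine) (auto intro: integrable_on_subinterval)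
    moreover have "\<gamma> 1 = \<gamma> 0" using per(1)[of 0] by simp
    ultimately show ?thesis using prim1[of 1] by simp
  qed (use prim1 that in auto)
  have "integral {0..a} g + integral {a..b} g = integral {0..b} g"
    using ab io by (intro Henstock_Kurzweil_Integration.integral_combine) (auto intro: integrable_on_subinterval)
  then show "(LINT t:{a..b}|lborel. g t) = \<gamma> b - \<gamma> a"
    using prim2[of a] prim2[of b] ab set_borel_integral_eq_integral(2)[OF int] by (simp add: algebra_simps)
qed

text \<open>On two adjacent intervals of length \<open>r\<close> the means of \<open>g\<close> differ by the double mean of
  \<open>g y - g u\<close>.  As \<open>\<bar>y - u\<bar> \<le> 2 * r\<close> there, the Gagliardo integrand bounds the squared difference up to the
  factor \<open>(2 * r) powr (1 + 2 * s)\<close>, whose square root beats the length \<open>r\<close> because \<open>s > 1/2\<close>.\<close>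

lemma adjacent_means_diff_le:
  fixes \<gamma> g :: "real \<Rightarrow> 'a::euclidean_space"
  assumes \<gamma>: "continuous_on UNIV \<gamma>" and wd: "has_weak_deriv \<gamma> g"
    and gag: "gagliardo_sq s g \<le> ennreal (\<Gamma>\<^sup>2)" and \<Gamma>: "\<Gamma> > 0" and s: "1/2 < s" "s < 1"
    and r: "0 < r" "r \<le> 1/4" and t: "t \<in> {0..1}"
  shows "norm ((\<gamma> (t + 2 * r) - \<gamma> (t + r)) - (\<gamma> (t + r) - \<gamma> t)) \<le> 9 * \<Gamma> * r powr (s - 1/2) * r"
proof -
  define I where "I = {t..t + r}"
  define J where "J = {t + r..t + 2 * r}"
  have g_l2: "g \<in> l2_periodic" using has_weak_deriv_l2(2)[OF wd] .
  then have [measurable]: "g \<in> borel_measurable borel" by (simp add: l2_periodic_def)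
  have per: "g (t + 1) = g t" for t using g_l2 by (auto simp: l2_periodic_def periodic1_def)
  have I: "set_integrable lborel I g" "(LINT u:I|lborel. g u) = \<gamma> (t + r) - \<gamma> t"
    and J: "set_integrable lborel J g" "(LINT u:J|lborel. g u) = \<gamma> (t + 2 * r) - \<gamma> (t + r)"
    unfolding I_def J_def using primitive_two_periods[OF \<gamma> wd] r t by auto
  have [measurable]: "I \<in> sets borel" "J \<in> sets borel" by (auto simp: I_def J_def)
  have len: "emeasure lborel I = ennreal r" "emeasure lborel J = ennreal r" using r by (auto simp: I_def J_def)
  have meas: "measure lborel I = r" "measure lborel J = r" using r by (auto simp: I_def J_def)
  have const: "set_integrable lborel I (\<lambda>_. c)" "set_integrable lborel J (\<lambda>_. c)"
    "(LINT u:I|lborel. c) = r *\<^sub>R c" "(LINT u:J|lborel. c) = r *\<^sub>R c" for c :: 'a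
    using meas len by (auto simp: set_integrable_def set_lebesgue_integral_def)
  let ?X = "(\<gamma> (t + 2 * r) - \<gamma> (t + r)) - (\<gamma> (t + r) - \<gamma> t)"
  define p where "p = 1 + 2 * s"
  define e where "e = r powr (s - 1/2) * \<Gamma>"
  have e: "e > 0" using r \<Gamma> by (simp add: e_def)
  have inner: "r *\<^sub>R g u - (\<gamma> (t + 2 * r) - \<gamma> (t + r)) = (LINT y:J|lborel. g u - g y)" for u
    using J const by simp
  have "(LINT u:I|lborel. r *\<^sub>R g u - c) = r *\<^sub>R (\<gamma> (t + r) - \<gamma> t) - r *\<^sub>R c" for c
    using I const by simp
  then have "r *\<^sub>R ?X = - (LINT u:I|lborel. r *\<^sub>R g u - (\<gamma> (t + 2 * r) - \<gamma> (t + r)))"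
    by (simp add: scaleR_diff_right)
  then have "ennreal (norm (r *\<^sub>R ?X)) = ennreal (norm (LINT u:I|lborel. LINT y:J|lborel. g u - g y))"
    unfolding inner by simp
  also have "\<dots> \<le> (\<integral>\<^sup>+u. ennreal (norm (indicator I u *\<^sub>R (LINT y:J|lborel. g u - g y))) \<partial>lborel)"
    unfolding set_lebesgue_integral_def[of lborel I]
  proof (rule integral_norm_bound_ennreal)
    show "integrable lborel (\<lambda>u. indicat_real I u *\<^sub>R (LINT y:J|lborel. g u - g y))"
      using I const unfolding inner[symmetric] set_integrable_def[symmetric] by auto
  qed
  also have "\<dots> \<le> (\<integral>\<^sup>+u. (\<integral>\<^sup>+y. ennreal (norm (g y - g u)) * indicator J y \<partial>lborel) * indicator I u \<partial>lborel)"
  proof (intro nn_integral_mono)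
    fix u
    have "ennreal (norm (LINT y:J|lborel. g u - g y)) \<le> (\<integral>\<^sup>+y. ennreal (norm (indicator J y *\<^sub>R (g u - g y))) \<partial>lborel)"
      unfolding set_lebesgue_integral_def using J const
      by (intro integral_norm_bound_ennreal) (simp flip: set_integrable_def)
    also have "\<dots> = (\<integral>\<^sup>+y. ennreal (norm (g y - g u)) * indicator J y \<partial>lborel)"
      by (intro nn_integral_cong) (auto simp: indicator_def norm_minus_commute)
    finally show "ennreal (norm (indicator I u *\<^sub>R (LINT y:J|lborel. g u - g y)))
        \<le> (\<integral>\<^sup>+y. ennreal (norm (g y - g u)) * indicator J y \<partial>lborel) * indicator I u"
      by (auto simp: indicator_def)
  qed
  also have "\<dots> \<le> (\<integral>\<^sup>+u. (ennreal (e / 2 * r) + ennreal ((2 * r) powr p / (2 * e)) *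
      (\<integral>\<^sup>+w\<in>{-1/2..1/2}. ennreal ((norm (g (u + w) - g u))\<^sup>2 / \<bar>w\<bar> powr (1 + 2 * s)) \<partial>lborel)) * indicator I u \<partial>lborel)"
  proof (intro nn_integral_mono)
    fix u :: real
    have pt: "norm (g (u + w) - g u) \<le> e / 2 + (2 * r) powr p / (2 * e) * ((norm (g (u + w) - g u))\<^sup>2 / \<bar>w\<bar> powr p)"
      if w: "\<bar>w\<bar> \<le> 2 * r" for w
    proof (cases "w = 0")
      case False
      let ?n = "norm (g (u + w) - g u)"
      have "\<bar>w\<bar> powr p \<le> (2 * r) powr p" using w s by (intro powr_mono2) (auto simp: p_def)
      then have "1 \<le> (2 * r) powr p / \<bar>w\<bar> powr p" using False by (simp add: field_simps)
      then have "?n\<^sup>2 / (2 * e) * 1 \<le> ?n\<^sup>2 / (2 * e) * ((2 * r) powr p / \<bar>w\<bar> powr p)"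
        using e by (intro mult_left_mono) auto
      moreover have "?n \<le> e / 2 + ?n\<^sup>2 / (2 * e)"
        using sum_squares_bound[of ?n e] e by (simp add: field_simps power2_eq_square)
      moreover have "?n\<^sup>2 / (2 * e) * ((2 * r) powr p / \<bar>w\<bar> powr p)
          = (2 * r) powr p / (2 * e) * (?n\<^sup>2 / \<bar>w\<bar> powr p)" by simp
      ultimately show ?thesis by linarith
    qed (use e in simp)
    have "(\<integral>\<^sup>+y. ennreal (norm (g y - g u)) * indicator J y \<partial>lborel)
        = (\<integral>\<^sup>+w. ennreal (norm (g (u + 1 * w) - g u)) * indicator J (u + 1 * w) \<partial>lborel)"
      by (subst nn_integral_real_affine[where c = 1 and t = u]) auto
    also have "\<dots> \<le> (\<integral>\<^sup>+w. ennreal (e / 2) * indicator J (u + w) + ennreal ((2 * r) powr p / (2 * e)) *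
        (ennreal ((norm (g (u + w) - g u))\<^sup>2 / \<bar>w\<bar> powr p) * indicator {-1/2..1/2} w) \<partial>lborel)" if u: "u \<in> I"
    proof (intro nn_integral_mono)
      fix w
      show "ennreal (norm (g (u + 1 * w) - g u)) * indicator J (u + 1 * w)
        \<le> ennreal (e / 2) * indicator J (u + w) + ennreal ((2 * r) powr p / (2 * e)) *
        (ennreal ((norm (g (u + w) - g u))\<^sup>2 / \<bar>w\<bar> powr p) * indicator {-1/2..1/2} w)"
      proof (cases "u + w \<in> J")
        case True
        then have w: "\<bar>w\<bar> \<le> 2 * r" "w \<in> {-1/2..1/2}" using u r by (auto simp: I_def J_def)
        show ?thesis using pt[OF w(1)] w(2) True e
          by (simp add: ennreal_leI flip: ennreal_mult ennreal_plus)
      qed simp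
    qed
    also have "\<dots> = ennreal (e / 2) * (\<integral>\<^sup>+w. indicator J (u + w) \<partial>lborel) + ennreal ((2 * r) powr p / (2 * e)) *
        (\<integral>\<^sup>+w\<in>{-1/2..1/2}. ennreal ((norm (g (u + w) - g u))\<^sup>2 / \<bar>w\<bar> powr p) \<partial>lborel)"
      by (subst nn_integral_add) (auto simp: nn_integral_cmult)
    also have "(\<integral>\<^sup>+w. indicator J (u + w) \<partial>lborel) = (\<integral>\<^sup>+w. indicator J (u + 1 * w) \<partial>lborel)" by simp
    also have "\<dots> = ennreal r"
      using nn_integral_real_affine[where c = 1 and t = u and f = "indicator J"] len by simp
    also have "ennreal (e / 2) * ennreal r = ennreal (e / 2 * r)" using e r by (simp flip: ennreal_mult)
    finally show "(\<integral>\<^sup>+y. ennreal (norm (g y - g u)) * indicator J y \<partial>lborel) * indicator I u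
       \<le> (ennreal (e / 2 * r) + ennreal ((2 * r) powr p / (2 * e)) *
      (\<integral>\<^sup>+w\<in>{-1/2..1/2}. ennreal ((norm (g (u + w) - g u))\<^sup>2 / \<bar>w\<bar> powr (1 + 2 * s)) \<partial>lborel)) * indicator I u"
      by (cases "u \<in> I") (simp_all add: p_def)
  qed
  also have "\<dots> = (\<integral>\<^sup>+u. ennreal (e / 2 * r) * indicator I u + ennreal ((2 * r) powr p / (2 * e)) *
      ((\<integral>\<^sup>+w\<in>{-1/2..1/2}. ennreal ((norm (g (u + w) - g u))\<^sup>2 / \<bar>w\<bar> powr (1 + 2 * s)) \<partial>lborel) * indicator I u) \<partial>lborel)"
    by (intro nn_integral_cong) (simp add: distrib_right mult.assoc)
  also have "\<dots> = ennreal (e / 2 * r) * ennreal r + ennreal ((2 * r) powr p / (2 * e)) *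
      (\<integral>\<^sup>+u. (\<integral>\<^sup>+w\<in>{-1/2..1/2}. ennreal ((norm (g (u + w) - g u))\<^sup>2 / \<bar>w\<bar> powr (1 + 2 * s)) \<partial>lborel) * indicator I u \<partial>lborel)"
    using len by (subst nn_integral_add) (auto simp: nn_integral_cmult nn_integral_cmult_indicator)
  also have "\<dots> \<le> ennreal (e / 2 * r) * ennreal r + ennreal ((2 * r) powr p / (2 * e)) * (2 * ennreal (\<Gamma>\<^sup>2))"
  proof (intro add_left_mono mult_left_mono)
    let ?f = "\<lambda>u. \<integral>\<^sup>+w\<in>{-1/2..1/2}. ennreal ((norm (g (u + w) - g u))\<^sup>2 / \<bar>w\<bar> powr (1 + 2 * s)) \<partial>lborel"
    have "(\<integral>\<^sup>+u. ?f u * indicator I u \<partial>lborel) \<le> (\<integral>\<^sup>+u. ?f u * indicator {0..2} u \<partial>lborel)"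
      using t r by (intro nn_integral_mono) (auto simp: indicator_def I_def)
    also have "\<dots> \<le> 2 * (\<integral>\<^sup>+u. ?f u * indicator {0..1} u \<partial>lborel)"
    proof (rule nn_integral_two_periods)
      show "?f (u + 1) = ?f u" for u
      proof -
        have "g (u + 1 + w) = g (u + w)" for w using per[of "u + w"] by (simp add: ac_simps)
        then show ?thesis using per[of u] by simp
      qed
    qed measurable
    also have "(\<integral>\<^sup>+u. ?f u * indicator {0..1} u \<partial>lborel) \<le> ennreal (\<Gamma>\<^sup>2)"
      using gag unfolding gagliardo_sq_def .
    finally show "(\<integral>\<^sup>+u. ?f u * indicator I u \<partial>lborel) \<le> 2 * ennreal (\<Gamma>\<^sup>2)"
      by (simp add: mult_left_mono)
  qed auto
  also have "\<dots> = ennreal (e / 2 * r * r + (2 * r) powr p / (2 * e) * (2 * \<Gamma>\<^sup>2))"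
  proof -
    have "2 * ennreal (\<Gamma>\<^sup>2) = ennreal (2 * \<Gamma>\<^sup>2)" by (simp add: ennreal_mult')
    then show ?thesis using e r by (simp only: flip: ennreal_mult ennreal_plus) (simp flip: ennreal_mult ennreal_plus)
  qed
  finally have "norm (r *\<^sub>R ?X) \<le> e / 2 * r * r + (2 * r) powr p / (2 * e) * (2 * \<Gamma>\<^sup>2)"
    using e r by (subst (asm) ennreal_le_iff) auto
  also have "(2 * r) powr p / (2 * e) * (2 * \<Gamma>\<^sup>2) \<le> 8 * e * r * r"
  proof -
    have "(2 * r) powr p = 2 powr p * r powr p" using r by (simp add: powr_mult)
    also have "2 powr p \<le> 2 powr 3" using s by (intro powr_mono) (auto simp: p_def)
    also have "r powr p = r powr (s - 1/2) * r powr (s - 1/2) * (r * r)"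
    proof -
      have "p = (s - 1/2) + (s - 1/2) + (1 + 1)" by (simp add: p_def)
      then have "r powr p = r powr (s - 1/2) * r powr (s - 1/2) * (r powr 1 * r powr 1)"
        by (simp only: powr_add)
      then show ?thesis using r by simp
    qed
    finally have "(2 * r) powr p \<le> 8 * (r powr (s - 1/2) * r powr (s - 1/2) * (r * r))"
      by (simp add: mult_right_mono)
    then have "(2 * r) powr p * \<Gamma>\<^sup>2 \<le> 8 * (r powr (s - 1/2) * r powr (s - 1/2) * (r * r)) * \<Gamma>\<^sup>2"
      by (rule mult_right_mono) simp
    then have "(2 * r) powr p * \<Gamma>\<^sup>2 \<le> 8 * e * r * r * e"
      by (simp add: e_def power2_eq_square mult_ac)
    then show ?thesis using e by (simp add: field_simps)
  qed
  finally have "r * norm ?X \<le> e / 2 * r * r + 8 * e * r * r" using r by simp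
  moreover have "e / 2 * r * r \<le> e * r * r" using r e by simp
  moreover have "r * (9 * e * r) = e * r * r + 8 * e * r * r" by (simp add: algebra_simps)
  ultimately have "r * norm ?X \<le> r * (9 * e * r)" by linarith
  then have "norm ?X \<le> 9 * e * r" using r by (simp only: mult_le_cancel_left_pos)
  then show ?thesis by (simp add: e_def mult_ac)
qed


text \<open>A classical primitive \<open>A\<close> of \<open>v\<close> agrees with \<open>\<gamma>\<close> on the unit interval up to a constant, and it is periodic.\<close>

lemma C1_of_continuous_weak_deriv:
  fixes \<gamma> v :: "real \<Rightarrow> 'a::euclidean_space"
  assumes \<gamma>: "continuous_on UNIV \<gamma>" and v: "continuous_on UNIV v" and wd: "has_weak_deriv \<gamma> v"
  shows "(\<gamma> has_vector_derivative v t) (at t)"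
proof -
  have per: "periodic1 \<gamma>" "periodic1 v"
    using wd[THEN has_weak_deriv_l2(1)] wd[THEN has_weak_deriv_l2(2)] by (auto simp: l2_periodic_def)
  have "isCont v t" for t using v by (simp add: continuous_on_eq_continuous_at)
  then obtain A where A: "\<And>t. (A has_vector_derivative v t) (at t)"
    using einterval_antiderivative[of "-\<infinity>" \<infinity> v] by auto
  have A01: "A t - A 0 = \<gamma> t - \<gamma> 0" if t: "t \<in> {0..1}" for t
  proof -
    have "(v has_integral (A t - A 0)) {0..t}"
      using t by (intro fundamental_theorem_of_calculus) (auto intro: has_vector_derivative_at_within A)
    moreover have "set_integrable lborel {0..t} v"
      using t l2_integrable[OF has_weak_deriv_l2(2)[OF wd]] by (elim set_integrable_subset) auto
    ultimately have "(LINT u:{0..t}|lborel. v u) = A t - A 0"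
      by (simp add: set_borel_integral_eq_integral integral_unique)
    then show ?thesis using primitive_of_weak_deriv[OF \<gamma> wd t] by simp
  qed
  have "((\<lambda>t. A (t + 1) - A t) has_vector_derivative v t - v t) (at t within UNIV)" for t
  proof (intro has_vector_derivative_diff A)
    have "((A \<circ> (\<lambda>t. t + 1)) has_vector_derivative (1 *\<^sub>R v (t + 1))) (at t)"
      by (rule vector_diff_chain_at) (auto intro!: A derivative_eq_intros)
    then show "((\<lambda>t. A (t + 1)) has_vector_derivative v t) (at t)"
      using per(2) by (simp add: o_def periodic1_def)
  qed
  then obtain c where "\<And>t. A (t + 1) - A t = c"
    using has_vector_derivative_zero_constant[OF convex_UNIV, of "\<lambda>t. A (t + 1) - A t"]
    by (metis UNIV_I diff_self)
  moreover have "A (0 + 1) - A 0 = 0"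
    using A01[of 1] per(1) unfolding periodic1_def by (metis add_0 atLeastAtMost_iff diff_self order_refl zero_le_one)
  ultimately have "A (t + 1) - A t = 0" for t by metis
  then have "periodic1 (\<lambda>t. A t - \<gamma> t)" using per(1) by (simp add: periodic1_def)
  then have "A t - \<gamma> t = A (frac t) - \<gamma> (frac t)" for t by (rule periodic1_frac[symmetric])
  also have "A (frac t) - \<gamma> (frac t) = A 0 - \<gamma> 0" for t
    using A01[OF frac_in_unit[of t]] by (simp add: algebra_simps)
  finally have "\<gamma> t = A t + (\<gamma> 0 - A 0)" for t by (simp add: algebra_simps)
  then have "\<gamma> = (\<lambda>t. A t + (\<gamma> 0 - A 0))" by (rule ext)
  moreover have "((\<lambda>t. A t + (\<gamma> 0 - A 0)) has_vector_derivative v t) (at t)"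
    using has_vector_derivative_add[OF A[of t] has_vector_derivative_const] by simp
  ultimately show ?thesis by metis
qed

lemma has_weak_deriv_C1:
  fixes \<gamma> v :: "real \<Rightarrow> 'a::euclidean_space"
  assumes per: "periodic1 \<gamma>" "periodic1 v" and v: "continuous_on UNIV v"
    and D: "\<And>t. (\<gamma> has_vector_derivative v t) (at t)"
  shows "has_weak_deriv \<gamma> v"
proof (rule has_weak_deriv_primitive)
  show "continuous_on UNIV \<gamma>"
    using D by (metis continuous_at_imp_continuous_on has_vector_derivative_continuous)
  show l2: "v \<in> l2_periodic" by (rule continuous_periodic_l2[OF v per(2)])
  fix t :: real assume t: "t \<in> {0..1}"
  have "(v has_integral (\<gamma> t - \<gamma> 0)) {0..t}"
    using t by (intro fundamental_theorem_of_calculus) (auto intro: has_vector_derivative_at_within D)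
  moreover have "set_integrable lborel {0..t} v"
    using t l2_integrable[OF l2] by (elim set_integrable_subset) auto
  ultimately show "\<gamma> t = \<gamma> 0 + (LINT u:{0..t}|lborel. v u)"
    by (simp add: set_borel_integral_eq_integral integral_unique)
qed (rule per)

text \<open>By \<open>adjacent_means_diff_le\<close> the difference quotients \<open>q k\<close> of \<open>\<gamma>\<close> with step \<open>1/2, 1/4, 1/8, \<dots>\<close>, which are means of \<open>g\<close>,
form a series that is dominated by a geometric one with ratio \<open>\<rho>\<close>.  So they converge uniformly, with a
bound by \<open>\<Gamma>\<close>.\<close>

theorem sobolev_embedding_C1:
  fixes \<gamma> g :: "real \<Rightarrow> 'a::euclidean_space"
  assumes \<gamma>: "continuous_on UNIV \<gamma>" and wd: "has_weak_deriv \<gamma> g"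
    and gag: "gagliardo_sq s g \<le> ennreal (\<Gamma>\<^sup>2)" and l2: "l2_sq g \<le> ennreal (\<Gamma>\<^sup>2)"
    and \<Gamma>: "\<Gamma> > 0" and s: "1/2 < s" "s < 1"
  defines "\<rho> \<equiv> (1/2) powr (s - 1/2)"
  shows "\<exists>v. continuous_on UNIV v \<and> (\<forall>t. (\<gamma> has_vector_derivative v t) (at t)) \<and>
    (\<forall>t. norm (v t) \<le> (4 + 9 / (1 - \<rho>)) * \<Gamma>)"
proof -
  have \<rho>: "0 < \<rho>" "\<rho> < 1"
    using s powr_less_mono'[of "1/2" 0 "s - 1/2"] by (auto simp: \<rho>_def)
  define r :: "nat \<Rightarrow> real" where "r k = (1/2) ^ Suc k" for k
  have r: "0 < r k" "r k = 2 * r (Suc k)" "r (Suc k) \<le> 1/4" for k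
  proof -
    have "(1/2 :: real) ^ k \<le> 1" by (intro power_le_one) auto
    then show "r (Suc k) \<le> 1/4" by (simp add: r_def)
  qed (simp_all add: r_def)
  define q where "q k t = (1 / r k) *\<^sub>R (\<gamma> (t + r k) - \<gamma> t)" for k t
  have per: "periodic1 \<gamma>" using has_weak_deriv_l2(1)[OF wd] by (simp add: l2_periodic_def)
  have q_per: "periodic1 (q k)" for k
    using per unfolding periodic1_def q_def by (metis add.assoc add.commute)
  have q_cont: "continuous_on A (q k)" for k A
    unfolding q_def by (intro continuous_intros continuous_on_compose2[OF \<gamma>]) auto
  have step01: "norm (q (Suc k) t - q k t) \<le> 9 * \<Gamma> * \<rho> ^ k" if t: "t \<in> {0..1}" for k t
  proof -
    let ?r = "r (Suc k)"
    let ?X = "(\<gamma> (t + 2 * ?r) - \<gamma> (t + ?r)) - (\<gamma> (t + ?r) - \<gamma> t)"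
    have "q (Suc k) t - q k t = (- 1 / (2 * ?r)) *\<^sub>R ?X"
    proof -
      have 1: "q k t = (1 / (2 * ?r)) *\<^sub>R (\<gamma> (t + 2 * ?r) - \<gamma> t)" by (simp add: q_def r(2)[of k])
      have 2: "q (Suc k) t = (1 / (2 * ?r)) *\<^sub>R (2 *\<^sub>R (\<gamma> (t + ?r) - \<gamma> t))" by (simp add: q_def)
      show ?thesis unfolding 1 2 by (simp add: scaleR_2 algebra_simps)
    qed
    then have "norm (q (Suc k) t - q k t) = norm ?X / (2 * ?r)" using r(1)[of "Suc k"] by simp
    also have "\<dots> \<le> (9 * \<Gamma> * ?r powr (s - 1/2) * ?r) / (2 * ?r)"
      using r(1)[of "Suc k"] r(3)[of k] adjacent_means_diff_le[OF \<gamma> wd gag \<Gamma> s _ _ t, of ?r]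
      by (intro divide_right_mono) auto
    also have "\<dots> = 9 / 2 * \<Gamma> * ?r powr (s - 1/2)" using r(1)[of "Suc k"] by simp
    also have "?r powr (s - 1/2) \<le> \<rho> ^ k"
    proof -
      have "?r = (1/2) powr real (k + 2)" by (subst powr_realpow) (auto simp: r_def)
      then have "?r powr (s - 1/2) = (1/2) powr (real (k + 2) * (s - 1/2))" by (simp only: powr_powr)
      also have "\<dots> = \<rho> ^ (k + 2)" unfolding \<rho>_def by (subst powr_power) auto
      also have "\<rho> ^ (k + 2) \<le> \<rho> ^ k" using \<rho> by (intro power_decreasing) auto
      finally show ?thesis .
    qed
    finally have "norm (q (Suc k) t - q k t) \<le> 9 / 2 * \<Gamma> * \<rho> ^ k" using \<Gamma> by simp
    also have "\<dots> \<le> 9 * \<Gamma> * \<rho> ^ k" using \<Gamma> \<rho> by (intro mult_right_mono) auto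
    finally show ?thesis .
  qed
  have step: "norm (q (Suc k) t - q k t) \<le> 9 * \<Gamma> * \<rho> ^ k" for k t
    using step01[OF frac_in_unit[of t], of k] by (simp add: periodic1_frac[OF q_per])
  have sums: "summable (\<lambda>k. 9 * \<Gamma> * \<rho> ^ k)" using \<rho> by (intro summable_mult summable_geometric) auto
  define v where "v t = q 0 t + (\<Sum>k. q (Suc k) t - q k t)" for t
  have unif: "uniform_limit UNIV q v sequentially"
  proof -
    have "uniform_limit UNIV (\<lambda>n t. \<Sum>k<n. q (Suc k) t - q k t) (\<lambda>t. \<Sum>k. q (Suc k) t - q k t) sequentially"
      by (rule Weierstrass_m_test[OF step sums])
    then have "uniform_limit UNIV (\<lambda>n t. q 0 t + (\<Sum>k<n. q (Suc k) t - q k t)) v sequentially"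
      unfolding v_def by (intro uniform_limit_intros)
    moreover have "q 0 t + (\<Sum>k<n. q (Suc k) t - q k t) = q n t" for n t
      by (induction n) (simp_all add: algebra_simps)
    ultimately show ?thesis by simp
  qed
  have v_cont: "continuous_on UNIV v"
    using q_cont by (intro uniform_limit_theorem[OF _ unif]) auto
  have q0: "norm (q 0 t) \<le> 4 * \<Gamma>" for t
  proof -
    have "norm (q 0 t) \<le> 4 * \<Gamma>" if t: "t \<in> {0..1}" for t
    proof -
      have [measurable]: "g \<in> borel_measurable borel" using has_weak_deriv_l2(2)[OF wd] by (simp add: l2_periodic_def)
      have gper: "g (t + 1) = g t" for t using has_weak_deriv_l2(2)[OF wd] by (auto simp: l2_periodic_def periodic1_def)
      have "ennreal (norm (\<gamma> (t + 1/2) - \<gamma> t)) = ennreal (norm (LINT u:{t..t + 1/2}|lborel. g u))"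
        using t by (subst primitive_two_periods[OF \<gamma> wd]) auto
      also have "\<dots> \<le> (\<integral>\<^sup>+t. ennreal (norm (g t)) * indicator {0..2} t \<partial>lborel)"
        using t by (intro norm_set_integral_le primitive_two_periods[OF \<gamma> wd]) auto
      also have "\<dots> \<le> 2 * (\<integral>\<^sup>+t. ennreal (norm (g t)) * indicator {0..1} t \<partial>lborel)"
        by (intro nn_integral_two_periods) (auto simp: gper)
      also have "\<dots> \<le> 2 * ennreal \<Gamma>" by (intro mult_left_mono l1_le_of_l2_sq \<Gamma> l2) auto
      also have "\<dots> = ennreal (2 * \<Gamma>)" using \<Gamma> by (simp add: ennreal_mult')
      finally have "norm (\<gamma> (t + 1/2) - \<gamma> t) \<le> 2 * \<Gamma>" using \<Gamma> by (subst (asm) ennreal_le_iff) auto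
      then show ?thesis by (simp add: q_def r_def)
    qed
    from this[OF frac_in_unit[of t]] show ?thesis by (simp add: periodic1_frac[OF q_per])
  qed
  have bound: "norm (v t) \<le> (4 + 9 / (1 - \<rho>)) * \<Gamma>" for t
  proof -
    have sn: "summable (\<lambda>k. norm (q (Suc k) t - q k t))"
      by (rule summable_comparison_test'[OF sums, of 0]) (use step in simp)
    have "norm (\<Sum>k. q (Suc k) t - q k t) \<le> (\<Sum>k. norm (q (Suc k) t - q k t))" by (rule summable_norm[OF sn])
    also have "\<dots> \<le> (\<Sum>k. 9 * \<Gamma> * \<rho> ^ k)" by (intro suminf_le step sn sums)
    also have "\<dots> = 9 * \<Gamma> * (1 / (1 - \<rho>))"
      using \<rho> suminf_geometric[of \<rho>] by (subst suminf_mult) (auto intro: summable_geometric)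
    finally show ?thesis
      unfolding v_def using q0[of t] norm_triangle_ineq[of "q 0 t" "\<Sum>k. q (Suc k) t - q k t"]
      by (simp add: algebra_simps)
  qed
  (* The averages m k of \<gamma> over {t..t + r k} have derivative q k and tend to \<gamma>. *)
  have "isCont \<gamma> t" for t using \<gamma> by (simp add: continuous_on_eq_continuous_at)
  then obtain A where A: "\<And>t. (A has_vector_derivative \<gamma> t) (at t)"
    using einterval_antiderivative[of "-\<infinity>" \<infinity> \<gamma>] by auto
  define m where "m k t = (1 / r k) *\<^sub>R (A (t + r k) - A t)" for k t
  have m_deriv: "(m k has_derivative (\<lambda>h. h *\<^sub>R q k t)) (at t within UNIV)" for k t
  proof -
    have "((A \<circ> (\<lambda>t. t + r k)) has_vector_derivative (1 *\<^sub>R \<gamma> (t + r k))) (at t)"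
      by (rule vector_diff_chain_at) (auto intro!: A derivative_eq_intros)
    then have "((\<lambda>t. A (t + r k) - A t) has_vector_derivative (\<gamma> (t + r k) - \<gamma> t)) (at t)"
      by (intro has_vector_derivative_diff A) (simp add: o_def)
    then have "(m k has_vector_derivative q k t) (at t)"
      unfolding m_def[abs_def] q_def using bounded_linear.has_vector_derivative[OF bounded_linear_scaleR_right] by blast
    then show ?thesis by (simp add: has_vector_derivative_def)
  qed
  have r_lim: "filterlim r (at 0) sequentially"
  proof -
    have "r \<longlonglongrightarrow> 0" unfolding r_def[abs_def] by (intro LIMSEQ_Suc LIMSEQ_realpow_zero) auto
    then show ?thesis using r(1) by (simp add: filterlim_at less_imp_neq[THEN not_sym])
  qed
  have m_lim: "(\<lambda>k. m k t) \<longlonglongrightarrow> \<gamma> t" for t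
  proof -
    have "((\<lambda>h. (1 / h) *\<^sub>R (A (t + h) - A t)) \<longlongrightarrow> \<gamma> t) (at 0)"
    proof -
      have "((\<lambda>h. norm (A (t + h) - A t - h *\<^sub>R \<gamma> t) / norm h) \<longlongrightarrow> 0) (at 0)"
        using A[of t] unfolding has_vector_derivative_def has_derivative_at by simp
      then have "((\<lambda>h. norm ((1 / h) *\<^sub>R (A (t + h) - A t) - \<gamma> t)) \<longlongrightarrow> 0) (at 0)"
      proof (rule Lim_transform_eventually)
        show "\<forall>\<^sub>F h in at 0. norm (A (t + h) - A t - h *\<^sub>R \<gamma> t) / norm h = norm ((1 / h) *\<^sub>R (A (t + h) - A t) - \<gamma> t)"
          unfolding eventually_at_filter
        proof (intro always_eventually allI impI)
          fix h :: real assume "h \<noteq> 0"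
          then have "(1 / h) *\<^sub>R (A (t + h) - A t) - \<gamma> t = (1 / h) *\<^sub>R (A (t + h) - A t - h *\<^sub>R \<gamma> t)"
            by (simp add: scaleR_diff_right)
          then show "norm (A (t + h) - A t - h *\<^sub>R \<gamma> t) / norm h = norm ((1 / h) *\<^sub>R (A (t + h) - A t) - \<gamma> t)"
            by simp
        qed
      qed
      then show ?thesis by (rule Lim_null[THEN iffD2, OF tendsto_norm_zero_cancel])
    qed
    then show ?thesis unfolding m_def by (rule filterlim_compose[OF _ r_lim])
  qed
  have "\<exists>G. \<forall>t\<in>UNIV. (\<lambda>k. m k t) \<longlonglongrightarrow> G t \<and> (G has_derivative (\<lambda>h. h *\<^sub>R v t)) (at t within UNIV)"
  proof (rule has_derivative_sequence[OF convex_UNIV m_deriv])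
    show "\<forall>\<^sub>F k in sequentially. \<forall>t\<in>UNIV. \<forall>h. norm (h *\<^sub>R q k t - h *\<^sub>R v t) \<le> e * norm h" if "e > 0" for e
      using uniform_limitD[OF unif that]
    proof eventually_elim
      case (elim k)
      have "norm (h *\<^sub>R q k t - h *\<^sub>R v t) \<le> e * norm h" for t h
      proof -
        have "norm (h *\<^sub>R q k t - h *\<^sub>R v t) = \<bar>h\<bar> * dist (q k t) (v t)"
          by (simp add: dist_norm flip: scaleR_diff_right)
        also have "\<dots> \<le> \<bar>h\<bar> * e" using elim by (intro mult_left_mono) (auto intro: less_imp_le)
        finally show ?thesis by (simp add: mult.commute)
      qed
      then show ?case by blast
    qed
  qed (use m_lim in auto)
  then obtain G where G: "\<And>t. (\<lambda>k. m k t) \<longlonglongrightarrow> G t" "\<And>t. (G has_derivative (\<lambda>h. h *\<^sub>R v t)) (at t)"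
    by auto
  have "G = \<gamma>" using G(1) m_lim LIMSEQ_unique by blast
  then have "(\<gamma> has_vector_derivative v t) (at t)" for t
    using G(2) by (simp add: has_vector_derivative_def)
  then show ?thesis using v_cont bound by blast
qed

section \<open>The fractional Sobolev seminorm\<close>

lemma AE_periodic:
  fixes g v :: "real \<Rightarrow> 'a::euclidean_space"
  assumes [measurable]: "g \<in> borel_measurable borel" "v \<in> borel_measurable borel"
    and per: "periodic1 g" "periodic1 v" and ae: "AE t in lborel. t \<in> {0..1} \<longrightarrow> g t = v t"
  shows "AE t in lborel. g t = v t"
proof -
  have "AE t in lborel. - of_int n + 1 * t \<in> {0..1} \<longrightarrow> g (- of_int n + 1 * t) = v (- of_int n + 1 * t)" for n :: int
    by (rule AE_borel_affine[OF _ _ ae]) auto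
  then have "AE t in lborel. \<forall>n::int. - of_int n + 1 * t \<in> {0..1} \<longrightarrow> g (- of_int n + 1 * t) = v (- of_int n + 1 * t)"
    unfolding AE_all_countable by blast
  then show ?thesis
  proof eventually_elim
    case (elim t)
    have "g (frac t) = v (frac t)" using elim[rule_format, of "floor t"] frac_in_unit[of t] by (simp add: frac_def)
    then show ?case by (simp add: periodic1_frac[OF per(1)] periodic1_frac[OF per(2)])
  qed
qed

lemma gagliardo_sq_cong_AE:
  fixes g v :: "real \<Rightarrow> 'a::euclidean_space"
  assumes g: "g \<in> l2_periodic" and v: "v \<in> l2_periodic"
    and ae: "AE t in lborel. t \<in> {0..1} \<longrightarrow> g t = v t"
  shows "gagliardo_sq s g = gagliardo_sq s v"
proof -
  have [measurable]: "g \<in> borel_measurable borel" "v \<in> borel_measurable borel"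
    and per: "periodic1 g" "periodic1 v" using g v by (auto simp: l2_periodic_def)
  have ae: "AE t in lborel. g t = v t" by (rule AE_periodic[OF _ _ per ae]) measurable
  show ?thesis
    unfolding gagliardo_sq_def
  proof (rule nn_integral_cong_AE)
    show "AE u in lborel.
      (\<integral>\<^sup>+w\<in>{-1/2..1/2}. ennreal ((norm (g (u + w) - g u))\<^sup>2 / \<bar>w\<bar> powr (1 + 2 * s)) \<partial>lborel) * indicator {0..1} u =
      (\<integral>\<^sup>+w\<in>{-1/2..1/2}. ennreal ((norm (v (u + w) - v u))\<^sup>2 / \<bar>w\<bar> powr (1 + 2 * s)) \<partial>lborel) * indicator {0..1} u"
      using ae
    proof eventually_elim
      case (elim u)
      have "AE w in lborel. g (u + 1 * w) = v (u + 1 * w)" by (rule AE_borel_affine[OF _ _ ae]) auto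
      then have "AE w in lborel. ennreal ((norm (g (u + w) - g u))\<^sup>2 / \<bar>w\<bar> powr (1 + 2 * s)) * indicator {-1/2..1/2} w
          = ennreal ((norm (v (u + w) - v u))\<^sup>2 / \<bar>w\<bar> powr (1 + 2 * s)) * indicator {-1/2..1/2} w"
        by eventually_elim (simp add: elim)
      from nn_integral_cong_AE[OF this] show ?case by simp
    qed
  qed
qed

lemma gagliardo_sq_linear_le:
  fixes f :: "real \<Rightarrow> 'a::euclidean_space" and g :: "real \<Rightarrow> 'b::euclidean_space"
    and h :: "real \<Rightarrow> 'c::euclidean_space"
  assumes [measurable]: "f \<in> borel_measurable borel" "g \<in> borel_measurable borel"
    and le: "\<And>x y. (norm (h x - h y))\<^sup>2 \<le> a * (norm (f x - f y))\<^sup>2 + b * (norm (g x - g y))\<^sup>2"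
    and ab: "0 \<le> a" "0 \<le> b"
  shows "gagliardo_sq s h \<le> ennreal a * gagliardo_sq s f + ennreal b * gagliardo_sq s g"
proof -
  let ?I = "\<lambda>g u w. ennreal ((norm (g (u + w) - g u))\<^sup>2 / \<bar>w\<bar> powr (1 + 2 * s)) * indicator {-1/2..1/2} w"
  have pt: "?I h u w \<le> ennreal a * ?I f u w + ennreal b * ?I g u w" for u w
  proof -
    let ?d = "\<bar>w\<bar> powr (1 + 2 * s)"
    have "(norm (h (u + w) - h u))\<^sup>2 / ?d \<le> (a * (norm (f (u + w) - f u))\<^sup>2 + b * (norm (g (u + w) - g u))\<^sup>2) / ?d"
      by (intro divide_right_mono le) auto
    then have "ennreal ((norm (h (u + w) - h u))\<^sup>2 / ?d) \<le>
        ennreal (a * ((norm (f (u + w) - f u))\<^sup>2 / ?d) + b * ((norm (g (u + w) - g u))\<^sup>2 / ?d))"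
      by (intro ennreal_leI) (simp add: add_divide_distrib)
    also have "\<dots> = ennreal a * ennreal ((norm (f (u + w) - f u))\<^sup>2 / ?d) + ennreal b * ennreal ((norm (g (u + w) - g u))\<^sup>2 / ?d)"
      using ab by (subst ennreal_plus) (auto simp: ennreal_mult simp del: times_divide_eq_right)
    finally show ?thesis by (cases "w \<in> {-1/2..1/2}") auto
  qed
  have "gagliardo_sq s h \<le> (\<integral>\<^sup>+u. (\<integral>\<^sup>+w. ennreal a * ?I f u w + ennreal b * ?I g u w \<partial>lborel) * indicator {0..1} u \<partial>lborel)"
    unfolding gagliardo_sq_def using pt by (intro nn_integral_mono mult_right_mono) auto
  also have "\<dots> = (\<integral>\<^sup>+u. ennreal a * ((\<integral>\<^sup>+w. ?I f u w \<partial>lborel) * indicator {0..1} u)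
      + ennreal b * ((\<integral>\<^sup>+w. ?I g u w \<partial>lborel) * indicator {0..1} u) \<partial>lborel)"
    by (intro nn_integral_cong, subst nn_integral_add) (auto simp: nn_integral_cmult distrib_right mult.assoc)
  also have "\<dots> = ennreal a * gagliardo_sq s f + ennreal b * gagliardo_sq s g"
    unfolding gagliardo_sq_def by (subst nn_integral_add) (auto simp: nn_integral_cmult)
  finally show ?thesis .
qed

text \<open>The square of the seminorm that distinguishes the space of order \<open>s\<close> from the square integrable functions.\<close>

definition hs_sq :: "real \<Rightarrow> (real \<Rightarrow> 'a::euclidean_space) \<Rightarrow> ennreal" where
  "hs_sq s g = (if s < 1 then gagliardo_sq s g else l2_sq (weak_deriv g))"

text \<open>The derivatives of curves in the Sobolev space are of this kind; as \<open>s > 1/2\<close>, they have continuous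
representatives.\<close>

definition hs_regular :: "real \<Rightarrow> (real \<Rightarrow> 'a::euclidean_space) \<Rightarrow> bool" where
  "hs_regular s g \<longleftrightarrow> continuous_on UNIV g \<and> periodic1 g \<and>
    (if s < 1 then gagliardo_sq s g < \<infinity> else \<exists>h. has_weak_deriv g h)"

lemma has_weak_deriv_weak_deriv: "has_weak_deriv f g \<Longrightarrow> has_weak_deriv f (weak_deriv f)"
  unfolding weak_deriv_def by (rule someI[of "has_weak_deriv f"])

lemma l2_sq_weak_deriv: "has_weak_deriv f g \<Longrightarrow> l2_sq (weak_deriv f) = l2_sq g"
  by (intro l2_sq_cong_AE weak_deriv_unique[of f] has_weak_deriv_weak_deriv)

lemma hs_sq_weak: "\<not> s < 1 \<Longrightarrow> has_weak_deriv g h \<Longrightarrow> hs_sq s g = l2_sq h"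
  by (simp add: hs_sq_def l2_sq_weak_deriv)

lemma hs_regular_l2: "hs_regular s g \<Longrightarrow> g \<in> l2_periodic"
  by (simp add: hs_regular_def continuous_periodic_l2)

lemma l2_finite: "g \<in> l2_periodic \<Longrightarrow> l2_sq g < \<infinity>"
  by (simp add: l2_periodic_def)

lemma hs_regular_finite: "hs_regular s g \<Longrightarrow> hs_sq s g < \<infinity>"
proof (cases "s < 1")
  case False
  assume "hs_regular s g"
  then obtain h where w: "has_weak_deriv g h" using False by (auto simp: hs_regular_def)
  show ?thesis using hs_sq_weak[OF False w] l2_finite[OF has_weak_deriv_l2(2)[OF w]] by simp
qed (simp add: hs_regular_def hs_sq_def)

text \<open>An estimate of squares without mixed terms can be integrated term by term; optimising \<open>e\<close> afterwards recovers the
triangle inequality (lemma \<open>le_add_of_weighted_squares\<close>).\<close>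

lemma norm_add_sq_weighted:
  fixes x y :: "'a::real_normed_vector"
  assumes e: "e > 0"
  shows "(norm (x + y))\<^sup>2 \<le> (1 + e) * (norm x)\<^sup>2 + (1 + 1 / e) * (norm y)\<^sup>2"
proof -
  have "(norm (x + y))\<^sup>2 \<le> (norm x + norm y)\<^sup>2" by (intro power_mono norm_triangle_ineq) auto
  moreover have "2 * norm x * norm y \<le> e * (norm x)\<^sup>2 + (norm y)\<^sup>2 / e"
  proof -
    have "0 \<le> (e * norm x - norm y)\<^sup>2 / e" using e by simp
    also have "\<dots> = e * (norm x)\<^sup>2 + (norm y)\<^sup>2 / e - 2 * norm x * norm y"
      using e by (simp add: power2_diff power2_eq_square field_simps)
    finally show ?thesis by simp
  qed
  ultimately show ?thesis by (simp add: power2_sum algebra_simps)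
qed

text \<open>For \<open>s < 1\<close> the seminorm integrates squares of increments, for \<open>s = 1\<close> squares of derivatives.  Both depend linearly
  on the function, so in either case a pointwise estimate of squares suffices.\<close>

lemma hs_regular_add:
  fixes f g :: "real \<Rightarrow> 'a::euclidean_space"
  assumes f: "hs_regular s f" and g: "hs_regular s g" and e: "e > 0"
  shows "hs_regular s (\<lambda>t. f t + g t)"
    and "hs_sq s (\<lambda>t. f t + g t) \<le> ennreal (1 + e) * hs_sq s f + ennreal (1 + 1 / e) * hs_sq s g"
proof -
  note sq = norm_add_sq_weighted[OF e, where 'a = 'a]
  have cont: "continuous_on UNIV (\<lambda>t. f t + g t)" "periodic1 (\<lambda>t. f t + g t)"
    using f g by (auto simp: hs_regular_def periodic1_def intro!: continuous_intros)
  have [measurable]: "f \<in> borel_measurable borel" "g \<in> borel_measurable borel"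
    using f g hs_regular_l2 by (auto simp: l2_periodic_def)
  show le: "hs_sq s (\<lambda>t. f t + g t) \<le> ennreal (1 + e) * hs_sq s f + ennreal (1 + 1 / e) * hs_sq s g"
  proof (cases "s < 1")
    case True
    have "(norm (f x + g x - (f y + g y)))\<^sup>2 \<le> (1 + e) * (norm (f x - f y))\<^sup>2 + (1 + 1 / e) * (norm (g x - g y))\<^sup>2" for x y
      using sq[of "f x - f y" "g x - g y"] by (simp add: algebra_simps)
    then show ?thesis unfolding hs_sq_def if_P[OF True] using e by (intro gagliardo_sq_linear_le) auto
  next
    case False
    then obtain f' g' where w: "has_weak_deriv f f'" "has_weak_deriv g g'" using f g by (auto simp: hs_regular_def)
    then have [measurable]: "f' \<in> borel_measurable borel" "g' \<in> borel_measurable borel"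
      using has_weak_deriv_l2(2) l2_periodic_measurable by blast+
    show ?thesis
      unfolding hs_sq_weak[OF False has_weak_deriv_add[OF w]] hs_sq_weak[OF False w(1)] hs_sq_weak[OF False w(2)]
      using sq e by (intro l2_sq_linear_le) auto
  qed
  show "hs_regular s (\<lambda>t. f t + g t)"
  proof (cases "s < 1")
    case True
    have "ennreal (1 + e) * hs_sq s f + ennreal (1 + 1 / e) * hs_sq s g < \<infinity>"
      using hs_regular_finite[OF f] hs_regular_finite[OF g] by (simp add: ennreal_mult_less_top)
    then show ?thesis using le cont True unfolding hs_regular_def hs_sq_def by (auto intro: le_less_trans)
  next
    case False
    then show ?thesis using f g cont has_weak_deriv_add unfolding hs_regular_def by auto blast
  qed
qed

lemma hs_regular_scaleR:
  fixes f :: "real \<Rightarrow> 'a::euclidean_space"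
  assumes f: "hs_regular s f"
  shows "hs_regular s (\<lambda>t. c *\<^sub>R f t)" and "hs_sq s (\<lambda>t. c *\<^sub>R f t) \<le> ennreal (c\<^sup>2) * hs_sq s f"
proof -
  have cont: "continuous_on UNIV (\<lambda>t. c *\<^sub>R f t)" "periodic1 (\<lambda>t. c *\<^sub>R f t)"
    using f by (auto simp: hs_regular_def periodic1_def intro!: continuous_intros)
  have [measurable]: "f \<in> borel_measurable borel"
    using f hs_regular_l2 by (auto simp: l2_periodic_def)
  show le: "hs_sq s (\<lambda>t. c *\<^sub>R f t) \<le> ennreal (c\<^sup>2) * hs_sq s f"
  proof (cases "s < 1")
    case True
    have "(norm (c *\<^sub>R f x - c *\<^sub>R f y))\<^sup>2 \<le> c\<^sup>2 * (norm (f x - f y))\<^sup>2 + 0 * (norm (f x - f y))\<^sup>2" for x y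
      by (simp add: power_mult_distrib flip: scaleR_diff_right)
    from gagliardo_sq_linear_le[OF _ _ this, where s = s] show ?thesis using True unfolding hs_sq_def by simp
  next
    case False
    then obtain f' where w: "has_weak_deriv f f'" using f by (auto simp: hs_regular_def)
    then have [measurable]: "f' \<in> borel_measurable borel"
      using has_weak_deriv_l2(2) l2_periodic_measurable by blast+
    show ?thesis
      using hs_sq_weak[OF False has_weak_deriv_scaleR[OF w, of c]] hs_sq_weak[OF False w]
        l2_sq_linear_le[of f' f' "\<lambda>t. c *\<^sub>R f' t" "c\<^sup>2" 0] by (simp add: power_mult_distrib)
  qed
  show "hs_regular s (\<lambda>t. c *\<^sub>R f t)"
  proof (cases "s < 1")
    case True
    have "ennreal (c\<^sup>2) * hs_sq s f < \<infinity>"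
      using hs_regular_finite[OF f] by (simp add: ennreal_mult_less_top)
    then show ?thesis using le cont True unfolding hs_regular_def hs_sq_def by (auto intro: le_less_trans)
  next
    case False
    then show ?thesis using f cont has_weak_deriv_scaleR unfolding hs_regular_def by auto
  qed
qed

text \<open>By the Leibniz rule, for increments or for derivatives, with one factor bounded by its supremum.\<close>

lemma hs_regular_prod:
  fixes f :: "real \<Rightarrow> 'a::euclidean_space" and g :: "real \<Rightarrow> 'b::euclidean_space"
    and prod :: "'a \<Rightarrow> 'b \<Rightarrow> 'c::euclidean_space"
  assumes prod: "bounded_bilinear prod" and contr: "\<And>a b. norm (prod a b) \<le> norm a * norm b"
    and f: "hs_regular s f" "\<And>t. norm (f t) \<le> M1" and g: "hs_regular s g" "\<And>t. norm (g t) \<le> M2"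
  shows "hs_regular s (\<lambda>t. prod (f t) (g t))"
    and "hs_sq s (\<lambda>t. prod (f t) (g t)) \<le> ennreal (2 * M2\<^sup>2) * hs_sq s f + ennreal (2 * M1\<^sup>2) * hs_sq s g"
proof -
  interpret prod: bounded_bilinear prod by (rule prod)
  have M: "0 \<le> M1" "0 \<le> M2" using f(2)[of 0] g(2)[of 0] norm_ge_zero order_trans by blast+
  have cf: "continuous_on UNIV f" "periodic1 f" and cg: "continuous_on UNIV g" "periodic1 g"
    using f g by (auto simp: hs_regular_def)
  have cont: "continuous_on UNIV (\<lambda>t. prod (f t) (g t))" "periodic1 (\<lambda>t. prod (f t) (g t))"
    using cf cg by (auto simp: periodic1_def intro!: prod.continuous_on)
  have [measurable]: "f \<in> borel_measurable borel" "g \<in> borel_measurable borel"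
    using cf cg by (auto intro: borel_measurable_continuous_onI)
  have leibniz: "(norm (prod a b + prod a' b'))\<^sup>2 \<le> (2 * M2\<^sup>2) * (norm a)\<^sup>2 + (2 * M1\<^sup>2) * (norm b')\<^sup>2"
    if "norm b \<le> M2" "norm a' \<le> M1" for a a' b b'
  proof -
    have "norm (prod a b) \<le> norm a * M2" "norm (prod a' b') \<le> M1 * norm b'"
      using contr[of a b] contr[of a' b'] that mult_left_mono[OF that(1), of "norm a"] mult_right_mono[OF that(2), of "norm b'"]
      by auto
    then have "(norm (prod a b))\<^sup>2 \<le> (norm a * M2)\<^sup>2" "(norm (prod a' b'))\<^sup>2 \<le> (M1 * norm b')\<^sup>2"
      by (auto intro!: power_mono)
    then show ?thesis using norm_add_sq_le[of "prod a b" "prod a' b'"]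
      by (simp add: power_mult_distrib mult_ac)
  qed
  have weak: "has_weak_deriv (\<lambda>t. prod (f t) (g t)) (\<lambda>t. prod (f' t) (g t) + prod (f t) (g' t))"
    if w: "has_weak_deriv f f'" "has_weak_deriv g g'" for f' g'
  proof (rule has_weak_deriv_primitive[OF cont])
    have mf: "f' \<in> borel_measurable borel" "g' \<in> borel_measurable borel"
      using has_weak_deriv_l2(2)[OF w(1)] has_weak_deriv_l2(2)[OF w(2)] by (auto simp: l2_periodic_def)
    have c: "continuous_on UNIV (\<lambda>x. prod (fst x) (snd x))"
      by (rule prod.continuous_on) (intro continuous_on_fst continuous_on_snd continuous_on_id)+
    have meas: "(\<lambda>t. prod (f' t) (g t) + prod (f t) (g' t)) \<in> borel_measurable borel"
      using mf by (intro borel_measurable_add borel_measurable_continuous_Pair[OF _ _ c]) auto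
    have "l2_sq (\<lambda>t. prod (f' t) (g t) + prod (f t) (g' t)) \<le> ennreal (2 * M2\<^sup>2) * l2_sq f' + ennreal (2 * M1\<^sup>2) * l2_sq g'"
      using mf by (intro l2_sq_linear_le leibniz f g) auto
    also have "\<dots> < \<infinity>"
      using has_weak_deriv_l2(2)[OF w(1), THEN l2_finite] has_weak_deriv_l2(2)[OF w(2), THEN l2_finite]
      by (simp add: ennreal_mult_less_top)
    finally show "(\<lambda>t. prod (f' t) (g t) + prod (f t) (g' t)) \<in> l2_periodic"
      using meas has_weak_deriv_l2(2)[OF w(1)] has_weak_deriv_l2(2)[OF w(2)] cf cg
      by (auto simp: l2_periodic_def periodic1_def)
    fix t :: real assume t: "t \<in> {0..1}"
    have int: "set_integrable lborel {0..t} f'" "set_integrable lborel {0..t} g'"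
      using t l2_integrable[OF has_weak_deriv_l2(2)[OF w(1)]] l2_integrable[OF has_weak_deriv_l2(2)[OF w(2)]]
      by (auto elim: set_integrable_subset)
    have "(LINT u:{0..t}|lborel. prod (f u) (g' u) + prod (f' u) (g u)) = prod (f t) (g t) - prod (f 0) (g 0)"
    proof (rule integral_prod_primitives(2)[OF prod _ int])
      show "f u = f 0 + (LINT x:{0..u}|lborel. f' x)" if "u \<in> {0..t}" for u
        by (rule primitive_of_weak_deriv[OF cf(1) w(1)]) (use that t in auto)
      show "g u = g 0 + (LINT x:{0..u}|lborel. g' x)" if "u \<in> {0..t}" for u
        by (rule primitive_of_weak_deriv[OF cg(1) w(2)]) (use that t in auto)
    qed (use t in simp)
    then show "prod (f t) (g t) = prod (f 0) (g 0) + (LINT u:{0..t}|lborel. prod (f' u) (g u) + prod (f u) (g' u))"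
      by (simp add: add.commute)
  qed
  show le: "hs_sq s (\<lambda>t. prod (f t) (g t)) \<le> ennreal (2 * M2\<^sup>2) * hs_sq s f + ennreal (2 * M1\<^sup>2) * hs_sq s g"
  proof (cases "s < 1")
    case True
    have "(norm (prod (f x) (g x) - prod (f y) (g y)))\<^sup>2
        \<le> (2 * M2\<^sup>2) * (norm (f x - f y))\<^sup>2 + (2 * M1\<^sup>2) * (norm (g x - g y))\<^sup>2" for x y
    proof -
      have "prod (f x) (g x) - prod (f y) (g y) = prod (f x - f y) (g x) + prod (f y) (g x - g y)"
        by (simp add: prod.diff_left prod.diff_right)
      then show ?thesis using leibniz[OF g(2) f(2), of "f x - f y" x y "g x - g y"] by simp
    qed
    then show ?thesis unfolding hs_sq_def if_P[OF True] by (intro gagliardo_sq_linear_le) auto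
  next
    case False
    then obtain f' g' where w: "has_weak_deriv f f'" "has_weak_deriv g g'" using f g by (auto simp: hs_regular_def)
    then have "f' \<in> borel_measurable borel" "g' \<in> borel_measurable borel"
      using has_weak_deriv_l2(2) l2_periodic_measurable by blast+
    then have "l2_sq (\<lambda>t. prod (f' t) (g t) + prod (f t) (g' t)) \<le> ennreal (2 * M2\<^sup>2) * l2_sq f' + ennreal (2 * M1\<^sup>2) * l2_sq g'"
      by (intro l2_sq_linear_le leibniz f g) auto
    then show ?thesis
      using hs_sq_weak[OF False weak[OF w]] hs_sq_weak[OF False w(1)] hs_sq_weak[OF False w(2)] by simp
  qed
  show "hs_regular s (\<lambda>t. prod (f t) (g t))"
  proof (cases "s < 1")
    case True
    have "ennreal (2 * M2\<^sup>2) * hs_sq s f + ennreal (2 * M1\<^sup>2) * hs_sq s g < \<infinity>"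
      using hs_regular_finite[OF f(1)] hs_regular_finite[OF g(1)] by (simp add: ennreal_mult_less_top)
    then show ?thesis using le cont True unfolding hs_regular_def hs_sq_def by (auto intro: le_less_trans)
  next
    case False
    then show ?thesis using f g cont weak unfolding hs_regular_def by auto blast
  qed
qed

lemma hs_regular_const: "hs_regular s (\<lambda>_. c)" and hs_sq_const: "hs_sq s (\<lambda>_. c) = 0"
  for c :: "'a::euclidean_space"
proof -
  have per: "periodic1 (\<lambda>_. c)" "periodic1 (\<lambda>_. 0 :: 'a)" by (simp_all add: periodic1_def)
  have w: "has_weak_deriv (\<lambda>_. c) (\<lambda>_. 0)" by (intro has_weak_deriv_C1 per) auto
  have g: "gagliardo_sq s (\<lambda>_. c) = 0" by (simp add: gagliardo_sq_def)
  show "hs_regular s (\<lambda>_. c)" using per w g by (auto simp: hs_regular_def)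
  show "hs_sq s (\<lambda>_. c) = 0"
    using hs_sq_weak[OF _ w] g by (cases "s < 1") (auto simp: hs_sq_def l2_sq_def)
qed

text \<open>A joint bound for the supremum and the seminorm.  Stated as a relation it composes along sums and products without
mention of a norm on the space of derivatives.\<close>

definition hs_bd :: "real \<Rightarrow> (real \<Rightarrow> 'a::euclidean_space) \<Rightarrow> real \<Rightarrow> bool" where
  "hs_bd s f M \<longleftrightarrow> hs_regular s f \<and> (\<forall>t. norm (f t) \<le> M) \<and> hs_sq s f \<le> ennreal (M\<^sup>2)"

lemma hs_bd_nonneg: "hs_bd s f M \<Longrightarrow> 0 \<le> M"
  unfolding hs_bd_def by (meson norm_ge_zero order_trans)

lemma hs_bd_mono: "hs_bd s f M \<Longrightarrow> M \<le> M' \<Longrightarrow> hs_bd s f M'"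
  using hs_bd_nonneg[of s f M] unfolding hs_bd_def
  by (auto intro: order_trans intro!: ennreal_leI power_mono elim!: order_trans)

lemma hs_bd_const: "hs_bd s (\<lambda>_. c) (norm c)"
  by (simp add: hs_bd_def hs_regular_const hs_sq_const)

lemma hs_bd_add:
  assumes f: "hs_bd s f M" and g: "hs_bd s g M'"
  shows "hs_bd s (\<lambda>t. f t + g t) (2 * (M + M'))"
  unfolding hs_bd_def
proof (intro conjI allI)
  note M = hs_bd_nonneg[OF f] hs_bd_nonneg[OF g]
  show "hs_regular s (\<lambda>t. f t + g t)" using f g by (intro hs_regular_add[of _ _ _ 1]) (auto simp: hs_bd_def)
  show "norm (f t + g t) \<le> 2 * (M + M')" for t
    using norm_triangle_ineq[of "f t" "g t"] f g M unfolding hs_bd_def by (smt (verit))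
  have "hs_sq s (\<lambda>t. f t + g t) \<le> ennreal (1 + 1) * hs_sq s f + ennreal (1 + 1 / 1) * hs_sq s g"
    using f g by (intro hs_regular_add) (auto simp: hs_bd_def)
  also have "\<dots> \<le> ennreal 2 * ennreal (M\<^sup>2) + ennreal 2 * ennreal (M'\<^sup>2)"
    using f g unfolding hs_bd_def by (intro add_mono mult_mono) auto
  also have "\<dots> = ennreal (2 * M\<^sup>2 + 2 * M'\<^sup>2)" by (simp add: ennreal_mult)
  also have "\<dots> \<le> ennreal ((2 * (M + M'))\<^sup>2)"
    using M mult_nonneg_nonneg[OF M] by (intro ennreal_leI) (simp add: power2_eq_square algebra_simps)
  finally show "hs_sq s (\<lambda>t. f t + g t) \<le> ennreal ((2 * (M + M'))\<^sup>2)" .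
qed

lemma hs_bd_scaleR:
  assumes f: "hs_bd s f M"
  shows "hs_bd s (\<lambda>t. c *\<^sub>R f t) (\<bar>c\<bar> * M)"
  unfolding hs_bd_def
proof (intro conjI allI)
  show "hs_regular s (\<lambda>t. c *\<^sub>R f t)" using f by (intro hs_regular_scaleR) (auto simp: hs_bd_def)
  show "norm (c *\<^sub>R f t) \<le> \<bar>c\<bar> * M" for t using f by (auto simp: hs_bd_def intro!: mult_left_mono)
  have "hs_sq s (\<lambda>t. c *\<^sub>R f t) \<le> ennreal (c\<^sup>2) * hs_sq s f"
    using f by (intro hs_regular_scaleR) (auto simp: hs_bd_def)
  also have "\<dots> \<le> ennreal (c\<^sup>2) * ennreal (M\<^sup>2)" using f unfolding hs_bd_def by (intro mult_left_mono) auto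
  also have "\<dots> = ennreal ((\<bar>c\<bar> * M)\<^sup>2)" by (simp add: power_mult_distrib flip: ennreal_mult)
  finally show "hs_sq s (\<lambda>t. c *\<^sub>R f t) \<le> ennreal ((\<bar>c\<bar> * M)\<^sup>2)" .
qed

lemma hs_bd_diff:
  assumes "hs_bd s f M" "hs_bd s g M'"
  shows "hs_bd s (\<lambda>t. f t - g t) (2 * (M + M'))"
  using hs_bd_add[OF assms(1) hs_bd_scaleR[OF assms(2), of "-1"]] by simp

lemma hs_bd_prod:
  fixes f :: "real \<Rightarrow> 'a::euclidean_space" and g :: "real \<Rightarrow> 'b::euclidean_space"
    and prod :: "'a \<Rightarrow> 'b \<Rightarrow> 'c::euclidean_space"
  assumes prod: "bounded_bilinear prod" "\<And>a b. norm (prod a b) \<le> norm a * norm b"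
    and f: "hs_bd s f M" and g: "hs_bd s g M'"
  shows "hs_bd s (\<lambda>t. prod (f t) (g t)) (2 * M * M')"
  unfolding hs_bd_def
proof (intro conjI allI)
  note M = hs_bd_nonneg[OF f] hs_bd_nonneg[OF g]
  note p = hs_regular_prod[OF prod, of s f M g M']
  show "hs_regular s (\<lambda>t. prod (f t) (g t))" using f g by (intro p) (auto simp: hs_bd_def)
  show "norm (prod (f t) (g t)) \<le> 2 * M * M'" for t
  proof -
    have "norm (prod (f t) (g t)) \<le> norm (f t) * norm (g t)" by (rule prod(2))
    also have "\<dots> \<le> M * M'" using f g M by (intro mult_mono) (auto simp: hs_bd_def)
    finally show ?thesis using mult_nonneg_nonneg[OF M] by simp
  qed
  have "hs_sq s (\<lambda>t. prod (f t) (g t)) \<le> ennreal (2 * M'\<^sup>2) * hs_sq s f + ennreal (2 * M\<^sup>2) * hs_sq s g"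
    using f g by (intro p) (auto simp: hs_bd_def)
  also have "\<dots> \<le> ennreal (2 * M'\<^sup>2) * ennreal (M\<^sup>2) + ennreal (2 * M\<^sup>2) * ennreal (M'\<^sup>2)"
    using f g unfolding hs_bd_def by (intro add_mono mult_mono) auto
  also have "\<dots> = ennreal (2 * M'\<^sup>2 * M\<^sup>2 + 2 * M\<^sup>2 * M'\<^sup>2)" by (simp flip: ennreal_mult ennreal_plus)
  also have "\<dots> = ennreal ((2 * M * M')\<^sup>2)" by (simp add: power_mult_distrib mult_ac)
  finally show "hs_sq s (\<lambda>t. prod (f t) (g t)) \<le> ennreal ((2 * M * M')\<^sup>2)" .
qed

section \<open>The Banach space\<close>

text \<open>For \<open>s > 1/2\<close> this describes the Sobolev space by classical derivatives, see \<open>sobolev_space_imp_sob\<close> and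
\<open>sob_imp_sobolev_space\<close>.\<close>

definition sob :: "real \<Rightarrow> (real \<Rightarrow> 'a::euclidean_space) \<Rightarrow> (real \<Rightarrow> 'a) \<Rightarrow> bool" where
  "sob s \<gamma> v \<longleftrightarrow> periodic1 \<gamma> \<and> hs_regular s v \<and> (\<forall>t. (\<gamma> has_vector_derivative v t) (at t))"

lemma sob_continuous:
  assumes "sob s \<gamma> v"
  shows "continuous_on UNIV \<gamma>"
proof (rule continuous_at_imp_continuous_on, rule ballI)
  show "isCont \<gamma> t" for t
    using assms has_vector_derivative_continuous[of \<gamma> "v t" t UNIV] by (simp add: sob_def)
qed

lemma sob_weak:
  assumes "sob s \<gamma> v"
  shows "has_weak_deriv \<gamma> v"
  by (rule has_weak_deriv_C1) (use assms in \<open>simp_all add: sob_def hs_regular_def\<close>)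

lemma sob_vector_derivative:
  assumes "sob s \<gamma> v"
  shows "vector_derivative \<gamma> (at t) = v t"
  by (rule vector_derivative_at) (use assms in \<open>simp add: sob_def\<close>)

lemma sob_imp_sobolev_space:
  assumes "sob s \<gamma> v"
  shows "\<gamma> \<in> sobolev_space s"
proof -
  have "if s < 1 then gagliardo_sq s v < \<infinity> else \<exists>h. has_weak_deriv v h"
    using assms unfolding sob_def hs_regular_def by blast
  then show ?thesis
    using sob_continuous[OF assms] sob_weak[OF assms] unfolding sobolev_space_def by blast
qed

lemma ennreal_le_square:
  assumes "x < (\<infinity> :: ennreal)" "y < \<infinity>"
  obtains \<Gamma> where "\<Gamma> > 0" "x \<le> ennreal (\<Gamma>\<^sup>2)" "y \<le> ennreal (\<Gamma>\<^sup>2)"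
proof -
  obtain a b where ab: "x = ennreal a" "0 \<le> a" "y = ennreal b" "0 \<le> b"
    using assms by (metis ennreal_cases infinity_ennreal_def less_irrefl)
  have "a \<le> (a + b + 1)\<^sup>2" "b \<le> (a + b + 1)\<^sup>2"
  proof -
    have "(a + b + 1) * 1 \<le> (a + b + 1) * (a + b + 1)" using ab by (intro mult_left_mono) auto
    then have "a + b + 1 \<le> (a + b + 1)\<^sup>2" by (simp add: power2_eq_square)
    then show "a \<le> (a + b + 1)\<^sup>2" "b \<le> (a + b + 1)\<^sup>2" using ab by linarith+
  qed
  then show ?thesis using ab by (intro that[of "a + b + 1"]) (auto intro: ennreal_leI)
qed

lemma periodic_vector_derivative:
  fixes \<gamma> :: "real \<Rightarrow> 'a::euclidean_space"
  assumes per: "periodic1 \<gamma>" and D: "\<And>t. (\<gamma> has_vector_derivative v t) (at t)"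
  shows "periodic1 v"
  unfolding periodic1_def
proof
  fix t
  have "((\<gamma> \<circ> (\<lambda>t. t + 1)) has_vector_derivative (1 *\<^sub>R v (t + 1))) (at t)"
    by (rule vector_diff_chain_at) (auto intro!: D derivative_eq_intros)
  moreover have "\<gamma> \<circ> (\<lambda>t. t + 1) = \<gamma>" using per by (auto simp: periodic1_def)
  ultimately have "(\<gamma> has_vector_derivative v (t + 1)) (at t)" by simp
  then show "v (t + 1) = v t" using D[of t] by (rule vector_derivative_unique_at)
qed

lemma sobolev_space_imp_sob:
  fixes \<gamma> :: "real \<Rightarrow> 'a::euclidean_space"
  assumes s: "1/2 < s" "s \<le> 1" and \<gamma>: "\<gamma> \<in> sobolev_space s"
  shows "\<exists>v. sob s \<gamma> v"
proof -
  from \<gamma> obtain g where c: "continuous_on UNIV \<gamma>" and wd: "has_weak_deriv \<gamma> g"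
    and g: "if s < 1 then gagliardo_sq s g < \<infinity> else \<exists>h. has_weak_deriv g h"
    by (auto simp: sobolev_space_def)
  have per: "periodic1 \<gamma>" using has_weak_deriv_l2(1)[OF wd] by (simp add: l2_periodic_def)
  show ?thesis
  proof (cases "s < 1")
    case True
    obtain \<Gamma> where \<Gamma>: "\<Gamma> > 0" "gagliardo_sq s g \<le> ennreal (\<Gamma>\<^sup>2)" "l2_sq g \<le> ennreal (\<Gamma>\<^sup>2)"
      using ennreal_le_square g True l2_finite[OF has_weak_deriv_l2(2)[OF wd]] by metis
    obtain v where v: "continuous_on UNIV v" "\<And>t. (\<gamma> has_vector_derivative v t) (at t)"
      using sobolev_embedding_C1[OF c wd \<Gamma>(2,3,1) s(1) True] by blast
    have vper: "periodic1 v" by (rule periodic_vector_derivative[OF per v(2)])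
    have wv: "has_weak_deriv \<gamma> v" by (rule has_weak_deriv_C1[OF per vper v])
    have "gagliardo_sq s g = gagliardo_sq s v"
      by (intro gagliardo_sq_cong_AE weak_deriv_unique[OF wd wv] has_weak_deriv_l2(2)[OF wd] has_weak_deriv_l2(2)[OF wv])
    then have "hs_regular s v" using g True v(1) vper by (simp add: hs_regular_def)
    then show ?thesis using per v(2) unfolding sob_def by blast
  next
    case False
    then obtain h where "has_weak_deriv g h" using g by auto
    then obtain v where v: "continuous_on UNIV v" "periodic1 v" "has_weak_deriv v h"
      "AE t in lborel. t \<in> {0..1} \<longrightarrow> g t = v t"
      using weak_deriv_continuous_representative by blast
    have "has_weak_deriv \<gamma> v"
      by (rule has_weak_deriv_cong_AE[OF wd]) (use has_weak_deriv_l2[OF wd] has_weak_deriv_l2[OF v(3)] v(4) in auto)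
    then have "(\<gamma> has_vector_derivative v t) (at t)" for t by (rule C1_of_continuous_weak_deriv[OF c v(1)])
    moreover have "hs_regular s v" using False v by (auto simp: hs_regular_def)
    ultimately show ?thesis using per unfolding sob_def by blast
  qed
qed

text \<open>For \<open>s = 1\<close>, where \<open>v\<close> is the indefinite integral of a function in \<open>L\<^sup>2\<close>, the oscillation of \<open>v\<close> is at most \<open>\<Gamma>\<close>, and \<open>v\<close> has
mean zero as the derivative of a closed curve.\<close>

lemma sob_hs_embedding:
  assumes s: "1/2 < s" "s \<le> 1"
  shows "\<exists>C>0. \<forall>(\<gamma> :: real \<Rightarrow> 'a::euclidean_space) v \<Gamma>. sob s \<gamma> v \<longrightarrow> \<Gamma> > 0 \<longrightarrow> l2_sq v \<le> ennreal (\<Gamma>\<^sup>2) \<longrightarrow>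
    hs_sq s v \<le> ennreal (\<Gamma>\<^sup>2) \<longrightarrow> (\<forall>t. norm (v t) \<le> C * \<Gamma>)"
proof (cases "s < 1")
  case True
  have "(1/2 :: real) powr (s - 1/2) < 1" using s powr_less_mono'[of "1/2" 0 "s - 1/2"] by auto
  then have pos: "0 < 4 + 9 / (1 - (1/2 :: real) powr (s - 1/2))" by (intro add_pos_pos divide_pos_pos) auto
  show ?thesis
  proof (intro exI conjI allI impI, rule pos)
    fix \<gamma> v :: "real \<Rightarrow> 'a" and \<Gamma> t
    assume sob: "sob s \<gamma> v" and \<Gamma>: "\<Gamma> > 0" "l2_sq v \<le> ennreal (\<Gamma>\<^sup>2)" "hs_sq s v \<le> ennreal (\<Gamma>\<^sup>2)"
    have gag: "gagliardo_sq s v \<le> ennreal (\<Gamma>\<^sup>2)" using \<Gamma>(3) True by (simp add: hs_sq_def)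
    obtain w where w: "\<And>t. (\<gamma> has_vector_derivative w t) (at t)"
      "\<And>t. norm (w t) \<le> (4 + 9 / (1 - (1/2) powr (s - 1/2))) * \<Gamma>"
      using sobolev_embedding_C1[OF sob_continuous[OF sob] sob_weak[OF sob] gag \<Gamma>(2,1) s(1) True] by blast
    have "w t = v t" using vector_derivative_at[OF w(1)[of t]] sob_vector_derivative[OF sob, of t] by simp
    then show "norm (v t) \<le> (4 + 9 / (1 - (1/2) powr (s - 1/2))) * \<Gamma>" using w(2)[of t] by simp
  qed
next
  case False
  show ?thesis
  proof (intro exI[of _ 2] conjI allI impI)
    fix \<gamma> v :: "real \<Rightarrow> 'a" and \<Gamma> t
    assume sob: "sob s \<gamma> v" and \<Gamma>: "\<Gamma> > 0" "l2_sq v \<le> ennreal (\<Gamma>\<^sup>2)" "hs_sq s v \<le> ennreal (\<Gamma>\<^sup>2)"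
    have v: "continuous_on UNIV v" "periodic1 v" using sob by (auto simp: sob_def hs_regular_def)
    obtain h where h: "has_weak_deriv v h" using sob False by (auto simp: sob_def hs_regular_def)
    then have h2: "l2_sq h \<le> ennreal (\<Gamma>\<^sup>2)" using \<Gamma>(3) hs_sq_weak[OF False h] by simp
    have hm: "h \<in> borel_measurable borel" using has_weak_deriv_l2(2)[OF h] by (simp add: l2_periodic_def)
    have osc: "norm (v t - v 0) \<le> \<Gamma>" if t: "t \<in> {0..1}" for t
    proof -
      have "ennreal (norm (LINT u:{0..t}|lborel. h u)) \<le> (\<integral>\<^sup>+u. ennreal (norm (h u)) * indicator {0..1} u \<partial>lborel)"
        using t l2_integrable[OF has_weak_deriv_l2(2)[OF h]]
        by (intro norm_set_integral_le) (auto elim: set_integrable_subset)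
      also have "\<dots> \<le> ennreal \<Gamma>" by (rule l1_le_of_l2_sq[OF hm \<Gamma>(1) h2])
      finally have "norm (LINT u:{0..t}|lborel. h u) \<le> \<Gamma>" using \<Gamma>(1) by (subst (asm) ennreal_le_iff) auto
      moreover have "v t - v 0 = (LINT u:{0..t}|lborel. h u)"
        using primitive_of_weak_deriv[OF v(1) h t] by (metis add_diff_cancel_left')
      ultimately show ?thesis by simp
    qed
    have vi: "v integrable_on {0..1}" using v(1) by (intro integrable_continuous_interval) (rule continuous_on_subset, auto)
    have "integral {0..1} v = 0"
      using weak_deriv_integral_zero[OF sob_weak[OF sob]]
        set_borel_integral_eq_integral(2)[OF l2_integrable[OF has_weak_deriv_l2(1)[OF h]]] by simp
    then have "- v 0 = integral {0..1} (\<lambda>t. v t - v 0)" using vi by (subst integral_diff) auto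
    moreover have "norm (integral {0..1} (\<lambda>t. v t - v 0)) \<le> \<Gamma> * (1 - 0)"
      using osc v(1) by (intro integral_bound continuous_intros) (auto intro: continuous_on_subset)
    ultimately have "norm (v 0) \<le> \<Gamma>" by (metis diff_zero mult.right_neutral norm_minus_cancel)
    moreover have "norm (v t) \<le> norm (v t - v 0) + norm (v 0)" for t by (metis diff_add_cancel norm_triangle_ineq)
    ultimately have "norm (v t) \<le> 2 * \<Gamma>" if "t \<in> {0..1}" for t using osc[OF that] by (smt (verit))
    from this[OF frac_in_unit[of t]] show "norm (v t) \<le> 2 * \<Gamma>" by (simp add: periodic1_frac[OF v(2)])
  qed simp
qed

text \<open>The chosen weak derivatives agree almost everywhere with the classical ones.\<close>

lemma sob_norm_sq:
  assumes sob: "sob s \<gamma> v"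
  shows "ennreal ((sobolev_norm s \<gamma>)\<^sup>2) = l2_sq \<gamma> + l2_sq v + hs_sq s v"
proof -
  note wv = sob_weak[OF sob]
  note ww = has_weak_deriv_weak_deriv[OF wv]
  have ae: "AE t in lborel. t \<in> {0..1} \<longrightarrow> v t = weak_deriv \<gamma> t" by (rule weak_deriv_unique[OF wv ww])
  have "(if s < 1 then gagliardo_sq s (weak_deriv \<gamma>) else l2_sq (weak_deriv (weak_deriv \<gamma>))) = hs_sq s v"
  proof (cases "s < 1")
    case True
    then show ?thesis
      using gagliardo_sq_cong_AE[OF has_weak_deriv_l2(2)[OF wv] has_weak_deriv_l2(2)[OF ww] ae] by (simp add: hs_sq_def)
  next
    case False
    then obtain h where h: "has_weak_deriv v h" using sob by (auto simp: sob_def hs_regular_def)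
    have "has_weak_deriv (weak_deriv \<gamma>) h"
      by (rule has_weak_deriv_cong_AE[OF h has_weak_deriv_l2(2)[OF ww] has_weak_deriv_l2(2)[OF h] ae]) auto
    then show ?thesis using hs_sq_weak[OF False h] l2_sq_weak_deriv False by auto
  qed
  moreover have "l2_sq (weak_deriv \<gamma>) = l2_sq v" by (rule l2_sq_weak_deriv[OF wv])
  moreover have "l2_sq \<gamma> + l2_sq v + hs_sq s v < \<infinity>"
    using l2_finite[OF has_weak_deriv_l2(1)[OF wv]] l2_finite[OF has_weak_deriv_l2(2)[OF wv]]
      hs_regular_finite[of s v] sob by (simp add: sob_def)
  ultimately show ?thesis unfolding sobolev_norm_def by simp
qed

lemma sob_add:
  assumes x: "sob s x v" and y: "sob s y w"
  shows "sob s (x + y) (\<lambda>t. v t + w t)"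
  unfolding sob_def plus_fun_def
proof (intro conjI allI)
  show "periodic1 (\<lambda>t. x t + y t)" using x y by (simp add: sob_def periodic1_def)
  show "hs_regular s (\<lambda>t. v t + w t)" by (rule hs_regular_add[of _ _ _ 1]) (use x y in \<open>simp_all add: sob_def\<close>)
  show "((\<lambda>t. x t + y t) has_vector_derivative v t + w t) (at t)" for t
    by (rule has_vector_derivative_add) (use x y in \<open>simp_all add: sob_def\<close>)
qed

lemma sob_scaleR:
  assumes x: "sob s x v"
  shows "sob s (c *\<^sub>R x) (\<lambda>t. c *\<^sub>R v t)"
  unfolding sob_def scaleR_fun_def
proof (intro conjI allI)
  show "periodic1 (\<lambda>t. c *\<^sub>R x t)" using x by (simp add: sob_def periodic1_def)
  show "hs_regular s (\<lambda>t. c *\<^sub>R v t)" by (rule hs_regular_scaleR) (use x in \<open>simp add: sob_def\<close>)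
  show "((\<lambda>t. c *\<^sub>R x t) has_vector_derivative c *\<^sub>R v t) (at t)" for t
    by (rule bounded_linear.has_vector_derivative[OF bounded_linear_scaleR_right]) (use x in \<open>simp add: sob_def\<close>)
qed

lemma sob_diff:
  assumes x: "sob s x v" and y: "sob s y w"
  shows "sob s (x - y) (\<lambda>t. v t - w t)"
  using sob_add[OF x sob_scaleR[OF y, of "-1"]] by simp

lemma sob_0: "sob s 0 (\<lambda>_. 0)"
  unfolding sob_def zero_fun_def by (simp add: hs_regular_const periodic1_def)

lemma le_add_of_weighted_squares:
  fixes a b z :: real
  assumes ab: "0 \<le> a" "0 \<le> b" and le: "\<And>e. e > 0 \<Longrightarrow> z\<^sup>2 \<le> (1 + e) * a\<^sup>2 + (1 + 1 / e) * b\<^sup>2"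
  shows "z \<le> a + b"
proof (rule field_le_epsilon)
  fix \<delta> :: real assume \<delta>: "\<delta> > 0"
  define a' b' where "a' = a + \<delta> / 2" and "b' = b + \<delta> / 2"
  have pos: "a' > 0" "b' > 0" using ab \<delta> by (auto simp: a'_def b'_def)
  have "z\<^sup>2 \<le> (1 + b' / a') * a\<^sup>2 + (1 + 1 / (b' / a')) * b\<^sup>2" using pos by (intro le) auto
  also have "\<dots> \<le> (1 + b' / a') * a'\<^sup>2 + (1 + 1 / (b' / a')) * b'\<^sup>2"
    using pos ab \<delta> by (intro add_mono mult_left_mono power_mono) (auto simp: a'_def b'_def)
  also have "\<dots> = (a' + b')\<^sup>2" using pos by (simp add: field_simps power2_eq_square)
  finally have "z\<^sup>2 \<le> (a' + b')\<^sup>2" .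
  then have "z \<le> a' + b'" by (rule power2_le_imp_le) (use pos in simp)
  then show "z \<le> a + b + \<delta>" by (simp add: a'_def b'_def)
qed

lemma sobolev_norm_nonneg: "0 \<le> sobolev_norm s \<gamma>"
  by (simp add: sobolev_norm_def)

lemma sobolev_norm_triangle:
  assumes x: "sob s x v" and y: "sob s y w"
  shows "sobolev_norm s (x + y) \<le> sobolev_norm s x + sobolev_norm s y"
proof (rule le_add_of_weighted_squares)
  fix e :: real assume e: "e > 0"
  have [measurable]: "x \<in> borel_measurable borel" "y \<in> borel_measurable borel"
      "v \<in> borel_measurable borel" "w \<in> borel_measurable borel"
    using sob_weak[OF x] sob_weak[OF y] has_weak_deriv_l2 l2_periodic_measurable by blast+
  have 1: "l2_sq (\<lambda>t. f t + g t) \<le> ennreal (1 + e) * l2_sq f + ennreal (1 + 1 / e) * l2_sq g"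
    if "f \<in> borel_measurable borel" "g \<in> borel_measurable borel" for f g :: "real \<Rightarrow> 'a"
    using that e norm_add_sq_weighted[OF e] by (intro l2_sq_linear_le) auto
  have "ennreal ((sobolev_norm s (x + y))\<^sup>2) = l2_sq (\<lambda>t. x t + y t) + l2_sq (\<lambda>t. v t + w t) + hs_sq s (\<lambda>t. v t + w t)"
    using sob_norm_sq[OF sob_add[OF x y]] by (simp add: plus_fun_def)
  also have "\<dots> \<le> (ennreal (1 + e) * l2_sq x + ennreal (1 + 1 / e) * l2_sq y)
      + (ennreal (1 + e) * l2_sq v + ennreal (1 + 1 / e) * l2_sq w)
      + (ennreal (1 + e) * hs_sq s v + ennreal (1 + 1 / e) * hs_sq s w)"
    using x y e by (intro add_mono 1 hs_regular_add) (auto simp: sob_def)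
  also have "\<dots> = ennreal (1 + e) * ennreal ((sobolev_norm s x)\<^sup>2) + ennreal (1 + 1 / e) * ennreal ((sobolev_norm s y)\<^sup>2)"
    unfolding sob_norm_sq[OF x] sob_norm_sq[OF y] by (simp add: distrib_left ac_simps)
  also have "\<dots> = ennreal ((1 + e) * (sobolev_norm s x)\<^sup>2 + (1 + 1 / e) * (sobolev_norm s y)\<^sup>2)"
    using e by (subst ennreal_plus) (auto simp: ennreal_mult)
  finally show "(sobolev_norm s (x + y))\<^sup>2 \<le> (1 + e) * (sobolev_norm s x)\<^sup>2 + (1 + 1 / e) * (sobolev_norm s y)\<^sup>2"
    using e by (subst (asm) ennreal_le_iff) auto
qed (rule sobolev_norm_nonneg)+

lemma sobolev_norm_scale_le:
  assumes x: "sob s x v"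
  shows "sobolev_norm s (c *\<^sub>R x) \<le> \<bar>c\<bar> * sobolev_norm s x"
proof (rule power2_le_imp_le)
  have [measurable]: "x \<in> borel_measurable borel" "v \<in> borel_measurable borel"
    using sob_weak[OF x] has_weak_deriv_l2 l2_periodic_measurable by blast+
  have 1: "l2_sq (\<lambda>t. c *\<^sub>R f t) \<le> ennreal (c\<^sup>2) * l2_sq f + ennreal 0 * l2_sq f"
    if "f \<in> borel_measurable borel" for f :: "real \<Rightarrow> 'a"
    using that by (intro l2_sq_linear_le) (auto simp: power_mult_distrib)
  have "ennreal ((sobolev_norm s (c *\<^sub>R x))\<^sup>2) = l2_sq (\<lambda>t. c *\<^sub>R x t) + l2_sq (\<lambda>t. c *\<^sub>R v t) + hs_sq s (\<lambda>t. c *\<^sub>R v t)"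
    using sob_norm_sq[OF sob_scaleR[OF x]] by (simp add: scaleR_fun_def)
  also have "\<dots> \<le> ennreal (c\<^sup>2) * l2_sq x + ennreal (c\<^sup>2) * l2_sq v + ennreal (c\<^sup>2) * hs_sq s v"
    using x 1[of x] 1[of v] by (intro add_mono hs_regular_scaleR) (auto simp: sob_def)
  also have "\<dots> = ennreal (c\<^sup>2) * ennreal ((sobolev_norm s x)\<^sup>2)"
    unfolding sob_norm_sq[OF x] by (simp add: distrib_left)
  also have "\<dots> = ennreal ((\<bar>c\<bar> * sobolev_norm s x)\<^sup>2)" by (simp add: power_mult_distrib flip: ennreal_mult)
  finally show "(sobolev_norm s (c *\<^sub>R x))\<^sup>2 \<le> (\<bar>c\<bar> * sobolev_norm s x)\<^sup>2"
    by (subst (asm) ennreal_le_iff) auto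
qed (simp add: sobolev_norm_nonneg)

lemma sobolev_norm_scale:
  assumes x: "sob s x v"
  shows "sobolev_norm s (c *\<^sub>R x) = \<bar>c\<bar> * sobolev_norm s x"
proof (rule antisym[OF sobolev_norm_scale_le[OF x]])
  show "\<bar>c\<bar> * sobolev_norm s x \<le> sobolev_norm s (c *\<^sub>R x)"
  proof (cases "c = 0")
    case False
    have "sobolev_norm s ((1 / c) *\<^sub>R c *\<^sub>R x) \<le> \<bar>1 / c\<bar> * sobolev_norm s (c *\<^sub>R x)"
      by (rule sobolev_norm_scale_le[OF sob_scaleR[OF x]])
    then show ?thesis using False by (simp add: field_simps)
  qed (simp add: sobolev_norm_nonneg)
qed

text \<open>The supremum of \<open>\<gamma>\<close> is at most its value at a suitable point, which the \<open>L\<^sup>2\<close> norm bounds, plus the supremum of its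
derivative.\<close>

lemma sob_bounds:
  assumes s: "1/2 < s" "s \<le> 1"
  shows "\<exists>C>0. \<forall>(\<gamma> :: real \<Rightarrow> 'a::euclidean_space) v. sob s \<gamma> v \<longrightarrow>
    hs_bd s v (C * sobolev_norm s \<gamma>) \<and> (\<forall>t. norm (\<gamma> t) \<le> C * sobolev_norm s \<gamma>)"
proof -
  obtain C where C: "C > 0" "\<And>(\<gamma> :: real \<Rightarrow> 'a) v \<Gamma> t. sob s \<gamma> v \<Longrightarrow> \<Gamma> > 0 \<Longrightarrow> l2_sq v \<le> ennreal (\<Gamma>\<^sup>2) \<Longrightarrow>
    hs_sq s v \<le> ennreal (\<Gamma>\<^sup>2) \<Longrightarrow> norm (v t) \<le> C * \<Gamma>"
    using sob_hs_embedding[OF s] by metis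
  show ?thesis
  proof (intro exI[of _ "C + 2"] conjI allI impI)
    fix \<gamma> v :: "real \<Rightarrow> 'a" assume sob: "sob s \<gamma> v"
    define N where "N = sobolev_norm s \<gamma>"
    have N0: "0 \<le> N" by (simp add: N_def sobolev_norm_nonneg)
    have parts: "l2_sq \<gamma> \<le> ennreal (N\<^sup>2)" "l2_sq v \<le> ennreal (N\<^sup>2)" "hs_sq s v \<le> ennreal (N\<^sup>2)"
      unfolding N_def sob_norm_sq[OF sob] by (auto simp: add_increasing add_increasing2)
    have v_le: "norm (v t) \<le> C * N" for t
    proof (rule field_le_epsilon)
      fix e :: real assume e: "e > 0"
      have "N\<^sup>2 \<le> (N + e / C)\<^sup>2" using N0 e C(1) by (intro power_mono) auto
      then have "norm (v t) \<le> C * (N + e / C)"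
        using parts N0 e C(1) by (intro C(2)[OF sob]) (auto intro: order_trans ennreal_leI add_nonneg_pos)
      then show "norm (v t) \<le> C * N + e" using C(1) by (simp add: distrib_left)
    qed
    have per: "periodic1 \<gamma>" and \<gamma>': "\<And>t. (\<gamma> has_vector_derivative v t) (at t)" using sob by (auto simp: sob_def)
    have \<gamma>_le: "norm (\<gamma> t) \<le> (C + 2) * N" if t: "t \<in> {0..1}" for t
    proof (rule field_le_epsilon)
      fix e :: real assume e: "e > 0"
      have "\<exists>\<tau>\<in>{0..1}. norm (\<gamma> \<tau>) \<le> N + e"
      proof (rule ccontr)
        assume "\<not> (\<exists>\<tau>\<in>{0..1}. norm (\<gamma> \<tau>) \<le> N + e)"
        then have big: "N + e < norm (\<gamma> \<tau>)" if "\<tau> \<in> {0..1}" for \<tau> using that by force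
        have "ennreal ((N + e)\<^sup>2) = (\<integral>\<^sup>+t. ennreal ((N + e)\<^sup>2) * indicator {0..1} (t::real) \<partial>lborel)"
          by (simp add: nn_integral_cmult_indicator)
        also have "\<dots> \<le> l2_sq \<gamma>"
          unfolding l2_sq_def using big N0 e
          by (intro nn_integral_mono) (auto simp: indicator_def intro!: ennreal_leI power_mono less_imp_le)
        finally have "(N + e)\<^sup>2 \<le> N\<^sup>2" using parts(1) by (metis ennreal_le_iff order_trans zero_le_power2)
        then have "N + e \<le> N" using N0 by (rule power2_le_imp_le)
        then show False using e by simp
      qed
      then obtain \<tau> where \<tau>: "\<tau> \<in> {0..1}" "norm (\<gamma> \<tau>) \<le> N + e" by blast
      have "norm (\<gamma> t - \<gamma> \<tau>) \<le> C * N * norm (t - \<tau>)"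
      proof (rule differentiable_bound[of "{0..1}" \<gamma> "\<lambda>t h. h *\<^sub>R v t"])
        show "(\<gamma> has_derivative (\<lambda>h. h *\<^sub>R v x)) (at x within {0..1})" for x
          using \<gamma>'[of x] by (simp add: has_vector_derivative_def has_derivative_at_withinI)
        show "onorm (\<lambda>h. h *\<^sub>R v x) \<le> C * N" for x
        proof (rule onorm_bound)
          show "norm (h *\<^sub>R v x) \<le> C * N * norm h" for h
            using mult_right_mono[OF v_le[of x], of "\<bar>h\<bar>"] by (simp add: mult.commute)
        qed (use C(1) N0 in simp)
      qed (use t \<tau> in auto)
      also have "\<dots> \<le> C * N * 1" using C(1) N0 t \<tau> by (intro mult_left_mono) auto
      finally have "norm (\<gamma> t) \<le> C * N + norm (\<gamma> \<tau>)"
        using norm_triangle_ineq[of "\<gamma> t - \<gamma> \<tau>" "\<gamma> \<tau>"] by simp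
      then show "norm (\<gamma> t) \<le> (C + 2) * N + e" using \<tau>(2) N0 by (simp add: algebra_simps)
    qed
    show "norm (\<gamma> t) \<le> (C + 2) * sobolev_norm s \<gamma>" for t
      using \<gamma>_le[OF frac_in_unit[of t]] by (simp add: periodic1_frac[OF per] N_def)
    have "N\<^sup>2 \<le> ((C + 2) * N)\<^sup>2"
      using C(1) N0 mult_right_mono[of 1 "C + 2" N] by (intro power_mono) auto
    then have "hs_sq s v \<le> ennreal (((C + 2) * N)\<^sup>2)" using parts(3) by (meson ennreal_leI order_trans)
    moreover have "norm (v t) \<le> (C + 2) * N" for t using v_le[of t] N0 by (simp add: distrib_right)
    ultimately show "hs_bd s v ((C + 2) * sobolev_norm s \<gamma>)" using sob by (simp add: hs_bd_def sob_def N_def)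
  qed (use C(1) in simp)
qed

section \<open>Completeness\<close>

lemma nn_integral_le_of_liminf:
  assumes meas: "\<And>m::nat. F m \<in> borel_measurable M"
    and lim: "AE x in M. (\<lambda>m. F m x) \<longlonglongrightarrow> f x"
    and le: "\<And>m. m \<ge> K \<Longrightarrow> (\<integral>\<^sup>+x. F m x \<partial>M) \<le> c"
  shows "(\<integral>\<^sup>+x. f x \<partial>M) \<le> (c :: ennreal)"
proof -
  have "(\<integral>\<^sup>+x. f x \<partial>M) = (\<integral>\<^sup>+x. liminf (\<lambda>m. F m x) \<partial>M)"
    using lim by (intro nn_integral_cong_AE) (auto elim!: eventually_mono simp: lim_imp_Liminf)
  also have "\<dots> \<le> liminf (\<lambda>m. \<integral>\<^sup>+x. F m x \<partial>M)" by (intro nn_integral_liminf meas)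
  also have "\<dots> \<le> liminf (\<lambda>m. c)"
    by (intro Liminf_mono eventually_mono[OF eventually_ge_at_top[of K]] le)
  also have "\<dots> = c" by (simp add: Liminf_const)
  finally show ?thesis .
qed

lemma l2_sq_limit_le:
  fixes F :: "nat \<Rightarrow> real \<Rightarrow> 'a::euclidean_space"
  assumes [measurable]: "\<And>m. F m \<in> borel_measurable borel"
    and lim: "AE t in lborel. t \<in> {0..1} \<longrightarrow> (\<lambda>m. F m t) \<longlonglongrightarrow> f t"
    and le: "\<And>m. m \<ge> K \<Longrightarrow> l2_sq (F m) \<le> c"
  shows "l2_sq f \<le> c"
  unfolding l2_sq_def
proof (rule nn_integral_le_of_liminf[where K = K])
  show "AE t in lborel. (\<lambda>m. ennreal ((norm (F m t))\<^sup>2) * indicator {0..1} t) \<longlonglongrightarrow> ennreal ((norm (f t))\<^sup>2) * indicator {0..1} t"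
    using lim
  proof eventually_elim
    case (elim t)
    show ?case
    proof (cases "t \<in> {0..1}")
      case True
      then have "(\<lambda>m. ennreal ((norm (F m t))\<^sup>2)) \<longlonglongrightarrow> ennreal ((norm (f t))\<^sup>2)"
        using elim by (intro tendsto_ennrealI tendsto_power tendsto_norm) auto
      then show ?thesis using True by simp
    qed simp
  qed
qed (use le in \<open>auto simp: l2_sq_def\<close>)

text \<open>Fatou's lemma, applied once to the Gagliardo integral as an integral over the plane.\<close>

lemma gagliardo_sq_limit_le:
  fixes F :: "nat \<Rightarrow> real \<Rightarrow> 'a::euclidean_space"
  assumes [measurable]: "\<And>m. F m \<in> borel_measurable borel"
    and lim: "\<And>t. (\<lambda>m. F m t) \<longlonglongrightarrow> f t"
    and le: "\<And>m. m \<ge> K \<Longrightarrow> gagliardo_sq s (F m) \<le> c"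
  shows "gagliardo_sq s f \<le> c"
proof -
  define I where "I g z = ennreal ((norm (g (fst z + snd z) - g (fst z)))\<^sup>2 / \<bar>snd z\<bar> powr (1 + 2 * s))
      * indicator {-1/2..1/2} (snd z) * indicator {0..1::real} (fst z)" for g :: "real \<Rightarrow> 'a" and z :: "real \<times> real"
  have gag: "gagliardo_sq s g = (\<integral>\<^sup>+z. I g z \<partial>(lborel \<Otimes>\<^sub>M lborel))" if [measurable]: "g \<in> borel_measurable borel" for g :: "real \<Rightarrow> 'a"
  proof -
    have [measurable]: "I g \<in> borel_measurable (lborel \<Otimes>\<^sub>M lborel)" unfolding I_def by measurable
    have "(\<integral>\<^sup>+z. I g z \<partial>(lborel \<Otimes>\<^sub>M lborel)) = (\<integral>\<^sup>+u. \<integral>\<^sup>+w. I g (u, w) \<partial>lborel \<partial>lborel)"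
      by (rule lborel.nn_integral_fst[symmetric]) measurable
    also have "\<dots> = gagliardo_sq s g"
      unfolding gagliardo_sq_def I_def by (intro nn_integral_cong) (simp add: nn_integral_multc)
    finally show ?thesis by simp
  qed
  have fm: "f \<in> borel_measurable borel"
    by (rule borel_measurable_LIMSEQ_metric[of F]) (use lim in auto)
  have Im: "I (F m) \<in> borel_measurable (lborel \<Otimes>\<^sub>M lborel)" for m unfolding I_def by measurable
  show ?thesis
    unfolding gag[OF fm]
  proof (rule nn_integral_le_of_liminf[where K = K, OF Im])
    have "(\<lambda>m. I (F m) z) \<longlonglongrightarrow> I f z" for z
    proof (cases "snd z = 0 \<or> snd z \<notin> {-1/2..1/2} \<or> fst z \<notin> {0..1}")
      case False
      have "(\<lambda>m. ennreal ((norm (F m (fst z + snd z) - F m (fst z)))\<^sup>2 / \<bar>snd z\<bar> powr (1 + 2 * s)))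
          \<longlonglongrightarrow> ennreal ((norm (f (fst z + snd z) - f (fst z)))\<^sup>2 / \<bar>snd z\<bar> powr (1 + 2 * s))"
        using False by (intro tendsto_ennrealI tendsto_divide tendsto_power tendsto_norm tendsto_diff lim tendsto_const) auto
      then show ?thesis using False by (simp add: I_def)
    qed (auto simp: I_def)
    then show "AE z in lborel \<Otimes>\<^sub>M lborel. (\<lambda>m. I (F m) z) \<longlonglongrightarrow> I f z" by simp
    show "(\<integral>\<^sup>+z. I (F m) z \<partial>(lborel \<Otimes>\<^sub>M lborel)) \<le> c" if "m \<ge> K" for m
      using le[OF that] gag[of "F m"] by simp
  qed
qed

text \<open>A subsequence with summable successive distances converges almost everywhere, and by Fatou's lemma
  its pointwise limit is the limit in the mean of the whole sequence.\<close>

theorem l2_complete: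
  fixes H :: "nat \<Rightarrow> real \<Rightarrow> 'a::euclidean_space"
  assumes l2: "\<And>n. H n \<in> l2_periodic"
    and cauchy: "\<And>e. e > 0 \<Longrightarrow> \<exists>M. \<forall>m\<ge>M. \<forall>n\<ge>M. l2_sq (\<lambda>t. H m t - H n t) \<le> ennreal (e\<^sup>2)"
  shows "\<exists>h. h \<in> l2_periodic \<and> (\<forall>e>0. \<exists>M. \<forall>n\<ge>M. l2_sq (\<lambda>t. H n t - h t) \<le> ennreal (e\<^sup>2))"
proof -
  have [measurable]: "H n \<in> borel_measurable borel" for n using l2 by (simp add: l2_periodic_def)
  obtain M where M: "\<And>j m n. M j \<le> m \<Longrightarrow> M j \<le> n \<Longrightarrow> l2_sq (\<lambda>t. H m t - H n t) \<le> ennreal (((1/2) ^ j)\<^sup>2)"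
    using cauchy[of "(1/2) ^ j" for j] by (metis zero_less_divide_1_iff zero_less_numeral zero_less_power)
  define k :: "nat \<Rightarrow> nat" where "k j = (\<Sum>i\<le>j. M i)" for j
  have k_ge: "M j \<le> k j" for j unfolding k_def by (rule member_le_sum) auto
  have k_step: "k j \<le> k (Suc j)" for j by (simp add: k_def)
  have k_mono: "k i \<le> k j" if "i \<le> j" for i j using k_step that by (rule lift_Suc_mono_le)
  define d where "d j t = H (k (Suc j)) t - H (k j) t" for j t
  have [measurable]: "d j \<in> borel_measurable borel" for j unfolding d_def by measurable
  have d_le: "(\<integral>\<^sup>+t. ennreal (norm (d j t)) * indicator {0..1} t \<partial>lborel) \<le> ennreal ((1/2) ^ j)" for j
    unfolding d_def using M[of j "k (Suc j)" "k j"] k_ge[of j] k_step[of j]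
    by (intro l1_le_of_l2_sq) auto
  have "(\<integral>\<^sup>+t. (\<Sum>j. ennreal (norm (d j t)) * indicator {0..1} t) \<partial>lborel)
      = (\<Sum>j. \<integral>\<^sup>+t. ennreal (norm (d j t)) * indicator {0..1} t \<partial>lborel)"
    by (intro nn_integral_suminf) auto
  also have "\<dots> \<le> (\<Sum>j. ennreal ((1/2) ^ j))" by (intro suminf_le d_le) auto
  also have "\<dots> = ennreal (\<Sum>j. (1/2) ^ j)" by (rule suminf_ennreal2) (auto intro: summable_geometric)
  also have "\<dots> < \<infinity>" by simp
  finally have "AE t in lborel. (\<Sum>j. ennreal (norm (d j t)) * indicator {0..1} t) \<noteq> \<infinity>"
    by (intro nn_integral_PInf_AE) (auto simp: less_top)
  then have conv: "AE t in lborel. t \<in> {0..1} \<longrightarrow> convergent (\<lambda>j. H (k j) t)"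
  proof eventually_elim
    case (elim t)
    show ?case
    proof
      assume "t \<in> {0..1}"
      then have "(\<Sum>j. ennreal (norm (d j t))) \<noteq> top" using elim by simp
      then have "summable (\<lambda>j. norm (d j t))" by (intro summable_suminf_not_top) auto
      then have "summable (\<lambda>j. d j t)" by (rule summable_norm_cancel)
      then have "convergent (\<lambda>n. \<Sum>j<n. d j t)" by (simp add: summable_iff_convergent)
      then have "convergent (\<lambda>n. H (k 0) t + (\<Sum>j<n. d j t))" by (intro convergent_add convergent_const)
      moreover have "H (k 0) t + (\<Sum>j<n. d j t) = H (k n) t" for n
        by (induction n) (simp_all add: d_def algebra_simps)
      ultimately show "convergent (\<lambda>j. H (k j) t)" by simp
    qed
  qed
  define h where "h t = lim (\<lambda>j. H (k j) t)" for t
  have hm [measurable]: "h \<in> borel_measurable borel" unfolding h_def by measurable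
  have close: "l2_sq (\<lambda>t. H n t - h t) \<le> ennreal (((1/2) ^ j)\<^sup>2)" if n: "n \<ge> k j" for n j
  proof (rule l2_sq_limit_le[where F = "\<lambda>i t. H n t - H (k i) t" and K = j])
    show "AE t in lborel. t \<in> {0..1} \<longrightarrow> (\<lambda>i. H n t - H (k i) t) \<longlonglongrightarrow> H n t - h t"
      using conv unfolding h_def by eventually_elim (auto intro!: tendsto_diff simp: convergent_LIMSEQ_iff)
    show "l2_sq (\<lambda>t. H n t - H (k i) t) \<le> ennreal (((1/2) ^ j)\<^sup>2)" if "i \<ge> j" for i
      using M[of j n "k i"] n k_ge[of j] k_mono[OF that] by simp
  qed measurable
  have per: "periodic1 h" unfolding h_def periodic1_def using l2 by (simp add: l2_periodic_def periodic1_def)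
  have "l2_sq (\<lambda>t. H (k 0) t - h t) \<le> ennreal (((1/2) ^ 0)\<^sup>2)" by (rule close) simp
  then have "l2_sq (\<lambda>t. H (k 0) t - h t) < \<infinity>" using ennreal_less_top le_less_trans unfolding infinity_ennreal_def by blast
  then have "(\<lambda>t. H (k 0) t - h t) \<in> l2_periodic"
    using per l2[of "k 0"] by (auto simp: l2_periodic_def periodic1_def)
  from l2_periodic_diff[OF l2[of "k 0"] this] have "h \<in> l2_periodic" by simp
  moreover have "\<exists>M. \<forall>n\<ge>M. l2_sq (\<lambda>t. H n t - h t) \<le> ennreal (e\<^sup>2)" if e: "e > 0" for e :: real
  proof -
    obtain j where j: "(1/2 :: real) ^ j < e" using real_arch_pow_inv[OF e, of "1/2"] by auto
    have "((1/2 :: real) ^ j)\<^sup>2 \<le> e\<^sup>2" using j by (intro power_mono) auto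
    then show ?thesis using close[of j] by (intro exI[of _ "k j"]) (auto intro: order_trans ennreal_leI)
  qed
  ultimately show ?thesis by blast
qed

lemma uniform_limit_of_derivatives:
  fixes X V :: "nat \<Rightarrow> real \<Rightarrow> 'a::euclidean_space"
  assumes D: "\<And>n t. (X n has_vector_derivative V n t) (at t)"
    and X: "\<And>t. (\<lambda>n. X n t) \<longlonglongrightarrow> \<gamma> t" and V: "uniform_limit UNIV V v sequentially"
  shows "(\<gamma> has_vector_derivative v t) (at t)"
proof -
  have "\<exists>G. \<forall>t\<in>UNIV. (\<lambda>k. X k t) \<longlonglongrightarrow> G t \<and> (G has_derivative (\<lambda>h. h *\<^sub>R v t)) (at t within UNIV)"
  proof (rule has_derivative_sequence[OF convex_UNIV, where f' = "\<lambda>k t h. h *\<^sub>R V k t"])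
    show "(X k has_derivative (\<lambda>h. h *\<^sub>R V k t)) (at t within UNIV)" for k t
      using D[of k t] by (simp add: has_vector_derivative_def)
    show "\<forall>\<^sub>F k in sequentially. \<forall>t\<in>UNIV. \<forall>h. norm (h *\<^sub>R V k t - h *\<^sub>R v t) \<le> e * norm h" if "e > 0" for e
      using uniform_limitD[OF V that]
    proof eventually_elim
      case (elim k)
      have "norm (h *\<^sub>R V k t - h *\<^sub>R v t) \<le> e * norm h" for t h
      proof -
        have "norm (h *\<^sub>R V k t - h *\<^sub>R v t) = \<bar>h\<bar> * dist (V k t) (v t)"
          by (simp add: dist_norm flip: scaleR_diff_right)
        also have "\<dots> \<le> \<bar>h\<bar> * e" using elim by (intro mult_left_mono) (auto intro: less_imp_le)
        finally show ?thesis by (simp add: mult.commute)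
      qed
      then show ?case by blast
    qed
  qed (use X in auto)
  then obtain G where G: "\<And>t. (\<lambda>k. X k t) \<longlonglongrightarrow> G t" "\<And>t. (G has_derivative (\<lambda>h. h *\<^sub>R v t)) (at t)"
    by auto
  have "G = \<gamma>" using G(1) X LIMSEQ_unique by blast
  then show ?thesis using G(2) by (simp add: has_vector_derivative_def)
qed

text \<open>For \<open>s < 1\<close> Fatou's lemma bounds the seminorm of \<open>V n - v\<close> by that of the differences \<open>V n - V m\<close>.  For \<open>s = 1\<close> the weak
derivatives converge in \<open>L\<^sup>2\<close>, and the limit \<open>v\<close> is the indefinite integral of their limit.\<close>

lemma hs_closed:
  fixes V :: "nat \<Rightarrow> real \<Rightarrow> 'a::euclidean_space"
  assumes reg: "\<And>n. hs_regular s (V n)"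
    and lim: "\<And>t. (\<lambda>n. V n t) \<longlonglongrightarrow> v t" and v: "continuous_on UNIV v" "periodic1 v"
    and cauchy: "\<And>e. e > 0 \<Longrightarrow> \<exists>M. \<forall>m\<ge>M. \<forall>n\<ge>M. hs_sq s (\<lambda>t. V m t - V n t) \<le> ennreal (e\<^sup>2)"
  shows "hs_regular s v" and "\<And>e. e > 0 \<Longrightarrow> \<exists>M. \<forall>n\<ge>M. hs_sq s (\<lambda>t. V n t - v t) \<le> ennreal (e\<^sup>2)"
proof -
  have Vc: "continuous_on UNIV (V n)" "periodic1 (V n)" for n using reg by (auto simp: hs_regular_def)
  have Vm [measurable]: "V n \<in> borel_measurable borel" for n by (rule borel_measurable_continuous_onI[OF Vc(1)])
  have "hs_regular s v \<and> (\<forall>e>0. \<exists>M. \<forall>n\<ge>M. hs_sq s (\<lambda>t. V n t - v t) \<le> ennreal (e\<^sup>2))"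
  proof (cases "s < 1")
    case True
    have close: "\<exists>M. \<forall>n\<ge>M. gagliardo_sq s (\<lambda>t. V n t - v t) \<le> ennreal (e\<^sup>2)" if e: "e > 0" for e
    proof -
      obtain M where M: "\<And>m n. m \<ge> M \<Longrightarrow> n \<ge> M \<Longrightarrow> hs_sq s (\<lambda>t. V m t - V n t) \<le> ennreal (e\<^sup>2)"
        using cauchy[OF e] by blast
      have "gagliardo_sq s (\<lambda>t. V n t - v t) \<le> ennreal (e\<^sup>2)" if "n \<ge> M" for n
      proof (rule gagliardo_sq_limit_le[where F = "\<lambda>m t. V n t - V m t" and K = M])
        show "gagliardo_sq s (\<lambda>t. V n t - V m t) \<le> ennreal (e\<^sup>2)" if "m \<ge> M" for m
          using M[OF \<open>n \<ge> M\<close> that] True by (simp add: hs_sq_def)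
      qed (auto intro!: tendsto_diff lim)
      then show ?thesis by blast
    qed
    obtain M where M: "gagliardo_sq s (\<lambda>t. V M t - v t) \<le> ennreal (1\<^sup>2)" using close[of 1] by auto
    have "hs_regular s (\<lambda>t. V M t - v t)"
      using le_less_trans[OF M ennreal_less_top] True Vc v
      by (auto simp: hs_regular_def periodic1_def intro!: continuous_intros)
    from hs_regular_add(1)[OF reg[of M] hs_regular_scaleR(1)[OF this, of "-1"], of 1]
    have "hs_regular s v" by simp
    then show ?thesis using close True by (simp add: hs_sq_def)
  next
    case False
    have "\<forall>n. \<exists>h. has_weak_deriv (V n) h" using reg False by (simp add: hs_regular_def)
    then obtain H where H: "\<And>n. has_weak_deriv (V n) (H n)" by metis
    have Hl: "H n \<in> l2_periodic" for n by (rule has_weak_deriv_l2(2)[OF H])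
    have HV: "hs_sq s (\<lambda>t. V m t - V n t) = l2_sq (\<lambda>t. H m t - H n t)" for m n
      by (rule hs_sq_weak[OF False has_weak_deriv_diff[OF H H]])
    obtain h where h: "h \<in> l2_periodic" "\<And>e. e > 0 \<Longrightarrow> \<exists>M. \<forall>n\<ge>M. l2_sq (\<lambda>t. H n t - h t) \<le> ennreal (e\<^sup>2)"
      using l2_complete[OF Hl cauchy[unfolded HV]] by blast
    have wv: "has_weak_deriv v h"
    proof (rule has_weak_deriv_primitive[OF v h(1)])
      fix t :: real assume t: "t \<in> {0..1}"
      have int: "set_integrable lborel {0..t} f" if "f \<in> l2_periodic" for f :: "real \<Rightarrow> 'a"
        by (rule set_integrable_subset[OF l2_integrable[OF that]]) (use t in auto)
      have "(\<lambda>n. LINT u:{0..t}|lborel. H n u) \<longlonglongrightarrow> (LINT u:{0..t}|lborel. h u)"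
      proof (rule LIMSEQ_I)
        fix e :: real assume e: "e > 0"
        obtain M where M: "\<And>n. n \<ge> M \<Longrightarrow> l2_sq (\<lambda>t. H n t - h t) \<le> ennreal ((e / 2)\<^sup>2)" using h(2)[of "e / 2"] e by auto
        have "norm ((LINT u:{0..t}|lborel. H n u) - (LINT u:{0..t}|lborel. h u)) < e" if "n \<ge> M" for n
        proof -
          have l: "(\<lambda>u. H n u - h u) \<in> l2_periodic" by (rule l2_periodic_diff[OF Hl h(1)])
          have "ennreal (norm (LINT u:{0..t}|lborel. H n u - h u)) \<le> (\<integral>\<^sup>+u. ennreal (norm (H n u - h u)) * indicator {0..1} u \<partial>lborel)"
            using t by (intro norm_set_integral_le int l) auto
          also have "\<dots> \<le> ennreal (e / 2)"
            by (rule l1_le_of_l2_sq[OF l2_periodic_measurable[OF l] _ M[OF that]]) (use e in simp)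
          finally have "norm (LINT u:{0..t}|lborel. H n u - h u) \<le> e / 2" using e by (subst (asm) ennreal_le_iff) auto
          then show ?thesis using set_integral_diff(2)[OF int[OF Hl] int[OF h(1)], of n] e by simp
        qed
        then show "\<exists>M. \<forall>n\<ge>M. norm ((LINT u:{0..t}|lborel. H n u) - (LINT u:{0..t}|lborel. h u)) < e" by blast
      qed
      then have "(\<lambda>n. V n 0 + (LINT u:{0..t}|lborel. H n u)) \<longlonglongrightarrow> v 0 + (LINT u:{0..t}|lborel. h u)"
        by (intro tendsto_add lim)
      then have "(\<lambda>n. V n t) \<longlonglongrightarrow> v 0 + (LINT u:{0..t}|lborel. h u)"
        unfolding primitive_of_weak_deriv[OF Vc(1) H t, symmetric] .
      then show "v t = v 0 + (LINT u:{0..t}|lborel. h u)" using lim LIMSEQ_unique by blast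
    qed
    have "hs_sq s (\<lambda>t. V n t - v t) = l2_sq (\<lambda>t. H n t - h t)" for n
      by (rule hs_sq_weak[OF False has_weak_deriv_diff[OF H wv]])
    then show ?thesis using wv h(2) v False by (auto simp: hs_regular_def)
  qed
  then show "hs_regular s v" and "\<And>e. e > 0 \<Longrightarrow> \<exists>M. \<forall>n\<ge>M. hs_sq s (\<lambda>t. V n t - v t) \<le> ennreal (e\<^sup>2)"
    by blast+
qed

lemma uniformly_Cauchy_limit:
  fixes F :: "nat \<Rightarrow> real \<Rightarrow> 'a::banach"
  assumes "\<And>e. e > 0 \<Longrightarrow> \<exists>M. \<forall>m\<ge>M. \<forall>n\<ge>M. \<forall>t. norm (F m t - F n t) < e"
  obtains f where "uniform_limit UNIV F f sequentially" "\<And>t. (\<lambda>n. F n t) \<longlonglongrightarrow> f t"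
proof -
  have "uniformly_Cauchy_on UNIV F"
    using assms unfolding uniformly_Cauchy_on_def dist_norm by blast
  then obtain f where f: "uniform_limit UNIV F f sequentially"
    using Cauchy_uniformly_convergent unfolding uniformly_convergent_on_def by blast
  then show ?thesis using that tendsto_uniform_limitI[OF f] by blast
qed

lemma weak_deriv_minus:
  fixes f g :: "real \<Rightarrow> 'a::euclidean_space"
  shows "has_weak_deriv (\<lambda>t. - f t) g \<longleftrightarrow> has_weak_deriv f (\<lambda>t. - g t)"
  using has_weak_deriv_scaleR[of "\<lambda>t. - f t" g "-1"] has_weak_deriv_scaleR[of f "\<lambda>t. - g t" "-1"] by auto

lemma l2_sq_weak_deriv_minus:
  fixes f f' :: "real \<Rightarrow> 'a::euclidean_space"
  assumes iff: "\<And>g. has_weak_deriv f' g \<longleftrightarrow> has_weak_deriv f (\<lambda>t. - g t)"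
  shows "l2_sq (weak_deriv f') = l2_sq (weak_deriv f)"
proof (cases "\<exists>g. has_weak_deriv f g")
  case True
  then obtain g where g: "has_weak_deriv f g" ..
  then have "has_weak_deriv f' (\<lambda>t. - g t)" by (simp add: iff)
  then have "l2_sq (weak_deriv f') = l2_sq (\<lambda>t. - g t)" by (rule l2_sq_weak_deriv)
  also have "\<dots> = l2_sq (weak_deriv f)" using l2_sq_weak_deriv[OF g] by (simp add: l2_sq_def)
  finally show ?thesis .
next
  case False
  then have "has_weak_deriv f' = has_weak_deriv f" by (auto simp: iff fun_eq_iff)
  then show ?thesis by (simp add: weak_deriv_def)
qed

text \<open>The equation is needed for all functions, even for those without weak derivatives.  For them the choice in \<open>weak_deriv\<close>
is made from the empty predicate and gives the same result for \<open>\<gamma>\<close> and \<open>- \<gamma>\<close>.\<close>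

lemma sobolev_norm_minus: "sobolev_norm s (- \<gamma>) = sobolev_norm s \<gamma>"
  for \<gamma> :: "real \<Rightarrow> 'a::euclidean_space"
proof -
  have m: "- \<gamma> = (\<lambda>t. - \<gamma> t)" by (simp add: fun_Compl_def)
  note iff = weak_deriv_minus[of \<gamma>, folded m]
  have 1: "l2_sq (- \<gamma>) = l2_sq \<gamma>" unfolding m by (simp add: l2_sq_def)
  have 2: "l2_sq (weak_deriv (- \<gamma>)) = l2_sq (weak_deriv \<gamma>)" by (rule l2_sq_weak_deriv_minus[OF iff])
  have 3: "gagliardo_sq s (weak_deriv (- \<gamma>)) = gagliardo_sq s (weak_deriv \<gamma>) \<and>
      l2_sq (weak_deriv (weak_deriv (- \<gamma>))) = l2_sq (weak_deriv (weak_deriv \<gamma>))"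
  proof (cases "\<exists>g. has_weak_deriv \<gamma> g")
    case True
    then obtain g where "has_weak_deriv \<gamma> g" ..
    note w = has_weak_deriv_weak_deriv[OF this]
    have w': "has_weak_deriv (- \<gamma>) (\<lambda>t. - weak_deriv \<gamma> t)" using w by (simp add: iff)
    note w'' = has_weak_deriv_weak_deriv[OF w']
    note l = has_weak_deriv_l2(2)[OF w'] has_weak_deriv_l2(2)[OF w'']
    have ae: "AE t in lborel. t \<in> {0..1} \<longrightarrow> weak_deriv (- \<gamma>) t = - weak_deriv \<gamma> t"
      by (rule weak_deriv_unique[OF w'' w'])
    have ae': "AE t in lborel. t \<in> {0..1} \<longrightarrow> - weak_deriv \<gamma> t = weak_deriv (- \<gamma>) t"
      using ae by eventually_elim auto
    have "gagliardo_sq s (weak_deriv (- \<gamma>)) = gagliardo_sq s (\<lambda>t. - weak_deriv \<gamma> t)"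
      by (rule gagliardo_sq_cong_AE[OF l(2,1) ae])
    also have "\<dots> = gagliardo_sq s (weak_deriv \<gamma>)"
      unfolding gagliardo_sq_def by (simp add: norm_minus_commute)
    finally have gag: "gagliardo_sq s (weak_deriv (- \<gamma>)) = gagliardo_sq s (weak_deriv \<gamma>)" .
    have "has_weak_deriv (weak_deriv (- \<gamma>)) h \<longleftrightarrow> has_weak_deriv (\<lambda>t. - weak_deriv \<gamma> t) h" for h
    proof
      assume h: "has_weak_deriv (weak_deriv (- \<gamma>)) h"
      show "has_weak_deriv (\<lambda>t. - weak_deriv \<gamma> t) h"
        by (rule has_weak_deriv_cong_AE[OF h l(1) has_weak_deriv_l2(2)[OF h] ae]) simp
    next
      assume h: "has_weak_deriv (\<lambda>t. - weak_deriv \<gamma> t) h"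
      show "has_weak_deriv (weak_deriv (- \<gamma>)) h"
        by (rule has_weak_deriv_cong_AE[OF h l(2) has_weak_deriv_l2(2)[OF h] ae']) simp
    qed
    then have "l2_sq (weak_deriv (weak_deriv (- \<gamma>))) = l2_sq (weak_deriv (weak_deriv \<gamma>))"
      by (intro l2_sq_weak_deriv_minus) (simp add: weak_deriv_minus)
    with gag show ?thesis by simp
  next
    case False
    then have "has_weak_deriv (- \<gamma>) = has_weak_deriv \<gamma>" by (auto simp: iff fun_eq_iff)
    then show ?thesis by (simp add: weak_deriv_def[of "- \<gamma>"] weak_deriv_def[of \<gamma>])
  qed
  show ?thesis unfolding sobolev_norm_def 1 2 using 3 by simp
qed

text \<open>A Cauchy sequence converges uniformly together with its derivatives, by the embedding, and \<open>hs_closed\<close> upgrades the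
convergence of the derivatives.\<close>

theorem banach_sobolev_space:
  assumes s: "1/2 < s" "s \<le> 1"
  shows "banach_subspace (sobolev_space s :: (real \<Rightarrow> 'a::euclidean_space) set) (sobolev_norm s)"
proof -
  have ex: "\<exists>v. sob s x v" if "x \<in> sobolev_space s" for x :: "real \<Rightarrow> 'a"
    by (rule sobolev_space_imp_sob[OF s that])
  obtain C where C0: "C > 0" and bd: "\<forall>(x :: real \<Rightarrow> 'a) v. sob s x v \<longrightarrow>
      hs_bd s v (C * sobolev_norm s x) \<and> (\<forall>t. norm (x t) \<le> C * sobolev_norm s x)"
    using sob_bounds[OF s, where 'a = 'a] by blast
  have C: "C > 0" "\<And>(x :: real \<Rightarrow> 'a) v. sob s x v \<Longrightarrow> hs_bd s v (C * sobolev_norm s x)"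
    "\<And>(x :: real \<Rightarrow> 'a) v t. sob s x v \<Longrightarrow> norm (x t) \<le> C * sobolev_norm s x"
    by (rule C0, rule bd[rule_format, THEN conjunct1], assumption,
        rule bd[rule_format, THEN conjunct2, rule_format], assumption)
  have normed: "normed_subspace (sobolev_space s :: (real \<Rightarrow> 'a) set) (sobolev_norm s)"
  proof
    show "subspace (sobolev_space s :: (real \<Rightarrow> 'a) set)"
    proof (rule subspaceI)
      show "0 \<in> sobolev_space s" by (rule sob_imp_sobolev_space[OF sob_0])
      show "x + y \<in> sobolev_space s" if "x \<in> sobolev_space s" "y \<in> sobolev_space s" for x y :: "real \<Rightarrow> 'a"
        using ex[OF that(1)] ex[OF that(2)] by (elim exE) (rule sob_imp_sobolev_space[OF sob_add])
      show "c *\<^sub>R x \<in> sobolev_space s" if "x \<in> sobolev_space s" for x :: "real \<Rightarrow> 'a" and c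
        using ex[OF that] by (elim exE) (rule sob_imp_sobolev_space[OF sob_scaleR])
    qed
    show "sobolev_norm s (x + y) \<le> sobolev_norm s x + sobolev_norm s y"
      if "x \<in> sobolev_space s" "y \<in> sobolev_space s" for x y :: "real \<Rightarrow> 'a"
      using ex[OF that(1)] ex[OF that(2)] by (elim exE) (rule sobolev_norm_triangle)
    show "sobolev_norm s (c *\<^sub>R x) = \<bar>c\<bar> * sobolev_norm s x" if "x \<in> sobolev_space s" for x :: "real \<Rightarrow> 'a" and c
      using ex[OF that] by (elim exE) (rule sobolev_norm_scale)
    show "x = 0" if xE: "x \<in> sobolev_space s" and x0: "sobolev_norm s x = 0" for x :: "real \<Rightarrow> 'a"
    proof
      fix t
      obtain v where "sob s x v" using ex[OF xE] ..
      then have "norm (x t) \<le> 0" using C(3)[of x v t] x0 by simp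
      then show "x t = 0 t" by simp
    qed
  qed (simp_all add: sobolev_norm_nonneg sobolev_norm_minus)
  interpret normed_subspace "sobolev_space s :: (real \<Rightarrow> 'a) set" "sobolev_norm s" by (rule normed)
  show ?thesis
  proof
    fix X :: "nat \<Rightarrow> real \<Rightarrow> 'a"
    assume X: "\<And>n. X n \<in> sobolev_space s"
      and cauchy: "\<And>e. e > 0 \<Longrightarrow> \<exists>M. \<forall>m\<ge>M. \<forall>n\<ge>M. sobolev_norm s (X m - X n) < e"
    obtain V where V: "\<And>n. sob s (X n) (V n)" using ex[OF X] by metis
    have d: "sob s (X m - X n) (\<lambda>t. V m t - V n t)" for m n by (rule sob_diff[OF V V])
    have unif: "\<exists>M. \<forall>m\<ge>M. \<forall>n\<ge>M. \<forall>t. norm (X m t - X n t) < e \<and> norm (V m t - V n t) < e" if e: "e > 0" for e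
    proof -
      obtain M where M: "\<And>m n. m \<ge> M \<Longrightarrow> n \<ge> M \<Longrightarrow> sobolev_norm s (X m - X n) < e / C"
        using cauchy[of "e / C"] e C(1) by auto
      have "norm (X m t - X n t) < e \<and> norm (V m t - V n t) < e" if "m \<ge> M" "n \<ge> M" for m n t
      proof -
        have "C * sobolev_norm s (X m - X n) < e" using M[OF that] C(1) by (simp add: field_simps)
        moreover have "norm (X m t - X n t) \<le> C * sobolev_norm s (X m - X n)" using C(3)[OF d[of m n], of t] by simp
        moreover have "norm (V m t - V n t) \<le> C * sobolev_norm s (X m - X n)" using C(2)[OF d[of m n]] by (simp add: hs_bd_def)
        ultimately show ?thesis by linarith
      qed
      then show ?thesis by blast
    qed
    have unifX: "\<exists>M. \<forall>m\<ge>M. \<forall>n\<ge>M. \<forall>t. norm (X m t - X n t) < e"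
      and unifV: "\<exists>M. \<forall>m\<ge>M. \<forall>n\<ge>M. \<forall>t. norm (V m t - V n t) < e" if "e > 0" for e
      using unif[OF that] by blast+
    obtain x where x: "uniform_limit UNIV X x sequentially" "\<And>t. (\<lambda>n. X n t) \<longlonglongrightarrow> x t"
      using uniformly_Cauchy_limit[of X, OF unifX] by blast
    obtain v where v: "uniform_limit UNIV V v sequentially" "\<And>t. (\<lambda>n. V n t) \<longlonglongrightarrow> v t"
      using uniformly_Cauchy_limit[of V, OF unifV] by blast
    have reg: "hs_regular s (V n)" "periodic1 (X n)" for n using V by (auto simp: sob_def)
    have v_cont: "continuous_on UNIV v"
      by (rule uniform_limit_theorem[OF _ v(1)]) (use reg in \<open>auto simp: hs_regular_def\<close>)
    have per: "periodic1 f" if "\<And>n. periodic1 (F n)" "\<And>t. (\<lambda>n. F n t) \<longlonglongrightarrow> f t" for F :: "nat \<Rightarrow> real \<Rightarrow> 'a" and f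
      unfolding periodic1_def
    proof
      fix t
      have "(\<lambda>n. F n t) \<longlonglongrightarrow> f (t + 1)" using that(2)[of "t + 1"] that(1) by (simp add: periodic1_def)
      then show "f (t + 1) = f t" using that(2)[of t] LIMSEQ_unique by blast
    qed
    have v_per: "periodic1 v" by (rule per[OF _ v(2)]) (use reg in \<open>simp add: hs_regular_def\<close>)
    have hs_cauchy: "\<exists>M. \<forall>m\<ge>M. \<forall>n\<ge>M. hs_sq s (\<lambda>t. V m t - V n t) \<le> ennreal (e\<^sup>2)" if e: "e > 0" for e
    proof -
      obtain M where M: "\<And>m n. m \<ge> M \<Longrightarrow> n \<ge> M \<Longrightarrow> sobolev_norm s (X m - X n) < e / C"
        using cauchy[of "e / C"] e C(1) by auto
      have "hs_sq s (\<lambda>t. V m t - V n t) \<le> ennreal (e\<^sup>2)" if "m \<ge> M" "n \<ge> M" for m n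
      proof -
        have "hs_bd s (\<lambda>t. V m t - V n t) e"
          by (rule hs_bd_mono[OF C(2)[OF d]]) (use M[OF that] C(1) in \<open>simp add: field_simps\<close>)
        then show ?thesis by (simp add: hs_bd_def)
      qed
      then show ?thesis by blast
    qed
    have lim: "hs_regular s v"
      by (rule hs_closed(1)[OF reg(1) v(2) v_cont v_per hs_cauchy])
    have lim_hs: "\<exists>M. \<forall>n\<ge>M. hs_sq s (\<lambda>t. V n t - v t) \<le> ennreal (e\<^sup>2)" if "e > 0" for e
      by (rule hs_closed(2)[OF reg(1) v(2) v_cont v_per], rule hs_cauchy, assumption, rule that)
    have D: "(x has_vector_derivative v t) (at t)" for t
      by (rule uniform_limit_of_derivatives[OF _ x(2) v(1)]) (use V in \<open>simp add: sob_def\<close>)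
    have sob_x: "sob s x v" using per[OF reg(2) x(2)] lim D by (simp add: sob_def)
    have "(\<lambda>n. sobolev_norm s (X n - x)) \<longlonglongrightarrow> 0"
    proof (rule LIMSEQ_I)
      fix e :: real assume e: "e > 0"
      define \<delta> where "\<delta> = e / 2"
      have \<delta>: "\<delta> > 0" using e by (simp add: \<delta>_def)
      obtain M where M: "\<And>n. n \<ge> M \<Longrightarrow> hs_sq s (\<lambda>t. V n t - v t) \<le> ennreal (\<delta>\<^sup>2)" using lim_hs[OF \<delta>] by blast
      have "\<forall>\<^sub>F n in sequentially. (\<forall>t\<in>UNIV. dist (X n t) (x t) < \<delta>) \<and> (\<forall>t\<in>UNIV. dist (V n t) (v t) < \<delta>)"
        using uniform_limitD[OF x(1) \<delta>] uniform_limitD[OF v(1) \<delta>] by (rule eventually_conj)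
      then obtain M' where M': "\<And>n t. n \<ge> M' \<Longrightarrow> norm (X n t - x t) < \<delta> \<and> norm (V n t - v t) < \<delta>"
        unfolding eventually_sequentially dist_norm by blast
      have "norm (sobolev_norm s (X n - x) - 0) < e" if n: "n \<ge> max M M'" for n
      proof -
        have "ennreal ((sobolev_norm s (X n - x))\<^sup>2)
            = l2_sq (X n - x) + l2_sq (\<lambda>t. V n t - v t) + hs_sq s (\<lambda>t. V n t - v t)"
          by (rule sob_norm_sq[OF sob_diff[OF V sob_x]])
        also have "\<dots> \<le> ennreal (\<delta>\<^sup>2) + ennreal (\<delta>\<^sup>2) + ennreal (\<delta>\<^sup>2)"
          using M[of n] M'[of n] n by (intro add_mono l2_sq_le) (auto intro: less_imp_le)
        also have "\<dots> = ennreal (3 * \<delta>\<^sup>2)" by (simp flip: ennreal_plus)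
        finally have "(sobolev_norm s (X n - x))\<^sup>2 \<le> 3 * \<delta>\<^sup>2" by (subst (asm) ennreal_le_iff) auto
        also have "\<dots> < e\<^sup>2" using e by (simp add: \<delta>_def power2_eq_square)
        finally have "sobolev_norm s (X n - x) < e" by (rule power2_less_imp_less) (use e in simp)
        then show ?thesis by (simp add: sobolev_norm_nonneg)
      qed
      then show "\<exists>M. \<forall>n\<ge>M. norm (sobolev_norm s (X n - x) - 0) < e" by blast
    qed
    then show "\<exists>x\<in>sobolev_space s. (\<lambda>n. sobolev_norm s (X n - x)) \<longlonglongrightarrow> 0"
      using sob_imp_sobolev_space[OF sob_x] by blast
  qed
qed

section \<open>Regular and injective curves\<close>

lemma sob_eqI:
  fixes x y :: "real \<Rightarrow> 'a::euclidean_space"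
  assumes "sob s x v" "sob s y v" "x 0 = y 0"
  shows "x = y"
proof
  fix t
  have "((\<lambda>t. x t - y t) has_vector_derivative v t - v t) (at t within UNIV)" for t
    by (rule has_vector_derivative_diff) (use assms in \<open>simp_all add: sob_def\<close>)
  then obtain c where c: "\<And>t. x t - y t = c"
    using has_vector_derivative_zero_constant[OF convex_UNIV, of "\<lambda>t. x t - y t"] by (metis UNIV_I diff_self)
  show "x t = y t" using c[of t] c[of 0] assms(3) by simp
qed

lemma sob_lipschitz:
  fixes x :: "real \<Rightarrow> 'a::euclidean_space"
  assumes sob: "sob s x v" and K: "\<And>t. norm (v t) \<le> K"
  shows "norm (x a - x b) \<le> K * \<bar>a - b\<bar>"
proof -
  have K0: "0 \<le> K" using K[of 0] norm_ge_zero order_trans by blast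
  have "norm (x a - x b) \<le> K * norm (a - b)"
  proof (rule differentiable_bound[of UNIV x "\<lambda>t h. h *\<^sub>R v t"])
    show "(x has_derivative (\<lambda>h. h *\<^sub>R v t)) (at t within UNIV)" for t
      using sob by (simp add: sob_def has_vector_derivative_def)
    show "onorm (\<lambda>h. h *\<^sub>R v t) \<le> K" for t
    proof (rule onorm_bound)
      show "norm (h *\<^sub>R v t) \<le> K * norm h" for h
        using mult_right_mono[OF K[of t], of "\<bar>h\<bar>"] by (simp add: mult.commute)
    qed (rule K0)
  qed auto
  then show ?thesis by simp
qed

lemma continuous_periodic_norm_bounded_below:
  fixes v :: "real \<Rightarrow> 'a::euclidean_space"
  assumes "continuous_on UNIV v" "periodic1 v" "\<And>t. norm (v t) > 0"
  obtains m where "m > 0" "\<And>t. m \<le> norm (v t)"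
proof -
  have "continuous_on {0..1} (\<lambda>t. norm (v t))" using assms(1) by (intro continuous_intros) (rule continuous_on_subset, auto)
  then obtain t0 where t0: "t0 \<in> {0..1}" "\<And>t. t \<in> {0..1} \<Longrightarrow> norm (v t0) \<le> norm (v t)"
    using continuous_attains_inf[of "{0..1::real}" "\<lambda>t. norm (v t)"] by auto
  have "norm (v t0) \<le> norm (v t)" for t
    using t0(2)[OF frac_in_unit[of t]] by (simp add: periodic1_frac[OF assms(2)])
  then show ?thesis using that assms(3) by blast
qed

lemma openin_regular_curves:
  assumes s: "1/2 < s" "s \<le> 1"
  shows "openin (norm_topology (sobolev_space s) (sobolev_norm s)) (regular_curves s :: (real \<Rightarrow> 'a::euclidean_space) set)"
proof -
  interpret banach_subspace "sobolev_space s :: (real \<Rightarrow> 'a) set" "sobolev_norm s" by (rule banach_sobolev_space[OF s])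
  obtain C where C0: "C > 0" and bd: "\<forall>(x :: real \<Rightarrow> 'a) v. sob s x v \<longrightarrow>
      hs_bd s v (C * sobolev_norm s x) \<and> (\<forall>t. norm (x t) \<le> C * sobolev_norm s x)"
    using sob_bounds[OF s, where 'a = 'a] by blast
  show ?thesis
    unfolding openin_norm_topology
  proof (intro conjI ballI)
    show "regular_curves s \<subseteq> (sobolev_space s :: (real \<Rightarrow> 'a) set)" by (auto simp: regular_curves_def)
    fix x :: "real \<Rightarrow> 'a" assume x: "x \<in> regular_curves s"
    then obtain v where v: "sob s x v" using sobolev_space_imp_sob[OF s] by (auto simp: regular_curves_def)
    have pos: "norm (v t) > 0" for t using x sob_vector_derivative[OF v] by (simp add: regular_curves_def)
    obtain m where m: "m > 0" "\<And>t. m \<le> norm (v t)"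
      using continuous_periodic_norm_bounded_below[of v] v pos by (auto simp: sob_def hs_regular_def)
    have "y \<in> regular_curves s" if y: "y \<in> sobolev_space s" "sobolev_norm s (y - x) < m / C" for y
    proof -
      obtain w where w: "sob s y w" using sobolev_space_imp_sob[OF s y(1)] ..
      have "norm (w t) > 0" for t
      proof -
        have "norm (w t - v t) \<le> C * sobolev_norm s (y - x)"
          using bd sob_diff[OF w v] by (auto simp: hs_bd_def)
        also have "\<dots> < m" using y(2) C0 by (simp add: field_simps)
        finally show ?thesis using m(2)[of t] by (auto simp: norm_minus_commute)
      qed
      then show ?thesis using y(1) sob_vector_derivative[OF w] by (simp add: regular_curves_def)
    qed
    then show "\<exists>r>0. \<forall>y\<in>sobolev_space s. sobolev_norm s (y - x) < r \<longrightarrow> y \<in> regular_curves s"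
      using m(1) C0 by (intro exI[of _ "m / C"]) auto
  qed
qed

text \<open>An injective regular closed curve is bi-Lipschitz: near the diagonal the derivative controls chords from
  below, and away from it compactness does.\<close>

lemma injective_regular_bilipschitz:
  fixes x :: "real \<Rightarrow> 'a::euclidean_space"
  assumes sob: "sob s x v" and pos: "\<And>t. norm (v t) > 0" and inj: "inj_on x {0..<1}"
  shows "\<exists>c>0. \<forall>t\<in>{0..1}. \<forall>w\<in>{-1/2..1/2}. c * \<bar>w\<bar> \<le> norm (x (t + w) - x t)"
proof -
  have v: "continuous_on UNIV v" "periodic1 v" and per: "periodic1 x" using sob by (auto simp: sob_def hs_regular_def)
  note xc = sob_continuous[OF sob]
  obtain m where m: "m > 0" "\<And>t. m \<le> norm (v t)"
    using continuous_periodic_norm_bounded_below[OF v pos] by blast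
  have "uniformly_continuous_on {-1..2} v"
    by (intro compact_uniformly_continuous continuous_on_subset[OF v(1)]) auto
  then obtain \<eta> where \<eta>: "\<eta> > 0" "\<And>a b. a \<in> {-1..2} \<Longrightarrow> b \<in> {-1..2} \<Longrightarrow> dist a b < \<eta> \<Longrightarrow> dist (v a) (v b) < m / 2"
    unfolding uniformly_continuous_on_def using m(1) by (meson half_gt_zero)
  have near: "m / 2 * \<bar>w\<bar> \<le> norm (x (t + w) - x t)" if t: "t \<in> {0..1}" and w: "\<bar>w\<bar> < \<eta>" "w \<in> {-1/2..1/2}" for t w
  proof -
    let ?S = "closed_segment t (t + w)"
    have S: "a \<in> {-1..2} \<and> dist a t < \<eta>" if "a \<in> ?S" for a
      using that t w by (auto simp: closed_segment_eq_real_ivl dist_real_def split: if_splits)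
    have "norm ((x (t + w) - (t + w) *\<^sub>R v t) - (x t - t *\<^sub>R v t)) \<le> m / 2 * norm (t + w - t)"
    proof (rule differentiable_bound[of ?S "\<lambda>a. x a - a *\<^sub>R v t" "\<lambda>a h. h *\<^sub>R (v a - v t)"])
      show "((\<lambda>a. x a - a *\<^sub>R v t) has_derivative (\<lambda>h. h *\<^sub>R (v a - v t))) (at a within ?S)" for a
      proof -
        have "(x has_derivative (\<lambda>h. h *\<^sub>R v a)) (at a within ?S)"
          using sob by (simp add: sob_def has_vector_derivative_def has_derivative_at_withinI)
        then have "((\<lambda>a. x a - a *\<^sub>R v t) has_derivative (\<lambda>h. h *\<^sub>R v a - h *\<^sub>R v t)) (at a within ?S)"
          by (rule has_derivative_diff[OF _ has_derivative_scaleR_left[OF has_derivative_ident]])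
        then show ?thesis by (simp add: scaleR_diff_right)
      qed
      show "onorm (\<lambda>h. h *\<^sub>R (v a - v t)) \<le> m / 2" if "a \<in> ?S" for a
      proof (rule onorm_bound)
        have "norm (v a - v t) \<le> m / 2"
          using \<eta>(2)[of a t] S[OF that] t by (auto simp: dist_norm)
        then show "norm (h *\<^sub>R (v a - v t)) \<le> m / 2 * norm h" for h
          using mult_right_mono[of "norm (v a - v t)" "m / 2" "\<bar>h\<bar>"] by (simp add: mult.commute)
      qed (use m in simp)
    qed auto
    then have "norm (x (t + w) - x t - w *\<^sub>R v t) \<le> m / 2 * \<bar>w\<bar>" by (simp add: algebra_simps)
    moreover have "norm (w *\<^sub>R v t) \<le> norm (x (t + w) - x t) + norm (x (t + w) - x t - w *\<^sub>R v t)"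
      using norm_triangle_ineq4[of "x (t + w) - x t" "x (t + w) - x t - w *\<^sub>R v t"] by simp
    moreover have "m * \<bar>w\<bar> \<le> norm (w *\<^sub>R v t)" using mult_right_mono[OF m(2)[of t], of "\<bar>w\<bar>"] by (simp add: mult.commute)
    ultimately show ?thesis by (simp add: field_simps)
  qed
  have ne: "norm (x (t + w) - x t) > 0" if w: "w \<noteq> 0" "w \<in> {-1/2..1/2}" for t w
  proof -
    have "x (t + w) \<noteq> x t"
    proof
      assume "x (t + w) = x t"
      then have "x (frac (t + w)) = x (frac t)" by (simp add: periodic1_frac[OF per])
      then have "frac (t + w) = frac t" using frac_lt_1 by (intro inj_onD[OF inj]) auto
      then have "w = of_int (floor (t + w) - floor t)" by (simp add: frac_def)
      moreover have "\<bar>w\<bar> < 1" using w by auto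
      ultimately have "floor (t + w) - floor t = 0" by linarith
      then show False using \<open>w = _\<close> w(1) by simp
    qed
    then show ?thesis by simp
  qed
  define A where "A = {-1/2..-\<eta>} \<union> {\<eta>..1/2}"
  have A: "compact ({0..1::real} \<times> A)" unfolding A_def by (intro compact_Times compact_Un compact_Icc)
  have "\<exists>m2>0. \<forall>z\<in>{0..1} \<times> A. m2 \<le> norm (x (fst z + snd z) - x (fst z))"
  proof (cases "A = {}")
    case False
    have nonempty: "{0..1::real} \<times> A \<noteq> {}" using False by simp
    have cont: "continuous_on ({0..1} \<times> A) (\<lambda>z. norm (x (fst z + snd z) - x (fst z)))"
      by (intro continuous_intros continuous_on_compose2[OF xc]) auto
    then obtain z0 where z0: "z0 \<in> {0..1} \<times> A" "\<forall>z\<in>{0..1} \<times> A. norm (x (fst z0 + snd z0) - x (fst z0)) \<le> norm (x (fst z + snd z) - x (fst z))"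
      using continuous_attains_inf[OF A nonempty cont] by blast
    have "norm (x (fst z0 + snd z0) - x (fst z0)) > 0" by (rule ne) (use z0(1) \<eta>(1) in \<open>auto simp: A_def\<close>)
    then show ?thesis using z0(2) by blast
  qed (auto intro: exI[of _ 1])
  then obtain m2 where m2: "m2 > 0" "\<And>t w. t \<in> {0..1} \<Longrightarrow> w \<in> A \<Longrightarrow> m2 \<le> norm (x (t + w) - x t)" by force
  show ?thesis
  proof (intro exI[of _ "min (m / 2) m2"] conjI ballI)
    fix t w :: real assume t: "t \<in> {0..1}" and w: "w \<in> {-1/2..1/2}"
    show "min (m / 2) m2 * \<bar>w\<bar> \<le> norm (x (t + w) - x t)"
    proof (cases "\<bar>w\<bar> < \<eta>")
      case True
      have "min (m / 2) m2 * \<bar>w\<bar> \<le> m / 2 * \<bar>w\<bar>" by (intro mult_right_mono) auto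
      then show ?thesis using near[OF t True w] by linarith
    next
      case False
      then have "w \<in> A" using w by (auto simp: A_def)
      have "min (m / 2) m2 * \<bar>w\<bar> \<le> m2 * 1" using m m2 w by (intro mult_mono) auto
      then show ?thesis using m2(2)[OF t \<open>w \<in> A\<close>] by linarith
    qed
  qed (use m m2 in auto)
qed

text \<open>A perturbation whose Lipschitz constant is smaller than the lower Lipschitz bound of the curve keeps it injective.\<close>

lemma openin_injective_regular_curves:
  assumes s: "1/2 < s" "s \<le> 1"
  shows "openin (norm_topology (sobolev_space s) (sobolev_norm s)) (injective_regular_curves s :: (real \<Rightarrow> 'a::euclidean_space) set)"
proof -
  interpret banach_subspace "sobolev_space s :: (real \<Rightarrow> 'a) set" "sobolev_norm s" by (rule banach_sobolev_space[OF s])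
  obtain C where C0: "C > 0" and bd: "\<forall>(x :: real \<Rightarrow> 'a) v. sob s x v \<longrightarrow>
      hs_bd s v (C * sobolev_norm s x) \<and> (\<forall>t. norm (x t) \<le> C * sobolev_norm s x)"
    using sob_bounds[OF s, where 'a = 'a] by blast
  show ?thesis
    unfolding openin_norm_topology
  proof (intro conjI ballI)
    show "injective_regular_curves s \<subseteq> (sobolev_space s :: (real \<Rightarrow> 'a) set)"
      by (auto simp: regular_curves_def injective_regular_curves_def)
    fix x :: "real \<Rightarrow> 'a" assume x: "x \<in> injective_regular_curves s"
    then have xr: "x \<in> regular_curves s" and inj: "inj_on x {0..<1}" by (auto simp: injective_regular_curves_def)
    then obtain v where v: "sob s x v" using sobolev_space_imp_sob[OF s] by (auto simp: regular_curves_def)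
    have pos: "norm (v t) > 0" for t using xr sob_vector_derivative[OF v] by (simp add: regular_curves_def)
    obtain c where c: "c > 0" "\<And>t w. t \<in> {0..1} \<Longrightarrow> w \<in> {-1/2..1/2} \<Longrightarrow> c * \<bar>w\<bar> \<le> norm (x (t + w) - x t)"
      using injective_regular_bilipschitz[OF v pos inj] by blast
    obtain r where r: "r > 0" "\<And>y. y \<in> sobolev_space s \<Longrightarrow> sobolev_norm s (y - x) < r \<Longrightarrow> y \<in> regular_curves s"
      using openin_regular_curves[OF s, where 'a = 'a] xr unfolding openin_norm_topology by blast
    have "y \<in> injective_regular_curves s" if y: "y \<in> sobolev_space s" "sobolev_norm s (y - x) < min r (c / C)" for y
    proof -
      obtain u where u: "sob s y u" using sobolev_space_imp_sob[OF s y(1)] ..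
      have yper: "periodic1 y" using u by (simp add: sob_def)
      have small: "C * sobolev_norm s (y - x) < c" using y(2) C0 by (simp add: field_simps)
      have ne: "y (t + w) \<noteq> y t" if t: "t \<in> {0..1}" and w: "w \<in> {-1/2..1/2}" "w \<noteq> 0" for t w
      proof
        assume eq: "y (t + w) = y t"
        have "norm ((y - x) (t + w) - (y - x) t) \<le> C * sobolev_norm s (y - x) * \<bar>t + w - t\<bar>"
          using bd sob_diff[OF u v] by (intro sob_lipschitz[OF sob_diff[OF u v]]) (auto simp: hs_bd_def)
        then have "norm (x (t + w) - x t) \<le> C * sobolev_norm s (y - x) * \<bar>w\<bar>"
          using eq by (simp add: norm_minus_commute)
        also have "\<dots> < c * \<bar>w\<bar>" using small w(2) by simp
        finally show False using c(2)[OF t w(1)] by simp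
      qed
      have "inj_on y {0..<1}"
      proof (rule inj_onI, rule ccontr)
        fix a b assume ab: "a \<in> {0..<1}" "b \<in> {0..<1}" "y a = y b" "a \<noteq> b"
        define w where "w = (if b - a > 1/2 then b - a - 1 else if b - a < -1/2 then b - a + 1 else b - a)"
        have "w \<in> {-1/2..1/2}" "w \<noteq> 0" using ab by (auto simp: w_def)
        moreover have "y (a + w) = y b"
        proof -
          have "y (b - 1 + 1) = y (b - 1)" "y (b + 1) = y b" using yper unfolding periodic1_def by blast+
          then show ?thesis by (simp add: w_def add.commute)
        qed
        ultimately show False using ne[of a w] ab by simp
      qed
      then show ?thesis using r(2)[of y] y by (simp add: injective_regular_curves_def)
    qed
    then show "\<exists>r>0. \<forall>y\<in>sobolev_space s. sobolev_norm s (y - x) < r \<longrightarrow> y \<in> injective_regular_curves s"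
      using r(1) c(1) C0 by (intro exI[of _ "min r (c / C)"]) auto
  qed
qed

section \<open>Curves parametrised by arc length\<close>

text \<open>The vanishing mean makes the indefinite integral a closed curve.\<close>

lemma sob_primitive:
  fixes u :: "real \<Rightarrow> 'a::euclidean_space"
  assumes u: "hs_regular s u" and mean: "integral {0..1} u = 0"
  shows "\<exists>x. sob s x u \<and> x 0 = 0"
proof -
  have uc: "continuous_on UNIV u" and ul: "u \<in> l2_periodic" using u hs_regular_l2 by (auto simp: hs_regular_def)
  note ui = l2_integrable[OF ul]
  define F where "F t = (LINT r:{0..t}|lborel. u r)" for t
  have F_cont: "continuous_on {0..1} F" unfolding F_def[abs_def] by (rule continuous_primitive[OF ui])
  have F01: "F 0 = 0" "F 1 = 0" using set_borel_integral_eq_integral(2)[OF ui] mean by (simp_all add: F_def)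
  define x where "x t = F (frac t)" for t
  have x: "continuous_on UNIV x" "periodic1 x"
    unfolding x_def[abs_def] using F_cont F01 by (auto intro: periodic_extension_continuous)
  have xF: "x t = F t" if "t \<in> {0..1}" for t
    using that F01 by (cases "t = 1") (auto simp: x_def frac_eq[THEN iffD2])
  have "has_weak_deriv x u"
    by (rule has_weak_deriv_primitive[OF x ul]) (use xF F01 in \<open>auto simp: F_def\<close>)
  then have "(x has_vector_derivative u t) (at t)" for t by (rule C1_of_continuous_weak_deriv[OF x(1) uc])
  then have "sob s x u" using x u by (simp add: sob_def)
  moreover have "x 0 = 0" using xF[of 0] F01 by simp
  ultimately show ?thesis by blast
qed

lemma hs_bd_continuous: "hs_bd s f M \<Longrightarrow> continuous_on A f"
  unfolding hs_bd_def hs_regular_def by (blast intro: continuous_on_subset)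

lemma hs_bd_integrable: "hs_bd s f M \<Longrightarrow> f integrable_on {0..1::real}"
  by (intro integrable_continuous_interval hs_bd_continuous)

lemma norm_integral_hs_bd: "hs_bd s f M \<Longrightarrow> norm (integral {0..1} f) \<le> M"
  using integral_bound[of 0 1 f M] hs_bd_continuous[of s f M "{0..1}"] by (auto simp: hs_bd_def)

lemma sobolev_norm_le_of_hs_bd:
  fixes x :: "real \<Rightarrow> 'a::euclidean_space"
  assumes sob: "sob s x u" and 0: "x 0 = 0" and u: "hs_bd s u M"
  shows "sobolev_norm s x \<le> 2 * M"
proof (rule power2_le_imp_le)
  have M: "0 \<le> M" by (rule hs_bd_nonneg[OF u])
  have "norm (x t) \<le> M" if t: "t \<in> {0..1}" for t
  proof -
    have "norm (x t - x 0) \<le> M * \<bar>t - 0\<bar>" by (rule sob_lipschitz[OF sob]) (use u in \<open>simp add: hs_bd_def\<close>)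
    also have "\<dots> \<le> M * 1" using t M by (intro mult_left_mono) auto
    finally show ?thesis using 0 by simp
  qed
  then have "l2_sq x \<le> ennreal (M\<^sup>2)" by (rule l2_sq_le)
  moreover have "l2_sq u \<le> ennreal (M\<^sup>2)" by (rule l2_sq_le) (use u in \<open>simp add: hs_bd_def\<close>)
  moreover have "hs_sq s u \<le> ennreal (M\<^sup>2)" using u by (simp add: hs_bd_def)
  ultimately have "ennreal ((sobolev_norm s x)\<^sup>2) \<le> ennreal (M\<^sup>2) + ennreal (M\<^sup>2) + ennreal (M\<^sup>2)"
    unfolding sob_norm_sq[OF sob] by (intro add_mono)
  also have "\<dots> = ennreal (3 * M\<^sup>2)" by (simp flip: ennreal_plus)
  also have "\<dots> \<le> ennreal ((2 * M)\<^sup>2)" by (intro ennreal_leI) (simp add: power_mult_distrib)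
  finally show "(sobolev_norm s x)\<^sup>2 \<le> (2 * M)\<^sup>2" by (subst (asm) ennreal_le_iff) auto
  show "0 \<le> 2 * M" using M by simp
qed

lemmas hs_bd_inner = hs_bd_prod[OF bounded_bilinear_inner, simplified, OF Cauchy_Schwarz_ineq2]
lemmas hs_bd_scaleR_fun = hs_bd_prod[OF bounded_bilinear_scaleR, simplified]

locale unit_speed_curve =
  fixes s :: real and \<gamma> g :: "real \<Rightarrow> 'a::euclidean_space"
  assumes s: "1/2 < s" "s \<le> 1" and sob_\<gamma>: "sob s \<gamma> g" and unit: "\<And>t. norm (g t) = 1"
begin

abbreviation E :: "(real \<Rightarrow> 'a) set" where "E \<equiv> sobolev_space s"
abbreviation N :: "(real \<Rightarrow> 'a) \<Rightarrow> real" where "N \<equiv> sobolev_norm s"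

definition D :: "(real \<Rightarrow> 'a) \<Rightarrow> real \<Rightarrow> 'a" where "D x t = vector_derivative x (at t)"

lemma D_eq: "sob s x v \<Longrightarrow> D x = v"
  by (auto simp: D_def sob_vector_derivative)

lemma sob_D: "x \<in> E \<Longrightarrow> sob s x (D x)"
  using sobolev_space_imp_sob[OF s] D_eq by metis

lemma g_inner [simp]: "g t \<bullet> g t = 1"
  using unit[of t] by (simp add: norm_eq_sqrt_inner)

text \<open>The component of a constant vector orthogonal to the curve; these fields correct means.\<close>

definition tang :: "'a \<Rightarrow> real \<Rightarrow> 'a" where "tang c t = c - (c \<bullet> g t) *\<^sub>R g t"

definition mean :: "(real \<Rightarrow> 'a) \<Rightarrow> 'a" where "mean h = integral {0..1} h"

lemma tang_linear: "tang (c + c') t = tang c t + tang c' t" "tang (a *\<^sub>R c) t = a *\<^sub>R tang c t" "tang 0 t = 0"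
  by (simp_all add: tang_def inner_add_left algebra_simps)

lemma tang_g [simp]: "tang c t \<bullet> g t = 0"
  by (simp add: tang_def inner_diff_left)

lemma hs_bd_g: "\<exists>K. hs_bd s g K"
  using sob_bounds[OF s, where 'a = 'a] sob_\<gamma> by blast

lemma hs_bd_tang: "\<exists>K. \<forall>c. hs_bd s (tang c) (K * norm c)"
proof -
  obtain K where K: "hs_bd s g K" using hs_bd_g ..
  have "hs_bd s (tang c) ((2 * (1 + 4 * K * K)) * norm c)" for c
  proof -
    have "hs_bd s (\<lambda>t. c - (c \<bullet> g t) *\<^sub>R g t) (2 * (norm c + 2 * (2 * norm c * K) * K))"
      by (intro hs_bd_diff hs_bd_const hs_bd_scaleR_fun hs_bd_inner K)
    then show ?thesis by (simp add: tang_def[abs_def] algebra_simps)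
  qed
  then show ?thesis by blast
qed

lemma tang_integrable: "tang c integrable_on {0..1}"
  using hs_bd_tang hs_bd_integrable by blast

text \<open>If \<open>tang c\<close> has mean zero, so has \<open>tang c t \<bullet> c = \<bar>c\<bar>\<^sup>2 - (c \<bullet> g t)\<^sup>2\<close>, which is nonnegative.  Hence it vanishes everywhere.
But \<open>c \<bullet> g\<close> is the derivative of the periodic function \<open>c \<bullet> \<gamma>\<close> and has a zero.\<close>

lemma mean_tang_inj:
  assumes 0: "mean (tang c) = 0"
  shows "c = 0"
proof -
  have cont: "continuous_on {0..1} (tang c)" using hs_bd_tang hs_bd_continuous by blast
  have "integral {0..1} ((\<lambda>x. x \<bullet> c) \<circ> tang c) = integral {0..1} (tang c) \<bullet> c"
    by (intro integral_linear tang_integrable bounded_linear_inner_left)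
  then have "integral {0..1} (\<lambda>t. tang c t \<bullet> c) = 0" using 0 by (simp add: o_def mean_def)
  moreover have nn: "0 \<le> tang c t \<bullet> c" for t
  proof -
    have "(c \<bullet> g t)\<^sup>2 \<le> (c \<bullet> c) * (g t \<bullet> g t)" by (rule Cauchy_Schwarz_ineq)
    moreover have "tang c t \<bullet> c = c \<bullet> c - (c \<bullet> g t)\<^sup>2"
      by (simp add: tang_def inner_diff_left power2_eq_square inner_commute[of "g t" c])
    ultimately show ?thesis by simp
  qed
  moreover have "continuous_on {0..1} (\<lambda>t. tang c t \<bullet> c)"
    using cont by (intro continuous_on_inner continuous_on_const)
  ultimately have zero: "tang c t \<bullet> c = 0" if "t \<in> {0..1}" for t
    using integral_eq_0_iff[of 0 1 "\<lambda>t. tang c t \<bullet> c"] that by simp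
  have "((\<lambda>t. c \<bullet> \<gamma> t) has_vector_derivative c \<bullet> g t) (at t)" for t
    by (rule bounded_linear.has_vector_derivative[OF bounded_linear_inner_right]) (use sob_\<gamma> in \<open>simp add: sob_def\<close>)
  then have der: "((\<lambda>t. c \<bullet> \<gamma> t) has_real_derivative c \<bullet> g t) (at t)" for t
    by (simp add: has_real_derivative_iff_has_vector_derivative)
  have "\<exists>z>0. z < 1 \<and> ((\<lambda>t. c \<bullet> \<gamma> t) has_real_derivative 0) (at z)"
  proof (rule Rolle)
    have "\<gamma> 0 = \<gamma> 1" using sob_\<gamma> unfolding sob_def periodic1_def by (metis add_0)
    then show "c \<bullet> \<gamma> 0 = c \<bullet> \<gamma> 1" by simp
    show "continuous_on {0..1} (\<lambda>t. c \<bullet> \<gamma> t)"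
      using der DERIV_isCont by (intro continuous_at_imp_continuous_on) blast
    show "(\<lambda>t. c \<bullet> \<gamma> t) differentiable at x" for x using der real_differentiable_def by blast
  qed simp
  then obtain z where z: "0 < z" "z < 1" "((\<lambda>t. c \<bullet> \<gamma> t) has_real_derivative 0) (at z)" by blast
  have "c \<bullet> g z = 0" using DERIV_unique[OF der z(3)] .
  moreover have "tang c z \<bullet> c = 0" using zero z by simp
  ultimately show "c = 0" by (simp add: tang_def)
qed

lemma mean_tang_linear: "linear (\<lambda>c. mean (tang c))"
proof (rule linearI)
  show "mean (tang (c + c')) = mean (tang c) + mean (tang c')" for c c'
    unfolding mean_def tang_linear(1)[abs_def] by (intro integral_add tang_integrable)
  show "mean (tang (a *\<^sub>R c)) = a *\<^sub>R mean (tang c)" for a c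
    unfolding mean_def tang_linear(2)[abs_def] by simp
qed

definition Ainv :: "'a \<Rightarrow> 'a" where
  "Ainv = (SOME f. linear f \<and> (\<forall>c. mean (tang (f c)) = c))"

lemma Ainv: "linear Ainv" "mean (tang (Ainv c)) = c"
proof -
  have "inj (\<lambda>c. mean (tang c))"
    using linear_injective_0[OF mean_tang_linear] mean_tang_inj by blast
  then have "\<exists>f. linear f \<and> (\<forall>c. mean (tang (f c)) = c)"
    using linear_injective_isomorphism[OF mean_tang_linear] by blast
  from someI_ex[OF this] show "linear Ainv" "mean (tang (Ainv c)) = c" unfolding Ainv_def by blast+
qed

text \<open>The corrected field has mean zero and the same component along \<open>g\<close> as \<open>h\<close>.\<close>

definition cor :: "(real \<Rightarrow> 'a) \<Rightarrow> real \<Rightarrow> 'a" where "cor h t = h t - tang (Ainv (mean h)) t"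

lemma cor_g: "cor h t \<bullet> g t = h t \<bullet> g t"
  by (simp add: cor_def inner_diff_left)

lemma hs_bd_cor: "\<exists>K\<ge>0. \<forall>h M. hs_bd s h M \<longrightarrow> hs_bd s (cor h) (K * M)"
proof -
  obtain K where K: "\<And>c. hs_bd s (tang c) (K * norm c)" using hs_bd_tang by blast
  have K0: "0 \<le> K"
  proof -
    obtain b :: 'a where "b \<in> Basis" using nonempty_Basis by blast
    then show ?thesis using hs_bd_nonneg[OF K[of b]] by simp
  qed
  obtain L where L: "L > 0" "\<And>c. norm (Ainv c) \<le> L * norm c" using linear_bounded_pos[OF Ainv(1)] by blast
  have "hs_bd s (cor h) (2 * (1 + K * L) * M)" if h: "hs_bd s h M" for h M
  proof -
    have M: "0 \<le> M" by (rule hs_bd_nonneg[OF h])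
    have "norm (Ainv (mean h)) \<le> L * norm (mean h)" by (rule L(2))
    also have "\<dots> \<le> L * M" unfolding mean_def using L(1) norm_integral_hs_bd[OF h] by (intro mult_left_mono) auto
    finally have "K * norm (Ainv (mean h)) \<le> K * (L * M)" using K0 by (rule mult_left_mono)
    then have "hs_bd s (tang (Ainv (mean h))) (K * (L * M))" by (rule hs_bd_mono[OF K])
    from hs_bd_diff[OF h this] show ?thesis by (simp add: cor_def[abs_def] algebra_simps)
  qed
  then show ?thesis using K0 L(1) by (intro exI[of _ "2 * (1 + K * L)"]) auto
qed

lemma mean_cor:
  assumes h: "hs_bd s h M"
  shows "mean (cor h) = 0"
proof -
  have "integral {0..1} (\<lambda>t. h t - tang (Ainv (mean h)) t) = integral {0..1} h - integral {0..1} (tang (Ainv (mean h)))"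
    by (rule integral_diff[OF hs_bd_integrable[OF h] tang_integrable])
  moreover have "cor h = (\<lambda>t. h t - tang (Ainv (mean h)) t)" by (simp add: fun_eq_iff cor_def)
  ultimately have "mean (cor h) = mean h - mean (tang (Ainv (mean h)))" by (simp add: mean_def)
  then show ?thesis by (simp add: Ainv)
qed

text \<open>The closed curve that starts at the origin and has the derivative \<open>cor h\<close>.\<close>

definition J :: "(real \<Rightarrow> 'a) \<Rightarrow> real \<Rightarrow> 'a" where
  "J h = (SOME x. sob s x (cor h) \<and> x 0 = 0)"

lemma J:
  assumes h: "hs_bd s h M"
  shows "sob s (J h) (cor h)" "J h 0 = 0"
proof -
  have "hs_regular s (cor h)" using hs_bd_cor h unfolding hs_bd_def by blast
  from someI_ex[OF sob_primitive[OF this]] mean_cor[OF h]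
  show "sob s (J h) (cor h)" "J h 0 = 0" unfolding J_def mean_def by blast+
qed

lemma J_eqI:
  assumes "hs_bd s h M" "sob s x (cor h)" "x 0 = 0"
  shows "J h = x"
  by (rule sob_eqI[OF J(1)[OF assms(1)] assms(2)]) (simp add: J(2)[OF assms(1)] assms(3))

lemma N_J: "\<exists>K\<ge>0. \<forall>h M. hs_bd s h M \<longrightarrow> N (J h) \<le> K * M"
proof -
  obtain K where K: "K \<ge> 0" "\<And>h M. hs_bd s h M \<Longrightarrow> hs_bd s (cor h) (K * M)" using hs_bd_cor by blast
  have "N (J h) \<le> (2 * K) * M" if "hs_bd s h M" for h M
    using sobolev_norm_le_of_hs_bd[OF J[OF that] K(2)[OF that]] by simp
  then show ?thesis using K(1) by (intro exI[of _ "2 * K"]) auto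
qed

lemma J_E: "hs_bd s h M \<Longrightarrow> J h \<in> E"
  by (rule sob_imp_sobolev_space[OF J(1)])

lemma J_add:
  assumes h: "hs_bd s h M" and h': "hs_bd s h' M'"
  shows "J (\<lambda>t. h t + h' t) = J h + J h'"
proof (rule J_eqI[OF hs_bd_add[OF h h']])
  have "mean (\<lambda>t. h t + h' t) = mean h + mean h'"
    unfolding mean_def by (intro integral_add hs_bd_integrable[OF h] hs_bd_integrable[OF h'])
  then have "cor (\<lambda>t. h t + h' t) = (\<lambda>t. cor h t + cor h' t)"
    by (auto simp: cor_def linear_add[OF Ainv(1)] tang_linear)
  then show "sob s (J h + J h') (cor (\<lambda>t. h t + h' t))" using sob_add[OF J(1)[OF h] J(1)[OF h']] by simp
  show "(J h + J h') 0 = 0" using J(2)[OF h] J(2)[OF h'] by simp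
qed

lemma J_scaleR:
  assumes h: "hs_bd s h M"
  shows "J (\<lambda>t. a *\<^sub>R h t) = a *\<^sub>R J h"
proof (rule J_eqI[OF hs_bd_scaleR[OF h]])
  have "mean (\<lambda>t. a *\<^sub>R h t) = a *\<^sub>R mean h" unfolding mean_def by simp
  then have "cor (\<lambda>t. a *\<^sub>R h t) = (\<lambda>t. a *\<^sub>R cor h t)"
    by (auto simp: cor_def linear_scale[OF Ainv(1)] tang_linear scaleR_diff_right)
  then show "sob s (a *\<^sub>R J h) (cor (\<lambda>t. a *\<^sub>R h t))" using sob_scaleR[OF J(1)[OF h]] by simp
  show "(a *\<^sub>R J h) 0 = 0" using J(2)[OF h] by (simp add: scaleR_fun_def)
qed

lemma hs_bd_D: "\<exists>C>0. \<forall>x\<in>E. hs_bd s (D x) (C * N x)"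
proof -
  obtain C where "C > 0" "\<forall>(x :: real \<Rightarrow> 'a) v. sob s x v \<longrightarrow>
      hs_bd s v (C * sobolev_norm s x) \<and> (\<forall>t. norm (x t) \<le> C * sobolev_norm s x)"
    using sob_bounds[OF s, where 'a = 'a] by blast
  then show ?thesis using sob_D by (intro exI[of _ C]) simp
qed

lemma D_add: "x \<in> E \<Longrightarrow> y \<in> E \<Longrightarrow> D (x + y) t = D x t + D y t"
  using D_eq[OF sob_add[OF sob_D sob_D]] by simp

lemma D_scaleR: "x \<in> E \<Longrightarrow> D (a *\<^sub>R x) t = a *\<^sub>R D x t"
  using D_eq[OF sob_scaleR[OF sob_D]] by simp

lemma D_J: "hs_bd s h M \<Longrightarrow> D (J h) = cor h"
  by (rule D_eq[OF J(1)])

text \<open>The quadratic part of the chart: its derivative has the component \<open>(D x t \<bullet> D x t) / 2\<close> along \<open>g\<close>.\<close>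

definition B :: "(real \<Rightarrow> 'a) \<Rightarrow> (real \<Rightarrow> 'a) \<Rightarrow> real \<Rightarrow> 'a" where
  "B x y = (1 / 2) *\<^sub>R J (\<lambda>t. (D x t \<bullet> D y t) *\<^sub>R g t)"

text \<open>A projection of the whole space onto the curves that start at the origin and have a derivative orthogonal to \<open>g\<close>.\<close>

definition proj :: "(real \<Rightarrow> 'a) \<Rightarrow> real \<Rightarrow> 'a" where
  "proj x = J (\<lambda>t. D x t - (D x t \<bullet> g t) *\<^sub>R g t)"

lemma hs_bd_speed: "\<exists>K\<ge>0. \<forall>x\<in>E. \<forall>y\<in>E. hs_bd s (\<lambda>t. (D x t \<bullet> D y t) *\<^sub>R g t) (K * N x * N y)"
proof -
  obtain C where C: "C > 0" "\<And>x. x \<in> E \<Longrightarrow> hs_bd s (D x) (C * N x)" using hs_bd_D by blast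
  obtain K where K: "hs_bd s g K" using hs_bd_g ..
  have "hs_bd s (\<lambda>t. (D x t \<bullet> D y t) *\<^sub>R g t) (4 * C * C * K * N x * N y)" if "x \<in> E" "y \<in> E" for x y
    using hs_bd_scaleR_fun[OF hs_bd_inner[OF C(2)[OF that(1)] C(2)[OF that(2)]] K] by (simp add: mult_ac)
  then show ?thesis using C(1) hs_bd_nonneg[OF K] by (intro exI[of _ "4 * C * C * K"]) auto
qed

lemma hs_bd_tangential_part: "\<exists>K\<ge>0. \<forall>x\<in>E. hs_bd s (\<lambda>t. D x t - (D x t \<bullet> g t) *\<^sub>R g t) (K * N x)"
proof -
  obtain C where C: "C > 0" "\<And>x. x \<in> E \<Longrightarrow> hs_bd s (D x) (C * N x)" using hs_bd_D by blast
  obtain K where K: "hs_bd s g K" using hs_bd_g ..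
  have "hs_bd s (\<lambda>t. D x t - (D x t \<bullet> g t) *\<^sub>R g t) (2 * (C + 4 * C * K * K) * N x)" if "x \<in> E" for x
    using hs_bd_diff[OF C(2)[OF that] hs_bd_scaleR_fun[OF hs_bd_inner[OF C(2)[OF that] K] K]]
    by (simp add: algebra_simps)
  then show ?thesis using C(1) hs_bd_nonneg[OF K] by (intro exI[of _ "2 * (C + 4 * C * K * K)"]) auto
qed

lemma quadratic_perturbation_B: "\<exists>b. quadratic_perturbation E N B b"
proof -
  interpret banach_subspace E N by (rule banach_sobolev_space[OF s])
  obtain K where K: "K \<ge> 0" "\<And>x y. x \<in> E \<Longrightarrow> y \<in> E \<Longrightarrow> hs_bd s (\<lambda>t. (D x t \<bullet> D y t) *\<^sub>R g t) (K * N x * N y)"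
    using hs_bd_speed by blast
  obtain L where L: "L \<ge> 0" "\<And>h M. hs_bd s h M \<Longrightarrow> N (J h) \<le> L * M" using N_J by blast
  have BE: "B x y \<in> E" if "x \<in> E" "y \<in> E" for x y
    unfolding B_def by (intro E_scale J_E[OF K(2)[OF that]])
  have "quadratic_perturbation E N B (L * K + 1)"
  proof
    show "B x y = B y x" for x y by (simp add: B_def inner_commute)
    show "B x (y + z) = B x y + B x z" if "x \<in> E" "y \<in> E" "z \<in> E" for x y z
    proof -
      have "(\<lambda>t. (D x t \<bullet> D (y + z) t) *\<^sub>R g t) = (\<lambda>t. (D x t \<bullet> D y t) *\<^sub>R g t + (D x t \<bullet> D z t) *\<^sub>R g t)"
        using that by (simp add: D_add inner_add_right scaleR_add_left)
      then show ?thesis unfolding B_def using J_add[OF K(2)[OF that(1,2)] K(2)[OF that(1,3)]]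
        by (simp add: scaleR_add_right)
    qed
    show "B x (c *\<^sub>R y) = c *\<^sub>R B x y" if "x \<in> E" "y \<in> E" for x y c
    proof -
      have "(\<lambda>t. (D x t \<bullet> D (c *\<^sub>R y) t) *\<^sub>R g t) = (\<lambda>t. c *\<^sub>R ((D x t \<bullet> D y t) *\<^sub>R g t))"
        using that by (simp add: D_scaleR)
      then show ?thesis unfolding B_def using J_scaleR[OF K(2)[OF that], of c] by simp
    qed
    show "N (B x y) \<le> (L * K + 1) * N x * N y" if "x \<in> E" "y \<in> E" for x y
    proof -
      have "N (J (\<lambda>t. (D x t \<bullet> D y t) *\<^sub>R g t)) \<le> L * (K * N x * N y)" by (rule L(2)[OF K(2)[OF that]])
      then have "N (B x y) \<le> (1/2) * (L * (K * N x * N y))"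
        unfolding B_def using N_scale[OF J_E[OF K(2)[OF that]], of "1/2"] by simp
      also have "\<dots> \<le> (L * K + 1) * N x * N y"
        using L(1) K(1) by (simp add: algebra_simps add_nonneg_nonneg)
      finally show ?thesis .
    qed
  qed (use BE L(1) K(1) in \<open>auto intro: add_nonneg_pos\<close>)
  then show ?thesis ..
qed

lemma proj_fixed_iff:
  assumes x: "x \<in> E"
  shows "proj x = x \<longleftrightarrow> x 0 = 0 \<and> (\<forall>t. D x t \<bullet> g t = 0)"
proof -
  obtain M where M: "hs_bd s (\<lambda>t. D x t - (D x t \<bullet> g t) *\<^sub>R g t) M" using hs_bd_tangential_part x by blast
  show ?thesis
  proof
    assume eq: "proj x = x"
    have "x 0 = 0" using J(2)[OF M] eq by (simp add: proj_def)
    moreover have "D x t \<bullet> g t = 0" for t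
    proof -
      have "D (proj x) t \<bullet> g t = (D x t - (D x t \<bullet> g t) *\<^sub>R g t) \<bullet> g t"
        unfolding proj_def D_J[OF M] by (rule cor_g)
      then show ?thesis unfolding eq by (simp add: inner_diff_left)
    qed
    ultimately show "x 0 = 0 \<and> (\<forall>t. D x t \<bullet> g t = 0)" by blast
  next
    assume 0: "x 0 = 0 \<and> (\<forall>t. D x t \<bullet> g t = 0)"
    then have tan: "(\<lambda>t. D x t - (D x t \<bullet> g t) *\<^sub>R g t) = D x" by simp
    note l2 = has_weak_deriv_l2(2)[OF sob_weak[OF sob_D[OF x]]]
    have "mean (D x) = 0"
      using weak_deriv_integral_zero[OF sob_weak[OF sob_D[OF x]]] set_borel_integral_eq_integral(2)[OF l2_integrable[OF l2]]
      by (simp add: mean_def)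
    then have "cor (D x) = D x" by (auto simp: cor_def linear_0[OF Ainv(1)] tang_linear)
    then show "proj x = x" unfolding proj_def using J_eqI[OF M] tan sob_D[OF x] 0 by simp
  qed
qed

lemma complemented_tangential: "complemented_subspace E N {x \<in> E. proj x = x}"
proof -
  interpret banach_subspace E N by (rule banach_sobolev_space[OF s])
  obtain K where K: "K \<ge> 0" "\<And>x. x \<in> E \<Longrightarrow> hs_bd s (\<lambda>t. D x t - (D x t \<bullet> g t) *\<^sub>R g t) (K * N x)"
    using hs_bd_tangential_part by blast
  obtain L where L: "L \<ge> 0" "\<And>h M. hs_bd s h M \<Longrightarrow> N (J h) \<le> L * M" using N_J by blast
  show ?thesis
  proof (rule complemented_range_of_projection[where c = "L * K"])
    show "proj (x + y) = proj x + proj y" if "x \<in> E" "y \<in> E" for x y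
    proof -
      have "(\<lambda>t. D (x + y) t - (D (x + y) t \<bullet> g t) *\<^sub>R g t)
          = (\<lambda>t. (D x t - (D x t \<bullet> g t) *\<^sub>R g t) + (D y t - (D y t \<bullet> g t) *\<^sub>R g t))"
        using that by (simp add: D_add inner_add_left algebra_simps)
      then show ?thesis unfolding proj_def using J_add[OF K(2)[OF that(1)] K(2)[OF that(2)]] by simp
    qed
    show "proj (a *\<^sub>R x) = a *\<^sub>R proj x" if "x \<in> E" for x a
    proof -
      have "(\<lambda>t. D (a *\<^sub>R x) t - (D (a *\<^sub>R x) t \<bullet> g t) *\<^sub>R g t)
          = (\<lambda>t. a *\<^sub>R (D x t - (D x t \<bullet> g t) *\<^sub>R g t))"
        using that by (simp add: D_scaleR scaleR_diff_right)
      then show ?thesis unfolding proj_def using J_scaleR[OF K(2)[OF that]] by simp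
    qed
    show bd: "proj x \<in> E \<and> N (proj x) \<le> L * K * N x" if "x \<in> E" for x
      unfolding proj_def using J_E[OF K(2)[OF that]] L(2)[OF K(2)[OF that]] by (simp add: mult.assoc)
    show "proj (proj x) = proj x" if x: "x \<in> E" for x
    proof -
      have "D (proj x) t \<bullet> g t = 0" for t
        unfolding proj_def D_J[OF K(2)[OF x]] cor_g by (simp add: inner_diff_left)
      moreover have "proj x 0 = 0" unfolding proj_def by (rule J(2)[OF K(2)[OF x]])
      ultimately show ?thesis using proj_fixed_iff[of "proj x"] bd[OF x] by blast
    qed
  qed
qed

text \<open>With \<open>y = x - \<gamma>\<close>, the identity \<open>\<bar>g + D y\<bar>\<^sup>2 = 1 + 2 * (D y \<bullet> g) + \<bar>D y\<bar>\<^sup>2\<close> shows that \<open>x\<close> has unit speed if and only if the derivative of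
\<open>y + B y y\<close> is orthogonal to \<open>g\<close>.\<close>

lemma straightened:
  assumes x: "x \<in> E"
  shows "x \<in> arclength_curves s (\<gamma> 0) \<longleftrightarrow> (x - \<gamma>) + B (x - \<gamma>) (x - \<gamma>) \<in> {x \<in> E. proj x = x}"
proof -
  interpret banach_subspace E N by (rule banach_sobolev_space[OF s])
  have \<gamma>E: "\<gamma> \<in> E" using sob_\<gamma> by (rule sob_imp_sobolev_space)
  define y where "y = x - \<gamma>"
  have y: "y \<in> E" using x \<gamma>E by (simp add: y_def)
  obtain M where M: "hs_bd s (\<lambda>t. (D y t \<bullet> D y t) *\<^sub>R g t) M" using hs_bd_speed y by blast
  define z where "z = y + B y y"
  have By: "B y y \<in> E" unfolding B_def by (intro E_scale J_E[OF M])
  have z: "z \<in> E" using y By by (simp add: z_def)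
  have Dx: "D x t = g t + D y t" for t
    using D_add[OF \<gamma>E y, of t] D_eq[OF sob_\<gamma>] by (simp add: y_def)
  have "D z t \<bullet> g t = D y t \<bullet> g t + (1 / 2) * (D y t \<bullet> D y t)" for t
    unfolding z_def D_add[OF y By] unfolding B_def D_scaleR[OF J_E[OF M]] D_J[OF M] by (simp add: inner_add_left cor_g)
  moreover have "(norm (D x t))\<^sup>2 = 1 + 2 * (D y t \<bullet> g t) + D y t \<bullet> D y t" for t
    unfolding Dx power2_norm_eq_inner by (simp add: inner_add_left inner_add_right inner_commute)
  ultimately have "norm (D x t) = 1 \<longleftrightarrow> D z t \<bullet> g t = 0" for t
    using abs_square_eq_1[of "norm (D x t)"] by auto
  moreover have "z 0 = x 0 - \<gamma> 0"
    using J(2)[OF M] by (simp add: z_def B_def y_def scaleR_fun_def)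
  ultimately show ?thesis
    using proj_fixed_iff[OF z] x z unfolding z_def[symmetric] y_def[symmetric] arclength_curves_def D_def by auto
qed

end

text \<open>Injectivity is an open condition, so the same charts serve for both submanifolds.\<close>

theorem theorem3p2:
  fixes s :: real and z :: "real ^ 'n"
  assumes "CARD('n) \<ge> 2" and "1/2 < s" and "s \<le> 1"
  shows "smooth_submanifold (sobolev_space s) (sobolev_norm s)
           (regular_curves s) (arclength_curves s z) \<and>
         smooth_submanifold (sobolev_space s) (sobolev_norm s)
           (injective_regular_curves s) (injective_arclength_curves s z)"
proof -
  note s = assms(2,3)
  let ?E = "sobolev_space s :: (real \<Rightarrow> real ^ 'n) set"
  interpret banach_subspace ?E "sobolev_norm s" by (rule banach_sobolev_space[OF s])
  have chart: "\<exists>B b F. quadratic_perturbation ?E (sobolev_norm s) B b \<and> complemented_subspace ?E (sobolev_norm s) F \<and>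
      (\<forall>x\<in>?E. x \<in> U \<longrightarrow> (x \<in> M \<longleftrightarrow> (x - p) + B (x - p) (x - p) \<in> F))"
    if p: "p \<in> arclength_curves s z" and M: "\<And>x. x \<in> U \<Longrightarrow> x \<in> M \<longleftrightarrow> x \<in> arclength_curves s z" for p U M
  proof -
    have pE: "p \<in> ?E" and p0: "p 0 = z" and p1: "norm (vector_derivative p (at t)) = 1" for t
      using p by (simp_all add: arclength_curves_def)
    obtain g where g: "sob s p g" using sobolev_space_imp_sob[OF s pE] ..
    interpret unit_speed_curve s p g
      by unfold_locales (use s g p1 sob_vector_derivative[OF g] in simp_all)
    obtain b where b: "quadratic_perturbation ?E (sobolev_norm s) B b" using quadratic_perturbation_B ..
    show ?thesis
    proof (intro exI conjI ballI impI)
      show "quadratic_perturbation ?E (sobolev_norm s) B b" by (rule b)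
      show "complemented_subspace ?E (sobolev_norm s) {x \<in> ?E. proj x = x}" by (rule complemented_tangential)
      show "x \<in> M \<longleftrightarrow> (x - p) + B (x - p) (x - p) \<in> {x \<in> ?E. proj x = x}" if "x \<in> ?E" "x \<in> U" for x
        using straightened[OF that(1)] M[OF that(2)] p0 by (simp only:)
    qed
  qed
  have sub: "arclength_curves s z \<subseteq> regular_curves s"
  proof
    fix x assume x: "x \<in> arclength_curves s z"
    have "norm (vector_derivative x (at t)) = 1" for t using x by (simp add: arclength_curves_def)
    then have "0 < norm (vector_derivative x (at t))" for t by (simp only: zero_less_one)
    then show "x \<in> regular_curves s" using x by (simp add: arclength_curves_def regular_curves_def)
  qed
  have "smooth_submanifold ?E (sobolev_norm s) (regular_curves s) (arclength_curves s z)"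
    by (rule smooth_submanifoldI[OF openin_regular_curves[OF s] sub]) (rule chart; simp)
  moreover have "smooth_submanifold ?E (sobolev_norm s) (injective_regular_curves s) (injective_arclength_curves s z)"
  proof (rule smooth_submanifoldI[OF openin_injective_regular_curves[OF s]])
    show "injective_arclength_curves s z \<subseteq> injective_regular_curves s"
      using sub by (auto simp: injective_arclength_curves_def injective_regular_curves_def)
    have iff: "x \<in> injective_arclength_curves s z \<longleftrightarrow> x \<in> arclength_curves s z" if "x \<in> injective_regular_curves s" for x
      using that by (simp add: injective_arclength_curves_def injective_regular_curves_def)
    show "\<exists>B b F. quadratic_perturbation ?E (sobolev_norm s) B b \<and> complemented_subspace ?E (sobolev_norm s) F \<and>
        (\<forall>x\<in>?E. x \<in> injective_regular_curves s \<longrightarrow>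
          (x \<in> injective_arclength_curves s z \<longleftrightarrow> (x - p) + B (x - p) (x - p) \<in> F))"
      if "p \<in> injective_arclength_curves s z" for p
      by (rule chart[OF _ iff]) (use that in \<open>simp_all add: injective_arclength_curves_def\<close>)
  qed
  ultimately show ?thesis ..
qed

end
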